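(* Let $N \ge 0$ be an integer and let $F \colon \mathcal{W}_{[0,1]} \to \mathbb{R}$ be a class function which is continuous with respect to the $L^1$ norm and $N+1$ times Gâteaux differentiable. Then $F$ satisfies \[ d^{N+1} F(f; g_1, \dots, g_{N+1}) = 0 \qquad \text{for all } f \in \mathcal{W}_{[0,1]} \text{ and all } g_1, \dots, g_{N+1} \in \mathrm{Adm}(f) \] if and only if there exist real constants $c_H$, $H \in \mathcal{H}_{\le N}$, such that \[ F(f) = \sum_{H \in \mathcal{H}_{\le N}} c_H\, t(H, f) \qquad \text{for all } f \in \mathcal{W}_{[0,1]}. \] Moreover, in this case the constants $c_H$ are unique. If in addition $F$ is continuous with respect to the cut norm, then $c_H = 0$ for every $H \in \mathcal{H}_{\le N}$ that is not a simple graph.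
   Context: $\mathcal{W} \subset L^\infty([0,1]^2,\mathbb{R})$ is the set of bounded symmetric measurable functions $f \colon [0,1]^2 \to \mathbb{R}$ (symmetric: $f(x,y)=f(y,x)$ for all $x,y$), and $\mathcal{W}_{[0,1]} \subset \mathcal{W}$ is the set of those taking values in $[0,1]$ (graphons). The cut norm on $\mathcal{W}$ is $\|f\|_\square := \sup_{S,T} \left| \int_{S\times T} f(x,y)\,dx\,dy \right|$, with $S,T$ ranging over measurable subsets of $[0,1]$. For $g \in \mathcal{W}$ and a measure-preserving map $\phi\colon[0,1]\to[0,1]$, put $g^\phi(x,y) := g(\phi(x),\phi(y))$. The cut distance is $\delta_\square(f,g) := \inf_\phi \|f-g^\phi\|_\square$, with $\phi$ ranging over all measure-preserving maps. Write $f\sim g$ if $\delta_\square(f,g)=0$. A class function is a function $F\colon \mathcal{W}_{[0,1]}/{\sim} \to \mathbb{R}$, i.e. a function $F$ on $\mathcal{W}_{[0,1]}$ with $F(f)=F(g)$ whenever $f \sim g$. The admissible directions at $f\in\mathcal{W}_{[0,1]}$ are $\mathrm{Adm}(f) := \{ g\in\mathcal{W} : f+\epsilon g\in\mathcal{W}_{[0,1]} \text{ for some } \epsilon>0\}$. The Gâteaux derivative of $F$ at $f \in \mathcal{W}_{[0,1]}$ in direction $g\in\mathrm{Adm}(f)$ is the one-sided limit (if it exists) $dF(f;g) := \lim_{\lambda\to0^+} \frac1\lambda\left(F(f+\lambda g)-F(f)\right)$. Higher mixed Gâteaux derivatives are defined iteratively: $d^{k+1}F(f;g_1,\dots,g_{k+1})$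 is the Gâteaux derivative of $d^kF(-;g_1,\dots,g_k)$ at $f$ in the direction $g_{k+1}$, if the limit exists. $F$ is $N+1$ times Gâteaux differentiable if the derivatives $d^kF(f;g_1,\dots,g_k)$ exist for all $1 \le k\le N+1$, all $f\in\mathcal{W}_{[0,1]}$ and all $g_1,\dots,g_k\in\mathrm{Adm}(f)$. $\mathcal{H}_n$ is the set of isomorphism classes of multigraphs with exactly $n$ edges (counted with multiplicity), no isolated vertices and no self-loops, but possibly with multi-edges ($\mathcal{H}_0$ consists of the empty graph, with $t(H,\cdot)=1$). $\mathcal{H}_{\le n} := \bigcup_{j\le n}\mathcal{H}_j$. A multigraph is simple if it has no multi-edges. For such $H$ and $f\in\mathcal{W}$, the homomorphism density is \[ t(H,f) := \int_{[0,1]^{V(H)}} \prod_{ij\in E(H)} f(x_i,x_j)\prod_{i\in V(H)}dx_i, \] where $E(H)$ is the multiset of edges of $H$. *)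

theory Defs
  imports "HOL-Analysis.Analysis" "HOL-Library.Multiset"
begin

section \<open>Kernels, graphons and the cut distance\<close>

definition unit_interval :: "real measure" where
  "unit_interval = restrict_space lborel {0..1}"

definition unit_square :: "(real \<times> real) measure" where
  "unit_square = unit_interval \<Otimes>\<^sub>M unit_interval"

text \<open>
  A kernel is represented by a function on all of \<^typ>\<open>real \<times> real\<close>; only its values on the
  unit square matter.  Measurable means Borel measurable: every element of $L^\infty$ of the
  unit square has a Borel representative, and compositions such as $f(x_i,x_j)$ are then
  measurable for the uncompleted product measures of the library.
\<close>

type_synonym kernel = "real \<times> real \<Rightarrow> real"

definition kernels :: "kernel set" where
  "kernels = {f. f \<in> borel_measurable unit_square
      \<and> bounded (f ` ({0..1} \<times> {0..1}))
      \<and> (\<forall>x\<in>{0..1}. \<forall>y\<in>{0..1}. f (x, y) = f (y, x))}"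

definition graphons :: "kernel set" where
  "graphons = {f \<in> kernels. \<forall>z\<in>{0..1} \<times> {0..1}. f z \<in> {0..1}}"

definition L1_norm :: "kernel \<Rightarrow> real" where
  "L1_norm f = (LINT z|unit_square. \<bar>f z\<bar>)"

definition cut_norm :: "kernel \<Rightarrow> real" where
  "cut_norm f =
     (SUP (S, T) \<in> sets unit_interval \<times> sets unit_interval. \<bar>LINT z:S \<times> T|unit_square. f z\<bar>)"

definition measure_preserving_maps :: "(real \<Rightarrow> real) set" where
  "measure_preserving_maps =
     {\<phi> \<in> measurable unit_interval unit_interval.
        distr unit_interval unit_interval \<phi> = unit_interval}"

definition pullback :: "(real \<Rightarrow> real) \<Rightarrow> kernel \<Rightarrow> kernel" where
  "pullback \<phi> g = (\<lambda>(x, y). g (\<phi> x, \<phi> y))"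

definition cut_distance :: "kernel \<Rightarrow> kernel \<Rightarrow> real" where
  "cut_distance f g = (INF \<phi> \<in> measure_preserving_maps. cut_norm (\<lambda>z. f z - pullback \<phi> g z))"

definition class_function :: "(kernel \<Rightarrow> real) \<Rightarrow> bool" where
  "class_function F \<longleftrightarrow>
     (\<forall>f\<in>graphons. \<forall>g\<in>graphons. cut_distance f g = 0 \<longrightarrow> F f = F g)"

definition continuous_wrt :: "(kernel \<Rightarrow> real) \<Rightarrow> (kernel \<Rightarrow> real) \<Rightarrow> bool" where
  "continuous_wrt nrm F \<longleftrightarrow>
     (\<forall>f\<in>graphons. \<forall>\<epsilon>>0. \<exists>\<delta>>0. \<forall>g\<in>graphons. nrm (\<lambda>z. g z - f z) < \<delta> \<longrightarrow> \<bar>F g - F f\<bar> < \<epsilon>)"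


section \<open>Gateaux derivatives\<close>

definition Adm :: "kernel \<Rightarrow> kernel set" where
  "Adm f = {g \<in> kernels. \<exists>\<epsilon>>0. (\<lambda>z. f z + \<epsilon> * g z) \<in> graphons}"

definition has_gateaux_derivative ::
    "(kernel \<Rightarrow> real) \<Rightarrow> real \<Rightarrow> kernel \<Rightarrow> kernel \<Rightarrow> bool" where
  "has_gateaux_derivative F D f g \<longleftrightarrow>
     ((\<lambda>l. (F (\<lambda>z. f z + l * g z) - F f) / l) \<longlongrightarrow> D) (at_right 0)"

definition gateaux_derivative :: "(kernel \<Rightarrow> real) \<Rightarrow> kernel \<Rightarrow> kernel \<Rightarrow> real" where
  "gateaux_derivative F f g = (THE D. has_gateaux_derivative F D f g)"

text \<open>
  \<open>gateaux F g k f\<close> is $d^kF(f;g_1,\dots,g_k)$ with $g_{i+1}$ written \<open>g i\<close>; the entries \<open>g i\<close>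
  with \<open>i \<ge> k\<close> are not used.  If \<open>g i \<in> Adm f\<close> for all \<open>i \<le> k\<close> then, by convexity, \<open>g i\<close> is
  also admissible at \<open>f + l * g k\<close> for all small \<open>l > 0\<close>, so the limit defining the derivative
  of order \<open>k + 1\<close> only involves derivatives of order \<open>k\<close> in admissible directions.
\<close>

primrec gateaux :: "(kernel \<Rightarrow> real) \<Rightarrow> (nat \<Rightarrow> kernel) \<Rightarrow> nat \<Rightarrow> kernel \<Rightarrow> real" where
  "gateaux F g 0 = F"
| "gateaux F g (Suc k) = (\<lambda>f. gateaux_derivative (gateaux F g k) f (g k))"

definition times_gateaux_differentiable :: "nat \<Rightarrow> (kernel \<Rightarrow> real) \<Rightarrow> bool" where
  "times_gateaux_differentiable n F \<longleftrightarrow>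
     (\<forall>k<n. \<forall>f\<in>graphons. \<forall>g. (\<forall>i<Suc k. g i \<in> Adm f) \<longrightarrow>
        (\<exists>D. has_gateaux_derivative (gateaux F g k) D f (g k)))"


section \<open>Multigraphs and homomorphism densities\<close>

record multigraph =
  verts :: "nat set"
  edges :: "nat set multiset"

text \<open>Loops are excluded by requiring every edge to be a two-element set of vertices.\<close>

definition loopless_multigraph :: "multigraph \<Rightarrow> bool" where
  "loopless_multigraph G \<longleftrightarrow>
     finite (verts G) \<and> (\<forall>e\<in>#edges G. e \<subseteq> verts G \<and> card e = 2)"

definition no_isolated_vertices :: "multigraph \<Rightarrow> bool" where
  "no_isolated_vertices G \<longleftrightarrow> (\<forall>v\<in>verts G. \<exists>e\<in>#edges G. v \<in> e)"

definition simple_multigraph :: "multigraph \<Rightarrow> bool" where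
  "simple_multigraph G \<longleftrightarrow> (\<forall>e. count (edges G) e \<le> 1)"

definition multigraphs :: "nat \<Rightarrow> multigraph set" where
  "multigraphs n =
     {G. loopless_multigraph G \<and> no_isolated_vertices G \<and> size (edges G) = n}"

definition multigraph_iso :: "(multigraph \<times> multigraph) set" where
  "multigraph_iso = {(G, H). \<exists>\<phi>. bij_betw \<phi> (verts G) (verts H)
      \<and> image_mset (\<lambda>e. \<phi> ` e) (edges G) = edges H}"

definition multigraph_classes :: "nat \<Rightarrow> multigraph set set" where
  "multigraph_classes n =
     multigraphs n // (multigraph_iso \<inter> multigraphs n \<times> multigraphs n)"

definition multigraph_classes_upto :: "nat \<Rightarrow> multigraph set set" where
  "multigraph_classes_upto n = (\<Union>j\<le>n. multigraph_classes j)"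

lemma equiv_multigraph_iso: "equiv (multigraphs n) (multigraph_iso \<inter> multigraphs n \<times> multigraphs n)"
proof (rule equivI)
  show "multigraph_iso \<inter> multigraphs n \<times> multigraphs n \<subseteq> multigraphs n \<times> multigraphs n" by auto
  show "refl_on (multigraphs n) (multigraph_iso \<inter> multigraphs n \<times> multigraphs n)"
    by (auto simp: refl_on_def multigraph_iso_def intro!: exI[of _ id])
  show "sym (multigraph_iso \<inter> multigraphs n \<times> multigraphs n)"
  proof (rule symI)
    fix G H assume a: "(G, H) \<in> multigraph_iso \<inter> multigraphs n \<times> multigraphs n"
    then obtain p where p: "bij_betw p (verts G) (verts H)"
      "image_mset (\<lambda>e. p ` e) (edges G) = edges H" by (auto simp: multigraph_iso_def)
    have sub: "e \<subseteq> verts G" if "e \<in># edges G" for e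
      using a that by (auto simp: multigraphs_def loopless_multigraph_def)
    let ?q = "the_inv_into (verts G) p"
    have 1: "bij_betw ?q (verts H) (verts G)" using p bij_betw_the_inv_into by blast
    have "image_mset (\<lambda>e. ?q ` e) (edges H) = image_mset (\<lambda>e. ?q ` p ` e) (edges G)"
      by (simp flip: p(2) add: multiset.map_comp o_def)
    also have "\<dots> = image_mset (\<lambda>e. e) (edges G)"
    proof (rule image_mset_cong)
      fix e assume "e \<in># edges G"
      then have "x \<in> verts G" if "x \<in> e" for x using sub that by blast
      then show "?q ` p ` e = e"
        using p(1) by (force simp: bij_betw_def image_image the_inv_into_f_f)
    qed
    finally show "(H, G) \<in> multigraph_iso \<inter> multigraphs n \<times> multigraphs n"
      using 1 a by (auto simp: multigraph_iso_def)
  qed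
  show "trans (multigraph_iso \<inter> multigraphs n \<times> multigraphs n)"
  proof (rule transI)
    fix G H K assume "(G, H) \<in> multigraph_iso \<inter> multigraphs n \<times> multigraphs n"
     "(H, K) \<in> multigraph_iso \<inter> multigraphs n \<times> multigraphs n"
    then obtain p q where p: "bij_betw p (verts G) (verts H)"
      "image_mset (\<lambda>e. p ` e) (edges G) = edges H"
      "bij_betw q (verts H) (verts K)"
      "image_mset (\<lambda>e. q ` e) (edges H) = edges K" "G \<in> multigraphs n" "K \<in> multigraphs n"
      by (auto simp: multigraph_iso_def)
    have "bij_betw (q \<circ> p) (verts G) (verts K)" using p bij_betw_trans by blast
    moreover have "image_mset (\<lambda>e. (q \<circ> p) ` e) (edges G) = edges K"
      by (simp flip: p(2) p(4) add: multiset.map_comp o_def image_image)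
    ultimately show "(G, K) \<in> multigraph_iso \<inter> multigraphs n \<times> multigraphs n"
      using p(5,6) unfolding multigraph_iso_def by blast
  qed
qed

lemma finite_multigraph_classes: "finite (multigraph_classes n)"
proof -
  let ?R = "multigraph_iso \<inter> multigraphs n \<times> multigraphs n"
  let ?S = "{G \<in> multigraphs n. verts G \<subseteq> {..<2 * n}}"
  have card: "card (verts G) \<le> 2 * n" if "G \<in> multigraphs n" for G
  proof -
    have "verts G = (\<Union>e\<in>set_mset (edges G). e)"
      using that by (auto simp: multigraphs_def loopless_multigraph_def no_isolated_vertices_def)
    then have "card (verts G) \<le> (\<Sum>e\<in>set_mset (edges G). card e)"
      using card_UN_le[of "set_mset (edges G)" "\<lambda>e. e"] by simp
    also have "\<dots> = 2 * card (set_mset (edges G))"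
      using that by (simp add: multigraphs_def loopless_multigraph_def)
    finally have le: "card (verts G) \<le> 2 * card (set_mset (edges G))" .
    have "card (set_mset (edges G)) \<le> (\<Sum>e\<in>set_mset (edges G). count (edges G) e)"
      using sum_mono[of "set_mset (edges G)" "\<lambda>_. 1" "count (edges G)"] by (simp add: Suc_leI)
    also have "\<dots> = n"
      using that by (simp add: multigraphs_def size_multiset_overloaded_eq)
    finally show ?thesis using le by linarith
  qed
  have fin: "finite ?S"
  proof (rule finite_subset)
    show "?S \<subseteq> (\<lambda>(V, E). \<lparr>verts = V, edges = E\<rparr>) `
       (Pow {..<2 * n} \<times> {E. set_mset E \<subseteq> Pow {..<2 * n} \<and> size E = n})"
    proof
      fix G assume G: "G \<in> ?S"
      show "G \<in> (\<lambda>(V, E). \<lparr>verts = V, edges = E\<rparr>) `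
       (Pow {..<2 * n} \<times> {E. set_mset E \<subseteq> Pow {..<2 * n} \<and> size E = n})"
        using G by (intro image_eqI[of _ _ "(verts G, edges G)"])
          (fastforce simp: multigraphs_def loopless_multigraph_def)+
    qed
    show "finite ((\<lambda>(V, E). \<lparr>verts = V, edges = E\<rparr>) `
       (Pow {..<2 * n} \<times> {E. set_mset E \<subseteq> Pow {..<2 * n} \<and> size E = n}))"
      using finite_multisets_of_size[of "Pow {..<2 * n}" n]
      by (intro finite_imageI finite_cartesian_product) (auto simp: multisets_of_size_def)
  qed
  have "multigraph_classes n \<subseteq> (\<lambda>G. ?R `` {G}) ` ?S"
  proof
    fix C assume "C \<in> multigraph_classes n"
    then obtain G where G: "G \<in> multigraphs n" "C = ?R `` {G}"
      by (auto simp: multigraph_classes_def elim: quotientE)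
    have fV: "finite (verts G)" using G by (auto simp: multigraphs_def loopless_multigraph_def)
    then obtain p where p: "bij_betw p (verts G) {0..<card (verts G)}"
      using ex_bij_betw_finite_nat by blast
    define H where "H = \<lparr>verts = {0..<card (verts G)}, edges = image_mset (\<lambda>e. p ` e) (edges G)\<rparr>"
    have c: "card (p ` e) = 2" "p ` e \<subseteq> {0..<card (verts G)}" if "e \<in># edges G" for e
    proof -
      have e: "e \<subseteq> verts G" "card e = 2"
        using that G by (auto simp: multigraphs_def loopless_multigraph_def)
      then show "card (p ` e) = 2" "p ` e \<subseteq> {0..<card (verts G)}"
        using p by (auto simp: bij_betw_def card_image inj_on_subset)
    qed
    have iso: "(G, H) \<in> multigraph_iso" using p by (auto simp: multigraph_iso_def H_def)
    have ni: "\<exists>e\<in>#edges G. v \<in> p ` e" if v: "v \<in> {0..<card (verts G)}" for v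
    proof -
      obtain w where w: "w \<in> verts G" "v = p w"
        using bij_betw_imp_surj_on[OF p] v by blast
      then obtain e where "e \<in># edges G" "w \<in> e"
        using G by (auto simp: multigraphs_def no_isolated_vertices_def)
      then show ?thesis using w by auto
    qed
    have H: "H \<in> multigraphs n"
      using G c ni by (auto simp: multigraphs_def loopless_multigraph_def no_isolated_vertices_def H_def)
    have "C = ?R `` {H}" unfolding G(2)
      by (rule equiv_class_eq[OF equiv_multigraph_iso]) (use G(1) iso H in auto)
    moreover have "verts H \<subseteq> {..<2 * n}" using card[OF G(1)] by (auto simp: H_def)
    ultimately show "C \<in> (\<lambda>G. ?R `` {G}) ` ?S" using H by blast
  qed
  with fin show ?thesis using finite_subset by blast
qed

lemma finite_multigraph_classes_upto: "finite (multigraph_classes_upto n)"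
  by (simp add: multigraph_classes_upto_def finite_multigraph_classes)

text \<open>
  For an edge \<open>e = {i, j}\<close> the factor is $f(x_i,x_j)$ with \<open>i < j\<close>; the order is irrelevant
  because kernels are symmetric.
\<close>

definition hom_density :: "multigraph \<Rightarrow> kernel \<Rightarrow> real" where
  "hom_density G f =
     (LINT x|(\<Pi>\<^sub>M v\<in>verts G. unit_interval). (\<Prod>e\<in>#edges G. f (x (Min e), x (Max e))))"

definition representative :: "multigraph set \<Rightarrow> multigraph" where
  "representative H = (SOME G. G \<in> H)"

definition class_density :: "multigraph set \<Rightarrow> kernel \<Rightarrow> real" where
  "class_density H f = hom_density (representative H) f"

definition simple_class :: "multigraph set \<Rightarrow> bool" where
  "simple_class H \<longleftrightarrow> simple_multigraph (representative H)"

definition hom_density_expansion ::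
    "nat \<Rightarrow> (multigraph set \<Rightarrow> real) \<Rightarrow> (kernel \<Rightarrow> real) \<Rightarrow> bool" where
  "hom_density_expansion N c F \<longleftrightarrow>
     (\<forall>f\<in>graphons. F f = (\<Sum>H\<in>multigraph_classes_upto N. c H * class_density H f))"

end

(*
  Write S(n, A) for the step kernel with n equal blocks and value A {i, j} on block (i, j), so that
  weights A are indexed by edges or loops {i, j}.  Inside a segment of graphons the derivative
  of order k <= N along the segment is differentiable in both directions, hence continuous; as the
  derivative of order N + 1 vanishes, F is a polynomial of degree at most N along segments, and
  F(S(n, A)) is a polynomial in A whose monomials are multigraphs M on n vertices, loops allowed.

  The coefficients c(n, M) are invariant under permutations of the blocks.  Refining n blocks to n * m
  blocks makes c(n, K) the sum of c(n * m, M) over the lifts M of K.  Suppose all coefficients with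
  more than p vertices vanish and K has p vertices.  Then only lifts isomorphic to K contribute, and
  they contribute equally, so whether c(n, K) is zero depends only on the isomorphism class of K.  If K
  has a loop, deleting the diagonal of the refined kernel removes all these lifts and is
  negligible in L^1 as m tends to infinity, so c(n, K) = 0.  If K has no loop, c(n, K) is removed by
  subtracting a multiple of t(K, -).  Descending induction on p starts at p = 2 * N + 1 and reaches 0 after
  subtracting finitely many densities; then F vanishes on step kernels, which are dense in L^1.

  Uniqueness: the coefficient at a graph K of the largest vertex number with nonzero c_K only sees
  t(K, -).  For the cut norm, multiply A / 2 by 1 + h with h a Hadamard sign pattern inside each block.
  As 1 + h is twice an idempotent and h tends to 0 in the cut norm, the densities converge to
  2 ^ -s t(H, A) where s counts the edges of H without multiplicity, whereas F converges to its value at A / 2,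
  which involves 2 ^ -|E(H)| t(H, A).  So c_H = 0 unless H is simple.
*)
theory Submission
  imports Defs "HOL-Probability.Infinite_Product_Measure"
begin

section \<open>Polynomiality along segments\<close>

lemma kernels_lincomb:
  assumes "f \<in> kernels" "g \<in> kernels"
  shows "(\<lambda>z. a * f z + b * g z) \<in> kernels"
proof -
  have fm [measurable]: "f \<in> borel_measurable unit_square" and gm [measurable]: "g \<in> borel_measurable unit_square"
    using assms by (auto simp: kernels_def)
  have "bounded (f ` ({0..1} \<times> {0..1}))" "bounded (g ` ({0..1} \<times> {0..1}))"
    using assms by (auto simp: kernels_def)
  then obtain B C where B: "\<And>z. z \<in> {0..1} \<times> {0..1} \<Longrightarrow> \<bar>f z\<bar> \<le> B"
    and C: "\<And>z. z \<in> {0..1} \<times> {0..1} \<Longrightarrow> \<bar>g z\<bar> \<le> C"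
    unfolding bounded_iff ball_simps real_norm_def by blast
  have "\<bar>a * f z + b * g z\<bar> \<le> \<bar>a\<bar> * B + \<bar>b\<bar> * C" if "z \<in> {0..1} \<times> {0..1}" for z
    using mult_left_mono[OF B[OF that], of "\<bar>a\<bar>"] mult_left_mono[OF C[OF that], of "\<bar>b\<bar>"]
    by (intro order_trans[OF abs_triangle_ineq]) (simp add: abs_mult)
  then have "bounded ((\<lambda>z. a * f z + b * g z) ` ({0..1} \<times> {0..1}))"
    unfolding bounded_iff by (intro exI[of _ "\<bar>a\<bar> * B + \<bar>b\<bar> * C"]) auto
  with assms show ?thesis by (auto simp: kernels_def)
qed

lemma graphons_convex:
  assumes "f \<in> graphons" "g \<in> graphons" "s \<in> {0..1}"
  shows "(\<lambda>z. f z + s * (g z - f z)) \<in> graphons"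
proof -
  have "(\<lambda>z. (1 - s) * f z + s * g z) \<in> kernels"
    using assms by (intro kernels_lincomb) (auto simp: graphons_def)
  moreover have "(\<lambda>z. (1 - s) * f z + s * g z) = (\<lambda>z. f z + s * (g z - f z))"
    by (auto simp: algebra_simps)
  moreover have "f z + s * (g z - f z) \<in> {0..1}" if "z \<in> {0..1} \<times> {0..1}" for z
  proof -
    have "f z \<in> {0..1}" "g z \<in> {0..1}" using assms that by (auto simp: graphons_def)
    moreover from this have "0 \<le> (1 - s) * f z + s * g z" "(1 - s) * f z + s * g z \<le> 1"
      using assms(3) convex_bound_le[of "f z" 1 "g z" "1 - s" s] by auto
    ultimately show ?thesis by (simp add: algebra_simps)
  qed
  ultimately show ?thesis by (simp add: graphons_def del: atLeastAtMost_iff)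
qed

lemma right_derivative_zero_imp_const:
  fixes h :: "real \<Rightarrow> real"
  assumes "a \<le> b" "continuous_on {a..b} h"
    and "\<And>x. x \<in> {a..<b} \<Longrightarrow> ((\<lambda>l. (h (x + l) - h x) / l) \<longlongrightarrow> 0) (at_right 0)"
  shows "h b = h a"
proof -
  have le: "\<bar>h b - h a\<bar> \<le> e * (b - a)" if e: "e > 0" for e
  proof -
    define T where "T = {a..b} \<inter> (\<lambda>x. \<bar>h x - h a\<bar> - e * (x - a)) -` {..0}"
    have "closed T" unfolding T_def
      by (intro continuous_closed_preimage continuous_intros assms closed_atLeastAtMost closed_atMost)
    moreover have "bounded T" by (rule bounded_subset[OF bounded_closed_interval[of a b]]) (auto simp: T_def)
    ultimately have "compact T" by (simp add: compact_eq_bounded_closed)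
    moreover have "a \<in> T" using assms by (simp add: T_def)
    ultimately obtain s where s: "s \<in> T" "\<And>t. t \<in> T \<Longrightarrow> t \<le> s"
      using compact_attains_sup[of T] by blast
    have "s = b"
    proof (rule ccontr)
      assume "s \<noteq> b"
      with s have sb: "s \<in> {a..<b}" by (auto simp: T_def)
      have "eventually (\<lambda>l. \<bar>(h (s + l) - h s) / l\<bar> < e) (at_right 0)"
        using tendstoD[OF assms(3)[OF sb] e] by (simp add: dist_real_def)
      moreover have "eventually (\<lambda>l. l \<in> {0<..<b - s}) (at_right 0)"
        using sb by (intro eventually_at_right_real) auto
      ultimately have "eventually (\<lambda>l. \<bar>(h (s + l) - h s) / l\<bar> < e \<and> l \<in> {0<..<b - s}) (at_right 0)"
        by (rule eventually_conj)
      then obtain l where l: "\<bar>(h (s + l) - h s) / l\<bar> < e" "l > 0" "l < b - s"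
        using eventually_happens'[OF trivial_limit_at_right_real] by fastforce
      then have "\<bar>h (s + l) - h s\<bar> \<le> e * l" by (simp add: abs_divide field_simps)
      moreover have "\<bar>h s - h a\<bar> \<le> e * (s - a)" using s by (auto simp: T_def)
      ultimately have "\<bar>h (s + l) - h a\<bar> \<le> e * (s + l - a)" by (simp add: algebra_simps)
      then have "s + l \<in> T" using l sb by (auto simp: T_def)
      then show False using s(2) l by force
    qed
    then show ?thesis using s by (auto simp: T_def)
  qed
  have "\<bar>h b - h a\<bar> \<le> 0"
  proof (rule field_le_epsilon)
    fix d :: real assume d: "d > 0"
    have "\<bar>h b - h a\<bar> \<le> d / (b - a + 1) * (b - a)" using assms d by (intro le) auto
    also have "\<dots> \<le> d" using assms d by (simp add: field_simps)
    finally show "\<bar>h b - h a\<bar> \<le> 0 + d" by simp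
  qed
  then show ?thesis by simp
qed

lemma ex_antiderivative_poly:
  fixes p :: "real poly"
  assumes "\<forall>i\<ge>j. coeff p i = 0"
  shows "\<exists>q. pderiv q = p \<and> (\<forall>i\<ge>Suc j. coeff q i = 0)"
proof -
  let ?q = "\<Sum>i\<le>degree p. monom (coeff p i / real (Suc i)) (Suc i)"
  have "pderiv ?q = (\<Sum>i\<le>degree p. monom (coeff p i) i)"
    by (simp add: sum.distrib higher_pderiv_sum[of 1, simplified] pderiv_monom del: of_nat_Suc)
  then have "pderiv ?q = p" by (simp add: poly_as_sum_of_monoms)
  moreover have "coeff ?q i = 0" if "i \<ge> Suc j" for i
    using that assms by (auto simp: coeff_sum intro!: sum.neutral)
  ultimately show ?thesis by blast
qed

lemma iterated_right_derivative_poly: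
  fixes h :: "nat \<Rightarrow> real \<Rightarrow> real"
  assumes "\<And>k. k \<le> N \<Longrightarrow> continuous_on {0<..<1} (h k)"
    and "\<And>k x. k \<le> N \<Longrightarrow> x \<in> {0<..<1} \<Longrightarrow> ((\<lambda>l. (h k (x + l) - h k x) / l) \<longlongrightarrow> h (Suc k) x) (at_right 0)"
    and "\<And>x. x \<in> {0<..<1} \<Longrightarrow> h (Suc N) x = 0"
    and "j \<le> Suc N"
  shows "\<exists>q. (\<forall>i\<ge>j. coeff q i = 0) \<and> (\<forall>x\<in>{0<..<1}. h (Suc N - j) x = poly q x)"
  using assms(4)
proof (induction j)
  case 0
  then show ?case using assms(3) by (intro exI[of _ 0]) auto
next
  case (Suc j)
  define k where "k = N - j"
  have k: "k \<le> N" "Suc N - Suc j = k" "Suc N - j = Suc k" using Suc.prems by (auto simp: k_def)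
  obtain p where p: "\<forall>i\<ge>j. coeff p i = 0" "\<And>x. x \<in> {0<..<1} \<Longrightarrow> h (Suc k) x = poly p x"
  proof -
    have "\<exists>q. (\<forall>i\<ge>j. coeff q i = 0) \<and> (\<forall>x\<in>{0<..<1}. h (Suc N - j) x = poly q x)"
      by (rule Suc.IH) (use Suc.prems in simp)
    then show ?thesis unfolding k(3) using that by blast
  qed
  obtain q where q: "pderiv q = p" "\<forall>i\<ge>Suc j. coeff q i = 0"
    using ex_antiderivative_poly[OF p(1)] by blast
  define d where "d x = h k x - poly q x" for x
  have cont: "continuous_on {0<..<1} d" unfolding d_def
    by (intro continuous_on_diff assms(1)[OF k(1)] continuous_on_poly continuous_on_id)
  have der: "((\<lambda>l. (d (x + l) - d x) / l) \<longlongrightarrow> 0) (at_right 0)" if "x \<in> {0<..<1}" for x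
  proof -
    have "((\<lambda>l. (poly q (x + l) - poly q x) / l) \<longlongrightarrow> poly p x) (at_right 0)"
      using poly_DERIV[of q x] unfolding DERIV_def q(1)
      by (rule tendsto_within_subset) simp
    from tendsto_diff[OF assms(2)[OF k(1) that] this]
    have "((\<lambda>l. (h k (x + l) - h k x) / l - (poly q (x + l) - poly q x) / l) \<longlongrightarrow> 0) (at_right 0)"
      using p(2)[OF that] by simp
    moreover have "(d (x + l) - d x) / l = (h k (x + l) - h k x) / l - (poly q (x + l) - poly q x) / l" for l
      unfolding d_def divide_inverse by algebra
    ultimately show ?thesis by simp
  qed
  have const: "d y = d x" if "x \<le> y" "x \<in> {0<..<1}" "y \<in> {0<..<1}" for x y
  proof (rule right_derivative_zero_imp_const[OF that(1)])
    show "continuous_on {x..y} d" by (rule continuous_on_subset[OF cont]) (use that in auto)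
    show "((\<lambda>l. (d (z + l) - d z) / l) \<longlongrightarrow> 0) (at_right 0)" if "z \<in> {x..<y}" for z
      by (rule der) (use that \<open>x \<in> _\<close> \<open>y \<in> _\<close> in auto)
  qed
  have dc: "d x = d (1/2)" if x: "x \<in> {0<..<1}" for x
  proof (cases "x \<le> 1/2")
    case True
    then show ?thesis using const[of x "1/2"] x by simp
  next
    case False
    then show ?thesis using const[of "1/2" x] x by simp
  qed
  have hk: "h k x = poly (q + [:d (1/2):]) x" if "x \<in> {0<..<1}" for x
    using dc[OF that] by (simp add: d_def[of x])
  have "\<forall>i\<ge>Suc j. coeff (q + [:d (1/2):]) i = 0"
    using q(2) by (auto simp: coeff_pCons split: nat.splits)
  then show ?case unfolding k(2) using hk by blast
qed

lemma gateaux_cong: "(\<And>i. i < k \<Longrightarrow> g i = g' i) \<Longrightarrow> gateaux F g k = gateaux F g' k"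
proof (induction k)
  case (Suc k)
  have "gateaux F g k = gateaux F g' k" by (rule Suc.IH, rule Suc.prems) simp
  moreover have "g k = g' k" by (rule Suc.prems) simp
  ultimately show ?case by simp
qed simp

lemma has_gateaux_derivative_unique:
  assumes D: "has_gateaux_derivative F D f g"
  shows "gateaux_derivative F f g = D"
  using D unfolding gateaux_derivative_def has_gateaux_derivative_def
proof (rule the_equality)
  fix D' assume "((\<lambda>l. (F (\<lambda>z. f z + l * g z) - F f) / l) \<longlongrightarrow> D') (at_right 0)"
  then show "D' = D" using tendsto_unique[OF trivial_limit_at_right_real] D[unfolded has_gateaux_derivative_def] by blast
qed

lemma continuous_if_one_sided_derivatives:
  fixes h :: "real \<Rightarrow> real"
  assumes "((\<lambda>l. (h (x + l) - h x) / l) \<longlongrightarrow> D) (at_right 0)"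
    and "((\<lambda>l. (h (x - l) - h x) / l) \<longlongrightarrow> E) (at_right 0)"
  shows "isCont h x"
proof -
  have l0: "((\<lambda>l::real. l) \<longlongrightarrow> 0) (at_right 0)" by (rule tendsto_ident_at)
  have nz: "eventually (\<lambda>l::real. l > 0) (at_right 0)" by (rule eventually_at_right_less)
  have "((\<lambda>l. (h (x + l) - h x) / l * l) \<longlongrightarrow> 0) (at_right 0)"
    using tendsto_mult[OF assms(1) l0] by simp
  then have "((\<lambda>l. h (x + l) - h x) \<longlongrightarrow> 0) (at_right 0)"
    by (rule Lim_transform_eventually) (rule eventually_mono[OF nz], simp)
  then have "((\<lambda>l. h (x + l)) \<longlongrightarrow> h x) (at_right 0)" using Lim_null by blast
  then have R: "(h \<longlongrightarrow> h x) (at_right x)"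
    by (subst filterlim_at_right_to_0) (simp add: add.commute)
  have "((\<lambda>l. (h (x - l) - h x) / l * l) \<longlongrightarrow> 0) (at_right 0)"
    using tendsto_mult[OF assms(2) l0] by simp
  then have "((\<lambda>l. h (x - l) - h x) \<longlongrightarrow> 0) (at_right 0)"
    by (rule Lim_transform_eventually) (rule eventually_mono[OF nz], simp)
  then have "((\<lambda>l. h (x - l)) \<longlongrightarrow> h x) (at_right 0)" using Lim_null by blast
  then have "((\<lambda>l. h (- l)) \<longlongrightarrow> h x) (at_right (- x))"
    by (subst filterlim_at_right_to_0) (simp add: add.commute)
  then have L: "(h \<longlongrightarrow> h x) (at_left x)"
    by (subst filterlim_at_left_to_right) simp
  show ?thesis using L R by (simp add: isCont_def filterlim_at_split)
qed

lemma graphon_segment_polynomial: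
  assumes cont: "continuous_wrt L1_norm F"
    and diff: "times_gateaux_differentiable (N + 1) F"
    and zero: "\<forall>f\<in>graphons. \<forall>g. (\<forall>i<N + 1. g i \<in> Adm f) \<longrightarrow> gateaux F g (N + 1) f = 0"
    and f: "f \<in> graphons" and g: "g \<in> graphons"
  shows "\<exists>q. (\<forall>i>N. coeff q i = 0) \<and> (\<forall>s\<in>{0..1}. F (\<lambda>z. f z + s * (g z - f z)) = poly q s)"
proof -
  define d where "d = (\<lambda>z. g z - f z)"
  define md where "md = (\<lambda>z. - d z)"
  define P where "P s = (\<lambda>z. f z + s * d z)" for s
  define h where "h k s = gateaux F (\<lambda>_. d) k (P s)" for k s
  have dk: "d \<in> kernels" "md \<in> kernels"
    using kernels_lincomb[of g f 1 "-1"] kernels_lincomb[of f g 1 "-1"] f g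
    by (auto simp: d_def md_def graphons_def)
  have Pg: "P s \<in> graphons" if "s \<in> {0..1}" for s
    unfolding P_def d_def using f g that by (rule graphons_convex)
  have shift: "(\<lambda>z. P s z + l * d z) = P (s + l)" "(\<lambda>z. P s z + l * md z) = P (s - l)" for s l
    by (auto simp: P_def md_def algebra_simps)
  have adm: "d \<in> Adm (P s)" "md \<in> Adm (P s)" if "s \<in> {0<..<1}" for s
  proof -
    have "(\<lambda>z. P s z + (1 - s) * d z) \<in> graphons" "(\<lambda>z. P s z + s * md z) \<in> graphons"
      unfolding shift by (auto intro: Pg)
    moreover have "1 - s > 0" "s > 0" using that by auto
    ultimately show "d \<in> Adm (P s)" "md \<in> Adm (P s)" using dk unfolding Adm_def by blast+
  qed
  have right: "((\<lambda>l. (h k (x + l) - h k x) / l) \<longlongrightarrow> h (Suc k) x) (at_right 0)"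
    if kx: "k \<le> N" "x \<in> {0<..<1}" for k x
  proof -
    have "x \<in> {0..1}" "k < N + 1" using kx by auto
    then obtain D where D: "has_gateaux_derivative (gateaux F (\<lambda>_. d) k) D (P x) d"
      using diff[unfolded times_gateaux_differentiable_def, rule_format, of k "P x" "\<lambda>_. d"] Pg adm(1)[OF kx(2)]
      by blast
    then have "h (Suc k) x = D" using has_gateaux_derivative_unique[OF D] by (simp add: h_def)
    then show ?thesis using D by (simp add: has_gateaux_derivative_def h_def shift)
  qed
  have left: "\<exists>E. ((\<lambda>l. (h k (x - l) - h k x) / l) \<longlongrightarrow> E) (at_right 0)"
    if "k \<le> N" "x \<in> {0<..<1}" for k x
  proof -
    let ?g = "\<lambda>i. if i < k then d else md"
    have eq: "gateaux F ?g k = gateaux F (\<lambda>_. d) k" by (rule gateaux_cong) auto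
    have "x \<in> {0..1}" "k < N + 1" "\<And>i. ?g i \<in> Adm (P x)" using that adm[OF that(2)] by auto
    then have "\<exists>E. has_gateaux_derivative (gateaux F ?g k) E (P x) (?g k)"
      using diff[unfolded times_gateaux_differentiable_def, rule_format, of k "P x" ?g] Pg by blast
    then obtain E where "has_gateaux_derivative (gateaux F ?g k) E (P x) md" by auto
    then show ?thesis unfolding eq by (auto simp: has_gateaux_derivative_def h_def shift)
  qed
  have "continuous_on {0<..<1} (h k)" if k: "k \<le> N" for k
  proof (intro continuous_at_imp_continuous_on ballI)
    fix x :: real assume x: "x \<in> {0<..<1}"
    obtain E where "((\<lambda>l. (h k (x - l) - h k x) / l) \<longlongrightarrow> E) (at_right 0)"
      using left[OF k x] by blast
    with right[OF k x] show "isCont (h k) x" by (rule continuous_if_one_sided_derivatives)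
  qed
  moreover have "h (Suc N) x = 0" if "x \<in> {0<..<1}" for x
  proof -
    have "P x \<in> graphons" using that by (intro Pg) auto
    then have "gateaux F (\<lambda>_. d) (N + 1) (P x) = 0" using zero[rule_format, of "P x" "\<lambda>_. d"] adm(1)[OF that] by blast
    then show ?thesis unfolding h_def Suc_eq_plus1 .
  qed
  ultimately have "\<exists>q. (\<forall>i\<ge>Suc N. coeff q i = 0) \<and> (\<forall>x\<in>{0<..<1}. h (Suc N - Suc N) x = poly q x)"
    using right by (intro iterated_right_derivative_poly) blast+
  then obtain q where q: "\<forall>i\<ge>Suc N. coeff q i = 0" "\<forall>x\<in>{0<..<1}. h 0 x = poly q x"
    unfolding diff_self_eq_0 by blast
  have "continuous_on {0..1} (h 0)"
    unfolding continuous_on_iff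
  proof (intro ballI allI impI)
    fix x e :: real assume x: "x \<in> {0..1}" and e: "e > 0"
    obtain \<delta> where \<delta>: "\<delta> > 0" "\<And>k. k \<in> graphons \<Longrightarrow> L1_norm (\<lambda>z. k z - P x z) < \<delta> \<Longrightarrow> \<bar>F k - F (P x)\<bar> < e"
      using cont Pg[OF x] e unfolding continuous_wrt_def by blast
    define C where "C = L1_norm d + 1"
    have C: "C > 0" "L1_norm d < C"
      using Bochner_Integration.integral_nonneg[of unit_square "\<lambda>z. \<bar>d z\<bar>"] unfolding C_def L1_norm_def by linarith+
    show "\<exists>r>0. \<forall>x'\<in>{0..1}. dist x' x < r \<longrightarrow> dist (h 0 x') (h 0 x) < e"
    proof (intro exI conjI ballI impI)
      show "\<delta> / C > 0" using \<delta> C by simp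
      fix x' assume x': "x' \<in> {0..1}" "dist x' x < \<delta> / C"
      have "L1_norm (\<lambda>z. P x' z - P x z) = \<bar>x' - x\<bar> * L1_norm d"
        by (simp add: L1_norm_def P_def abs_mult left_diff_distrib[symmetric])
      also have "\<dots> \<le> \<bar>x' - x\<bar> * C" using C by (intro mult_left_mono) auto
      also have "\<dots> < \<delta>" using x' C by (simp add: dist_real_def field_simps)
      finally show "dist (h 0 x') (h 0 x) < e"
        using \<delta>(2)[OF Pg[OF x'(1)]] by (simp add: h_def dist_real_def)
    qed
  qed
  then have cl: "continuous_on {0..1} (\<lambda>x. h 0 x - poly q x)" by (intro continuous_intros)
  have "h 0 x - poly q x = 0" if "x \<in> {0..1}" for x
    by (rule continuous_constant_on_closure[of "{0<..<1}" "\<lambda>x. h 0 x - poly q x"]) (use cl q that in auto)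
  then show ?thesis using q(1) by (intro exI[of _ q]) (auto simp: h_def P_def d_def)
qed

section \<open>Polynomials on a cube\<close>

definition node :: "nat \<Rightarrow> nat \<Rightarrow> real" where
  "node N k = real k / real (N + 1)"

lemma node_range: "k \<le> N \<Longrightarrow> node N k \<in> {0..1}"
  by (simp add: node_def)

lemma inj_node: "node N k = node N l \<longleftrightarrow> k = l"
  by (simp add: node_def)

definition lagrange :: "nat \<Rightarrow> nat \<Rightarrow> real poly" where
  "lagrange N k = (\<Prod>j\<in>{..N} - {k}. smult (1 / (node N k - node N j)) [:- node N j, 1:])"

lemma poly_lagrange:
  assumes "k \<le> N" "l \<le> N"
  shows "poly (lagrange N k) (node N l) = of_bool (k = l)"
proof (cases "k = l")
  case True
  then show ?thesis
    by (auto simp: lagrange_def poly_prod inj_node diff_divide_distrib[symmetric] intro!: prod.neutral)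
next
  case False
  then have "l \<in> {..N} - {k}" using assms by auto
  then show ?thesis using False
    by (auto simp: lagrange_def poly_prod intro!: prod_zero bexI[of _ l])
qed

lemma degree_lagrange:
  assumes "k \<le> N"
  shows "degree (lagrange N k) \<le> N"
proof -
  have "degree (lagrange N k) \<le> (\<Sum>j\<in>{..N} - {k}. degree (smult (1 / (node N k - node N j)) [:- node N j, 1:]))"
    unfolding lagrange_def by (rule order_trans[OF degree_prod_sum_le]) auto
  also have "\<dots> \<le> (\<Sum>j\<in>{..N} - {k}. 1)"
    by (intro sum_mono) (auto intro: order_trans[OF degree_smult_le])
  also have "\<dots> = N" using assms by (simp add: card_Diff_singleton)
  finally show ?thesis .
qed

lemma poly_eq_sum_lagrange:
  assumes "degree q \<le> N"
  shows "q = (\<Sum>k\<le>N. smult (poly q (node N k)) (lagrange N k))"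
proof (rule poly_eqI_degree[of "node N ` {..N}"])
  let ?r = "\<Sum>k\<le>N. smult (poly q (node N k)) (lagrange N k)"
  have card: "card (node N ` {..N}) = N + 1"
    by (subst card_image) (auto simp: inj_on_def inj_node)
  fix x assume "x \<in> node N ` {..N}"
  then obtain l where l: "l \<le> N" "x = node N l" by auto
  have "poly ?r x = (\<Sum>k\<le>N. if k = l then poly q (node N k) else 0)"
    unfolding poly_sum l(2) using l(1) by (intro sum.cong refl) (simp add: poly_lagrange)
  then show "poly q x = poly ?r x" using l by simp
next
  have card: "card (node N ` {..N}) = N + 1"
    by (subst card_image) (auto simp: inj_on_def inj_node)
  show "degree q < card (node N ` {..N})" using assms card by simp
  have "degree (\<Sum>k\<le>N. smult (poly q (node N k)) (lagrange N k)) \<le> N"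
    by (intro degree_sum_le) (auto intro: order_trans[OF degree_smult_le] degree_lagrange)
  then show "degree (\<Sum>k\<le>N. smult (poly q (node N k)) (lagrange N k)) < card (node N ` {..N})"
    using card by simp
qed

lemma sum_lagrange_coeff_power:
  assumes "e \<le> N" "e' \<le> N"
  shows "(\<Sum>k\<le>N. coeff (lagrange N k) e * node N k ^ e') = of_bool (e = e')"
proof -
  have "of_bool (e = e') = coeff (monom (1::real) e') e" by auto
  also have "monom (1::real) e' = (\<Sum>k\<le>N. smult (poly (monom 1 e') (node N k)) (lagrange N k))"
    using assms by (intro poly_eq_sum_lagrange) (auto intro: order_trans[OF degree_monom_le])
  also have "coeff \<dots> e = (\<Sum>k\<le>N. coeff (lagrange N k) e * node N k ^ e')"
    by (simp add: coeff_sum poly_monom mult.commute)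
  finally show ?thesis by simp
qed

definition cube :: "('a \<Rightarrow> real) set" where
  "cube = {A. \<forall>e. A e \<in> {0..1}}"

definition grid_point :: "nat \<Rightarrow> 'a set \<Rightarrow> ('a \<Rightarrow> nat) \<Rightarrow> 'a \<Rightarrow> real" where
  "grid_point N P x = (\<lambda>p. if p \<in> P then node N (x p) else 0)"

text \<open>Interpolation on a grid reads off the coefficient of the monomial \<open>M\<close>.  Being a finite
  combination of values, it is defined for all functions and continuous under pointwise limits.\<close>

definition coefficient :: "nat \<Rightarrow> 'a set \<Rightarrow> 'a multiset \<Rightarrow> (('a \<Rightarrow> real) \<Rightarrow> real) \<Rightarrow> real" where
  "coefficient N P M \<Phi> =
     (\<Sum>x\<in>PiE P (\<lambda>_. {..N}). (\<Prod>p\<in>P. coeff (lagrange N (x p)) (count M p)) * \<Phi> (grid_point N P x))"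

lemma grid_point_cube: "x \<in> PiE P (\<lambda>_. {..N}) \<Longrightarrow> grid_point N P x \<in> cube"
  using node_range by (force simp: grid_point_def cube_def PiE_def Pi_def)

lemma coefficient_cong:
  "(\<And>A. A \<in> cube \<Longrightarrow> \<Phi> A = \<Psi> A) \<Longrightarrow> coefficient N P M \<Phi> = coefficient N P M \<Psi>"
  unfolding coefficient_def by (intro sum.cong refl) (simp add: grid_point_cube)

lemma coefficient_sum:
  "coefficient N P M (\<lambda>A. \<Sum>i\<in>I. c i * \<Phi> i A) = (\<Sum>i\<in>I. c i * coefficient N P M (\<Phi> i))"
  unfolding coefficient_def sum_distrib_left
  by (subst sum.swap) (simp add: mult_ac)

lemma coefficient_diff:
  "coefficient N P M (\<lambda>A. \<Phi> A - \<Psi> A) = coefficient N P M \<Phi> - coefficient N P M \<Psi>"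
  unfolding coefficient_def by (simp add: right_diff_distrib sum_subtractf)

lemma coefficient_zero: "coefficient N P M (\<lambda>A. 0) = 0"
  by (simp add: coefficient_def)

lemma coefficient_tendsto:
  assumes "\<And>A. A \<in> cube \<Longrightarrow> (\<lambda>m. \<Phi> m A) \<longlonglongrightarrow> \<Psi> A"
  shows "(\<lambda>m. coefficient N P M (\<Phi> m)) \<longlonglongrightarrow> coefficient N P M \<Psi>"
  unfolding coefficient_def
  by (intro tendsto_sum tendsto_mult tendsto_const assms grid_point_cube)

definition bounded_multisets :: "nat \<Rightarrow> 'a set \<Rightarrow> 'a multiset set" where
  "bounded_multisets N P = {M. set_mset M \<subseteq> P \<and> (\<forall>p. count M p \<le> N)}"

definition small_multisets :: "nat \<Rightarrow> 'a set \<Rightarrow> 'a multiset set" where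
  "small_multisets N P = {M. set_mset M \<subseteq> P \<and> size M \<le> N}"

lemma small_bounded: "small_multisets N P \<subseteq> bounded_multisets N P"
  by (auto simp: small_multisets_def bounded_multisets_def intro: order_trans[OF count_le_size])

lemma prod_mset_eq_prod_power:
  assumes "finite P" "set_mset M \<subseteq> P"
  shows "(\<Prod>e\<in>#M. f e) = (\<Prod>p\<in>P. f p ^ count M p :: real)"
proof -
  have "(\<Prod>e\<in>#M. f e) = (\<Prod>p\<in>set_mset M. f p ^ count M p)"
    by (rule image_prod_mset_multiplicity)
  also have "\<dots> = (\<Prod>p\<in>P. f p ^ count M p)"
    using assms by (intro prod.mono_neutral_left) (auto simp: not_in_iff)
  finally show ?thesis .
qed

lemma coefficient_monomial:
  assumes "finite P" "M \<in> bounded_multisets N P" "M' \<in> bounded_multisets N P"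
  shows "coefficient N P M (\<lambda>A. \<Prod>e\<in>#M'. A e) = of_bool (M = M')"
proof -
  have M: "set_mset M \<subseteq> P" "set_mset M' \<subseteq> P" "\<And>p. count M p \<le> N" "\<And>p. count M' p \<le> N"
    using assms by (auto simp: bounded_multisets_def)
  have "coefficient N P M (\<lambda>A. \<Prod>e\<in>#M'. A e) =
    (\<Sum>x\<in>PiE P (\<lambda>_. {..N}). (\<Prod>p\<in>P. coeff (lagrange N (x p)) (count M p) * node N (x p) ^ count M' p))"
    unfolding coefficient_def prod_mset_eq_prod_power[OF assms(1) M(2)] prod.distrib
    by (simp add: grid_point_def)
  also have "\<dots> = (\<Prod>p\<in>P. \<Sum>k\<le>N. coeff (lagrange N k) (count M p) * node N k ^ count M' p)"
    using assms(1) by (subst prod_sum_PiE) auto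
  also have "\<dots> = (\<Prod>p\<in>P. of_bool (count M p = count M' p))"
    using M by (simp add: sum_lagrange_coeff_power)
  also have "\<dots> = of_bool (M = M')"
  proof (cases "M = M'")
    case False
    then obtain p where "count M p \<noteq> count M' p" by (auto simp: multiset_eq_iff)
    moreover from this have "p \<in> P" using M by (metis count_eq_zero_iff subsetD)
    ultimately have "(\<Prod>p\<in>P. of_bool (count M p = count M' p)) = (0::real)"
      using assms(1) by (intro prod_zero) auto
    then show ?thesis using False by simp
  qed simp
  finally show ?thesis .
qed

lemma finite_small_multisets: "finite P \<Longrightarrow> finite (small_multisets N P)"
proof -
  assume "finite P"
  then have "finite (\<Union>n\<le>N. multisets_of_size P n)" by (intro finite_UN_I) auto
  moreover have "small_multisets N P \<subseteq> (\<Union>n\<le>N. multisets_of_size P n)"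
    by (auto simp: small_multisets_def multisets_of_size_def)
  ultimately show ?thesis by (rule finite_subset[rotated])
qed

lemma bounded_multisets_empty: "bounded_multisets N {} = {{#}}"
  by (auto simp: bounded_multisets_def)

lemma bounded_multisets_insert:
  assumes "p \<notin> P"
  shows "bij_betw (\<lambda>(M, k). M + replicate_mset k p) (bounded_multisets N P \<times> {..N}) (bounded_multisets N (insert p P))"
proof -
  have np: "count M p = 0" if "M \<in> bounded_multisets N P" for M
    using that assms by (auto simp: bounded_multisets_def count_eq_zero_iff)
  show ?thesis
  proof (rule bij_betwI[where g = "\<lambda>M. (filter_mset (\<lambda>x. x \<noteq> p) M, count M p)"], goal_cases)
    case 1
    then show ?case using np by (auto simp: bounded_multisets_def split: if_splits)
  next
    case 2
    then show ?case by (auto simp: bounded_multisets_def)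
  next
    case (3 y)
    then show ?case using np
      by (auto intro!: multiset_eqI)
  next
    case (4 M)
    then show ?case by (auto intro!: multiset_eqI)
  qed
qed

lemma finite_bounded_multisets: "finite P \<Longrightarrow> finite (bounded_multisets N P)"
proof (induction P rule: finite_induct)
  case (insert p P)
  have "finite (bounded_multisets N P \<times> {..N})" using insert by simp
  then show ?case using bij_betw_finite[OF bounded_multisets_insert[OF insert(2)]] by blast
qed (simp add: bounded_multisets_empty)

lemma polynomial_in_each_variable:
  assumes "finite P"
    and "\<And>A p. A \<in> cube \<Longrightarrow> p \<in> P \<Longrightarrow> \<exists>q. degree q \<le> N \<and> (\<forall>s\<in>{0..1}. \<Phi> (A(p := s)) = poly q s)"
  shows "\<exists>a. \<forall>A\<in>cube. (\<forall>p. p \<notin> P \<longrightarrow> A p = 0) \<longrightarrow> \<Phi> A = (\<Sum>M\<in>bounded_multisets N P. a M * (\<Prod>e\<in>#M. A e))"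
  using assms
proof (induction P arbitrary: \<Phi> rule: finite_induct)
  case empty
  show ?case
  proof (intro exI[of _ "\<lambda>_. \<Phi> (\<lambda>_. 0)"] ballI impI)
    fix A :: "'a \<Rightarrow> real" assume "\<forall>p. p \<notin> {} \<longrightarrow> A p = 0"
    then have "A = (\<lambda>_. 0)" by auto
    then show "\<Phi> A = (\<Sum>M\<in>bounded_multisets N {}. \<Phi> (\<lambda>_. 0) * (\<Prod>e\<in>#M. A e))"
      by (simp add: bounded_multisets_empty)
  qed
next
  case (insert p P)
  have upd: "A(p := s) \<in> cube" if "A \<in> cube" "s \<in> {0..1}" for A s
    using that by (auto simp: cube_def)
  have "\<exists>a. \<forall>A\<in>cube. (\<forall>p. p \<notin> P \<longrightarrow> A p = 0) \<longrightarrow>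
      \<Phi> (A(p := node N k)) = (\<Sum>M\<in>bounded_multisets N P. a M * (\<Prod>e\<in>#M. A e))" if k: "k \<le> N" for k
  proof (rule insert.IH)
    fix A :: "'a \<Rightarrow> real" and p' assume A: "A \<in> cube" "p' \<in> P"
    then have "p' \<noteq> p" using insert by auto
    obtain q where "degree q \<le> N" "\<forall>s\<in>{0..1}. \<Phi> ((A(p := node N k))(p' := s)) = poly q s"
      using insert.prems[OF upd[OF A(1) node_range[OF k]], of p'] A(2) by blast
    then show "\<exists>q. degree q \<le> N \<and> (\<forall>s\<in>{0..1}. \<Phi> ((A(p' := s))(p := node N k)) = poly q s)"
      unfolding fun_upd_twist[OF \<open>p' \<noteq> p\<close>] by blast
  qed
  then have "\<forall>k\<in>{..N}. \<exists>a. \<forall>A\<in>cube. (\<forall>p. p \<notin> P \<longrightarrow> A p = 0) \<longrightarrow>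
      \<Phi> (A(p := node N k)) = (\<Sum>M\<in>bounded_multisets N P. a M * (\<Prod>e\<in>#M. A e))"
    by blast
  from bchoice[OF this] obtain a where a: "\<And>k A. k \<le> N \<Longrightarrow> A \<in> cube \<Longrightarrow> (\<forall>p. p \<notin> P \<longrightarrow> A p = 0) \<Longrightarrow>
      \<Phi> (A(p := node N k)) = (\<Sum>M\<in>bounded_multisets N P. a k M * (\<Prod>e\<in>#M. A e))"
    unfolding atMost_iff by blast
  define b where "b = (\<lambda>M. \<Sum>k\<le>N. coeff (lagrange N k) (count M p) * a k (filter_mset (\<lambda>x. x \<noteq> p) M))"
  show ?case
  proof (intro exI[of _ b] ballI impI)
    fix A :: "'a \<Rightarrow> real" assume A: "A \<in> cube" and A0: "\<forall>q. q \<notin> insert p P \<longrightarrow> A q = 0"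
    obtain q where q: "degree q \<le> N" "\<And>s. s \<in> {0..1} \<Longrightarrow> \<Phi> (A(p := s)) = poly q s"
      using insert.prems[OF A, of p] by blast
    have Ap: "A p \<in> {0..1}" using A by (auto simp: cube_def)
    let ?A = "A(p := 0)"
    have A': "?A \<in> cube" "\<forall>q. q \<notin> P \<longrightarrow> ?A q = 0" using upd[OF A, of 0] A0 by auto
    have mono: "(\<Prod>e\<in>#M. ?A e) = (\<Prod>e\<in>#M. A e)" if "M \<in> bounded_multisets N P" for M
      using that insert(2) by (intro arg_cong[where f=prod_mset] image_mset_cong) (auto simp: bounded_multisets_def)
    have "\<Phi> A = poly q (A p)" using q(2)[OF Ap] by simp
    also have "\<dots> = (\<Sum>k\<le>N. poly q (node N k) * poly (lagrange N k) (A p))"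
      by (subst poly_eq_sum_lagrange[OF q(1)]) (simp add: poly_sum)
    also have "\<dots> = (\<Sum>k\<le>N. (\<Sum>M\<in>bounded_multisets N P. a k M * (\<Prod>e\<in>#M. A e)) * (\<Sum>i\<le>N. coeff (lagrange N k) i * A p ^ i))"
    proof (intro sum.cong refl arg_cong2[where f="(*)"])
      fix k assume k: "k \<in> {..N}"
      have "poly q (node N k) = \<Phi> (?A(p := node N k))" using q(2)[OF node_range[of k N]] k by simp
      also have "\<dots> = (\<Sum>M\<in>bounded_multisets N P. a k M * (\<Prod>e\<in>#M. ?A e))" using k by (intro a A') auto
      finally show "poly q (node N k) = (\<Sum>M\<in>bounded_multisets N P. a k M * (\<Prod>e\<in>#M. A e))"
        using mono by simp
      show "poly (lagrange N k) (A p) = (\<Sum>i\<le>N. coeff (lagrange N k) i * A p ^ i)"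
        unfolding poly_altdef using degree_lagrange[of k N] k
        by (intro sum.mono_neutral_left) (auto simp: coeff_eq_0)
    qed
    also have "\<dots> = (\<Sum>k\<le>N. \<Sum>(M, i)\<in>bounded_multisets N P \<times> {..N}. coeff (lagrange N k) i * a k M * ((\<Prod>e\<in>#M. A e) * A p ^ i))"
      by (simp add: sum_product sum.cartesian_product mult_ac)
    also have "\<dots> = (\<Sum>(M, i)\<in>bounded_multisets N P \<times> {..N}. \<Sum>k\<le>N. coeff (lagrange N k) i * a k M * ((\<Prod>e\<in>#M. A e) * A p ^ i))"
      by (subst sum.swap) (simp add: case_prod_unfold)
    also have "\<dots> = (\<Sum>(M, i)\<in>bounded_multisets N P \<times> {..N}. b (M + replicate_mset i p) * (\<Prod>e\<in>#M + replicate_mset i p. A e))"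
    proof (intro sum.cong refl, clarify)
      fix M i assume M: "M \<in> bounded_multisets N P"
      have c: "count M p = 0" "p \<notin># M" using M insert(2) by (auto simp: bounded_multisets_def count_eq_zero_iff)
      then have "filter_mset (\<lambda>x. x \<noteq> p) (M + replicate_mset i p) = M"
        by (auto intro!: multiset_eqI)
      then show "(\<Sum>k\<le>N. coeff (lagrange N k) i * a k M * ((\<Prod>e\<in>#M. A e) * A p ^ i))
        = b (M + replicate_mset i p) * (\<Prod>e\<in>#M + replicate_mset i p. A e)"
        using c by (simp add: b_def sum_distrib_right)
    qed
    also have "\<dots> = (\<Sum>M\<in>bounded_multisets N (insert p P). b M * (\<Prod>e\<in>#M. A e))"
      using sum.reindex_bij_betw[OF bounded_multisets_insert[OF insert(2), of N], of "\<lambda>M. b M * (\<Prod>e\<in>#M. A e)"]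
      by (simp add: case_prod_unfold)
    finally show "\<Phi> A = (\<Sum>M\<in>bounded_multisets N (insert p P). b M * (\<Prod>e\<in>#M. A e))" .
  qed
qed

lemma coefficient_polynomial:
  assumes "finite P" "S \<subseteq> bounded_multisets N P" "M \<in> bounded_multisets N P"
    and "\<And>A. A \<in> cube \<Longrightarrow> \<forall>p. p \<notin> P \<longrightarrow> A p = 0 \<Longrightarrow> \<Phi> A = (\<Sum>M\<in>S. a M * (\<Prod>e\<in>#M. A e))"
  shows "coefficient N P M \<Phi> = (if M \<in> S then a M else 0)"
proof -
  have fin: "finite S" using finite_bounded_multisets[OF assms(1)] assms(2) finite_subset by blast
  have "coefficient N P M \<Phi> = coefficient N P M (\<lambda>A. \<Sum>M'\<in>S. a M' * (\<Prod>e\<in>#M'. A e))"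
    unfolding coefficient_def
    by (intro sum.cong refl arg_cong2[where f="(*)"] assms(4) grid_point_cube) (auto simp: grid_point_def)
  also have "\<dots> = (\<Sum>M'\<in>S. a M' * of_bool (M = M'))"
    unfolding coefficient_sum using assms by (intro sum.cong refl) (auto simp: coefficient_monomial)
  also have "\<dots> = (\<Sum>M'\<in>S. if M = M' then a M' else 0)" by (intro sum.cong) auto
  also have "\<dots> = (if M \<in> S then a M else 0)" using fin by simp
  finally show ?thesis .
qed

text \<open>Along rays from the origin the total degree becomes the degree in one variable.\<close>

lemma polynomial_on_segments:
  fixes \<Phi> :: "('a \<Rightarrow> real) \<Rightarrow> real"
  assumes P: "finite P"
    and seg: "\<And>A B. A \<in> cube \<Longrightarrow> B \<in> cube \<Longrightarrow>
       \<exists>q. degree q \<le> N \<and> (\<forall>s\<in>{0..1}. \<Phi> (\<lambda>e. A e + s * (B e - A e)) = poly q s)"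
    and cong: "\<And>A B. (\<And>p. p \<in> P \<Longrightarrow> A p = B p) \<Longrightarrow> \<Phi> A = \<Phi> B"
    and A: "A \<in> cube"
  shows "\<Phi> A = (\<Sum>M\<in>small_multisets N P. coefficient N P M \<Phi> * (\<Prod>e\<in>#M. A e))"
proof -
  have coord: "\<exists>q. degree q \<le> N \<and> (\<forall>s\<in>{0..1}. \<Phi> (A(p := s)) = poly q s)" if "A \<in> cube" for A p
  proof -
    have "A(p := 0) \<in> cube" "A(p := 1) \<in> cube" using that by (auto simp: cube_def)
    from seg[OF this] obtain q where q: "degree q \<le> N"
      "\<forall>s\<in>{0..1}. \<Phi> (\<lambda>e. (A(p := 0)) e + s * ((A(p := 1)) e - (A(p := 0)) e)) = poly q s" by blast
    have line: "(\<lambda>e. (A(p := 0)) e + s * ((A(p := 1)) e - (A(p := 0)) e)) = A(p := s)" for s by auto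
    show ?thesis using q unfolding line by blast
  qed
  have "\<exists>a. \<forall>A\<in>cube. (\<forall>p. p \<notin> P \<longrightarrow> A p = 0) \<longrightarrow> \<Phi> A = (\<Sum>M\<in>bounded_multisets N P. a M * (\<Prod>e\<in>#M. A e))"
    by (rule polynomial_in_each_variable[OF P coord])
  then obtain a where a0: "\<And>A. A \<in> cube \<Longrightarrow> \<forall>p. p \<notin> P \<longrightarrow> A p = 0 \<Longrightarrow> \<Phi> A = (\<Sum>M\<in>bounded_multisets N P. a M * (\<Prod>e\<in>#M. A e))"
    by blast
  have a: "\<Phi> A = (\<Sum>M\<in>bounded_multisets N P. a M * (\<Prod>e\<in>#M. A e))" if "A \<in> cube" for A
  proof -
    let ?A = "\<lambda>p. if p \<in> P then A p else 0"
    have "\<Phi> A = \<Phi> ?A" by (rule cong) auto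
    also have "\<dots> = (\<Sum>M\<in>bounded_multisets N P. a M * (\<Prod>e\<in>#M. ?A e))"
      using that by (intro a0) (auto simp: cube_def)
    also have "\<dots> = (\<Sum>M\<in>bounded_multisets N P. a M * (\<Prod>e\<in>#M. A e))"
      by (intro sum.cong refl arg_cong2[where f="(*)"] arg_cong[where f=prod_mset] image_mset_cong)
         (auto simp: bounded_multisets_def)
    finally show ?thesis .
  qed
  note fin = finite_bounded_multisets[OF P, of N]
  have coef: "coefficient N P M \<Phi> = a M" if "M \<in> bounded_multisets N P" for M
    using coefficient_polynomial[OF P order_refl that, of \<Phi> a] a that by simp
  have big: "a M = 0" if M: "M \<in> bounded_multisets N P" "size M > N" for M
  proof -
    define D where "D = size M"
    let ?S = "{M \<in> bounded_multisets N P. size M = D}"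
    have "(\<Sum>M\<in>?S. a M * (\<Prod>e\<in>#M. A e)) = 0" if A: "A \<in> cube" for A
    proof -
      have "(\<lambda>_. 0) \<in> cube" by (simp add: cube_def)
      from seg[OF this A] obtain q where q: "degree q \<le> N" "\<And>s. s \<in> {0..1} \<Longrightarrow> \<Phi> (\<lambda>e. s * A e) = poly q s"
        by auto
      define r where "r = (\<Sum>M\<in>bounded_multisets N P. monom (a M * (\<Prod>e\<in>#M. A e)) (size M))"
      have "poly q s = poly r s" if s: "s \<in> {0..1}" for s
      proof -
        have "(\<lambda>e. s * A e) \<in> cube" using A s by (auto simp: cube_def mult_le_one)
        then have "\<Phi> (\<lambda>e. s * A e) = (\<Sum>M\<in>bounded_multisets N P. a M * (\<Prod>e\<in>#M. s * A e))" by (rule a)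
        also have "\<dots> = poly r s"
          unfolding r_def poly_sum poly_monom by (intro sum.cong refl) (simp add: prod_mset.distrib mult_ac)
        finally show ?thesis using q(2)[OF s] by simp
      qed
      then have "{0..1} \<subseteq> {s. poly (q - r) s = 0}" by auto
      then have "infinite {s. poly (q - r) s = 0}" by (rule infinite_super) (simp add: infinite_Icc)
      then have "q - r = 0" using poly_roots_finite[of "q - r"] by blast
      then have "q = r" by simp
      moreover have "coeff q D = 0" using q(1) M(2) by (intro coeff_eq_0) (simp add: D_def)
      ultimately have "0 = coeff r D" by simp
      also have "\<dots> = (\<Sum>M\<in>bounded_multisets N P. if size M = D then a M * (\<Prod>e\<in>#M. A e) else 0)"
        unfolding r_def coeff_sum by (intro sum.cong) auto
      also have "\<dots> = (\<Sum>M\<in>?S. a M * (\<Prod>e\<in>#M. A e))"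
        using fin by (subst sum.inter_filter[symmetric]) auto
      finally show ?thesis by simp
    qed
    then have "coefficient N P M (\<lambda>_. 0) = (if M \<in> ?S then a M else 0)"
      using M(1) by (intro coefficient_polynomial[OF P]) (blast, blast, simp)
    then show ?thesis using M by (simp add: coefficient_zero D_def)
  qed
  have "\<Phi> A = (\<Sum>M\<in>bounded_multisets N P. a M * (\<Prod>e\<in>#M. A e))" by (rule a[OF A])
  also have "\<dots> = (\<Sum>M\<in>small_multisets N P. a M * (\<Prod>e\<in>#M. A e))"
    using fin big small_bounded[of N P]
    by (intro sum.mono_neutral_right) (auto simp: small_multisets_def bounded_multisets_def)
  also have "\<dots> = (\<Sum>M\<in>small_multisets N P. coefficient N P M \<Phi> * (\<Prod>e\<in>#M. A e))"
    using coef small_bounded[of N P] by (intro sum.cong refl) auto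
  finally show ?thesis .
qed

section \<open>Step kernels\<close>

lemma space_unit_interval [simp]: "space unit_interval = {0..1}"
  by (simp add: unit_interval_def space_restrict_space)

lemma sets_unit_interval: "sets unit_interval = sets (restrict_space borel {0..1})"
  unfolding unit_interval_def by (intro sets_restrict_space_cong) simp

lemma sets_unit_interval_iff: "A \<in> sets unit_interval \<longleftrightarrow> A \<in> sets borel \<and> A \<subseteq> {0..1}"
  unfolding sets_unit_interval by (subst sets_restrict_space_iff) auto

lemma emeasure_unit_interval: "A \<subseteq> {0..1} \<Longrightarrow> emeasure unit_interval A = emeasure lborel A"
  unfolding unit_interval_def by (subst emeasure_restrict_space) auto

lemma prob_space_unit_interval: "prob_space unit_interval"
  by (rule prob_spaceI) (simp add: emeasure_unit_interval)

interpretation unit_interval: prob_space unit_interval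
  by (rule prob_space_unit_interval)

lemma prob_space_unit_square: "prob_space unit_square"
proof -
  interpret pair_prob_space unit_interval unit_interval
    by unfold_locales
  show ?thesis unfolding unit_square_def by (rule prob_space_axioms)
qed

interpretation unit_square: prob_space unit_square
  by (rule prob_space_unit_square)

lemma space_unit_square [simp]: "space unit_square = {0..1} \<times> {0..1}"
  by (simp add: unit_square_def space_pair_measure)

definition block :: "nat \<Rightarrow> real \<Rightarrow> nat" where
  "block n x = min (n - 1) (nat \<lfloor>real n * x\<rfloor>)"

lemma block_less: "n > 0 \<Longrightarrow> block n x < n"
  by (auto simp: block_def)

lemma measurable_block [measurable]: "block n \<in> measurable unit_interval (count_space UNIV)"
proof -
  have "block n \<in> measurable borel (count_space UNIV)"
    unfolding block_def by measurable
  then have "block n \<in> measurable lborel (count_space UNIV)" by simp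
  then show ?thesis unfolding unit_interval_def by (rule measurable_restrict_space1)
qed

lemma block_div:
  assumes "n > 0" "m > 0"
  shows "block (n * m) x div m = block n x"
proof -
  have 1: "nat \<lfloor>real (n * m) * x\<rfloor> div m = nat \<lfloor>real n * x\<rfloor>"
  proof -
    have "\<lfloor>real (n * m) * x\<rfloor> div int m = \<lfloor>real (n * m) * x / real m\<rfloor>"
      using floor_divide_real_eq_div[of "int m" "real (n * m) * x"] by simp
    also have "\<dots> = \<lfloor>real n * x\<rfloor>" using assms by simp
    finally have div: "\<lfloor>real (n * m) * x\<rfloor> div int m = \<lfloor>real n * x\<rfloor>" .
    show ?thesis
    proof (cases "x \<ge> 0")
      case True
      then have "\<lfloor>real (n * m) * x\<rfloor> \<ge> 0" by simp
      then show ?thesis using nat_div_distrib[of "\<lfloor>real (n * m) * x\<rfloor>" "int m"] by (simp only: div nat_int)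
    next
      case False
      then have "real (n * m) * x \<le> 0" "real n * x \<le> 0" by (simp_all add: mult_nonneg_nonpos)
      then have "\<lfloor>real (n * m) * x\<rfloor> \<le> 0" "\<lfloor>real n * x\<rfloor> \<le> 0"
        by (simp_all add: floor_le_iff)
      then show ?thesis by simp
    qed
  qed
  have 2: "(n * m - 1) div m = n - 1"
  proof -
    obtain n' where "n = Suc n'" using assms not0_implies_Suc by blast
    then have "n * m - 1 = (m - 1) + n' * m" using assms by simp
    moreover have "((m - 1) + n' * m) div m = n' + (m - 1) div m"
      by (rule div_mult_self1) (use assms in simp)
    moreover have "(m - 1) div m = 0" using assms by simp
    ultimately show ?thesis using \<open>n = Suc n'\<close> by simp
  qed
  have "min (n * m - 1) k div m = min ((n * m - 1) div m) (k div m)" for k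
    by (simp add: div_le_mono min_def) (metis div_le_mono nle_le)
  then show ?thesis unfolding block_def 1 2 using 1 2 by simp
qed

lemma block_eq_iff:
  assumes "i < n" "x \<in> {0..<1}"
  shows "block n x = i \<longleftrightarrow> x \<in> {real i / n ..< (real i + 1) / n}"
proof -
  have n: "n > 0" using assms by simp
  have lt: "nat \<lfloor>real n * x\<rfloor> < n"
    using assms n by (simp add: nat_less_iff floor_less_iff)
  then have "block n x = nat \<lfloor>real n * x\<rfloor>" by (simp add: block_def)
  also have "\<dots> = i \<longleftrightarrow> \<lfloor>real n * x\<rfloor> = int i" using assms n by auto
  also have "\<dots> \<longleftrightarrow> real i \<le> real n * x \<and> real n * x < real i + 1"
    by (simp add: floor_eq_iff)
  also have "\<dots> \<longleftrightarrow> x \<in> {real i / n ..< (real i + 1) / n}"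
    using n by (auto simp: field_simps)
  finally show ?thesis .
qed

lemma block_interval_eq:
  assumes "i < n"
  shows "{real i / n ..< (real i + 1) / n} = {x \<in> {0..<1}. block n x = i}"
proof -
  have "x \<in> {0..<1}" if "x \<in> {real i / n ..< (real i + 1) / n}" for x
  proof -
    have "(real i + 1) / n \<le> 1" using assms by simp
    moreover have "0 \<le> real i / n" by simp
    ultimately show ?thesis using that unfolding atLeastLessThan_iff by linarith
  qed
  then show ?thesis using block_eq_iff[OF assms] by blast
qed

lemma measure_block:
  assumes "i < n"
  shows "measure unit_interval {x \<in> {0..1}. block n x = i} = 1 / n"
proof -
  have n: "n > 0" using assms by simp
  have "emeasure unit_interval {x \<in> {0..1}. block n x = i} = emeasure lborel {x \<in> {0..1}. block n x = i}"
    by (rule emeasure_unit_interval) auto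
  also have "\<dots> = emeasure lborel {real i / n ..< (real i + 1) / n}"
  proof (rule emeasure_eq_AE)
    have "AE x in lborel. x \<noteq> (1::real)" by (rule AE_lborel_singleton)
    then show "AE x in lborel. (x \<in> {x \<in> {0..1}. block n x = i}) = (x \<in> {real i / n ..< (real i + 1) / n})"
    proof eventually_elim
      case (elim x)
      have "x \<in> {0..<1} \<longleftrightarrow> x \<in> {0..1}" using elim by auto
      then show ?case using block_interval_eq[OF assms] by blast
    qed
    have "{x \<in> {0..1}. block n x = i} \<in> sets unit_interval"
      using measurable_sets[OF measurable_block[of n], of "{i}"] by (simp add: vimage_def Int_def conj_commute)
    then show "{x \<in> {0..1}. block n x = i} \<in> sets lborel" by (simp add: sets_unit_interval_iff)
  qed auto
  also have "\<dots> = ennreal (1 / n)" using n by (simp add: divide_right_mono diff_divide_distrib[symmetric])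
  finally show ?thesis by (simp add: measure_def)
qed

lemma integral_block_eq: "i < n \<Longrightarrow> (LINT x|unit_interval. of_bool (block n x = i)) = (1 / n :: real)"
proof -
  assume i: "i < n"
  have "(LINT x|unit_interval. of_bool (block n x = i)) = (LINT x|unit_interval. indicator {x \<in> {0..1}. block n x = i} x :: real)"
    by (rule Bochner_Integration.integral_cong) (auto simp: indicator_def)
  also have "\<dots> = 1 / n" using measure_block[OF i]
    by (simp add: Int_def conj_ac)
  finally show ?thesis .
qed

lemma integral_PiM_block:
  fixes g :: "('i \<Rightarrow> nat) \<Rightarrow> real"
  assumes "finite V" "n > 0"
  shows "(LINT x|(\<Pi>\<^sub>M v\<in>V. unit_interval). g (restrict (\<lambda>i. block n (x i)) V))
    = (\<Sum>v\<in>PiE V (\<lambda>_. {..<n}). g v) / real n ^ card V"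
proof -
  interpret product_prob_space "\<lambda>_::'i. unit_interval" V by unfold_locales
  let ?M = "\<Pi>\<^sub>M v\<in>V. unit_interval"
  let ?I = "\<lambda>v x. \<Prod>i\<in>V. of_bool (block n (x i) = v i) :: real"
  have fin: "finite (PiE V (\<lambda>_. {..<n}))" by (intro finite_PiE assms) auto
  have I: "?I v x = of_bool (restrict (\<lambda>i. block n (x i)) V = v)" if "v \<in> PiE V (\<lambda>_. {..<n})" for v x
  proof (cases "\<forall>i\<in>V. block n (x i) = v i")
    case True
    then show ?thesis using that by (auto simp: PiE_def extensional_def restrict_def intro!: ext)
  next
    case False
    then show ?thesis using assms(1) by (auto intro: prod_zero)
  qed
  have "g (restrict (\<lambda>i. block n (x i)) V) = (\<Sum>v\<in>PiE V (\<lambda>_. {..<n}). g v * ?I v x)" for x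
  proof -
    have "restrict (\<lambda>i. block n (x i)) V \<in> PiE V (\<lambda>_. {..<n})" using block_less assms by auto
    then have "g (restrict (\<lambda>i. block n (x i)) V) = (\<Sum>v\<in>PiE V (\<lambda>_. {..<n}). if v = restrict (\<lambda>i. block n (x i)) V then g v else 0)"
      using fin by (simp add: sum.delta)
    also have "\<dots> = (\<Sum>v\<in>PiE V (\<lambda>_. {..<n}). g v * ?I v x)"
      by (intro sum.cong refl) (auto simp: I)
    finally show ?thesis .
  qed
  then have "(LINT x|?M. g (restrict (\<lambda>i. block n (x i)) V)) = (LINT x|?M. (\<Sum>v\<in>PiE V (\<lambda>_. {..<n}). g v * ?I v x))"
    by simp
  also have int: "integrable unit_interval (\<lambda>x. of_bool (block n x = k) :: real)" for k
    by (intro unit_interval.integrable_const_bound[of _ 1]) auto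
  have "(LINT x|?M. (\<Sum>v\<in>PiE V (\<lambda>_. {..<n}). g v * ?I v x)) = (\<Sum>v\<in>PiE V (\<lambda>_. {..<n}). LINT x|?M. g v * ?I v x)"
    by (intro Bochner_Integration.integral_sum integrable_mult_right product_integrable_prod assms int)
  also have "\<dots> = (\<Sum>v\<in>PiE V (\<lambda>_. {..<n}). g v / real n ^ card V)"
  proof (intro sum.cong refl)
    fix v assume v: "v \<in> PiE V (\<lambda>_. {..<n})"
    have "(LINT x|?M. g v * ?I v x) = g v * (LINT x|?M. ?I v x)" by simp
    also have "(LINT x|?M. ?I v x) = (\<Prod>i\<in>V. LINT x|unit_interval. of_bool (block n x = v i))"
      by (intro product_integral_prod assms int)
    also have "\<dots> = (\<Prod>i\<in>V. 1 / real n)"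
      using v by (intro prod.cong refl integral_block_eq) auto
    finally show "(LINT x|?M. g v * ?I v x) = g v / real n ^ card V" by (simp add: power_divide)
  qed
  finally show ?thesis by (simp add: sum_divide_distrib)
qed

lemma integral_square_block_weighted:
  fixes g :: "nat \<Rightarrow> nat \<Rightarrow> real" and p q :: "real \<Rightarrow> real"
  assumes "n > 0" and [measurable]: "p \<in> borel_measurable unit_interval" "q \<in> borel_measurable unit_interval"
    and pq: "\<And>x. \<bar>p x\<bar> \<le> 1" "\<And>x. \<bar>q x\<bar> \<le> 1"
  shows "(LINT z|unit_square. p (fst z) * q (snd z) * g (block n (fst z)) (block n (snd z))) =
    (\<Sum>i<n. \<Sum>j<n. g i j * ((LINT x|unit_interval. p x * of_bool (block n x = i)) * (LINT x|unit_interval. q x * of_bool (block n x = j))))"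
proof -
  interpret P: pair_prob_space unit_interval unit_interval by unfold_locales
  let ?p = "\<lambda>i x. p x * of_bool (block n x = i)" let ?q = "\<lambda>j x. q x * of_bool (block n x = j)"
  have [measurable]: "?p i \<in> borel_measurable unit_interval" "?q i \<in> borel_measurable unit_interval" for i
    by measurable
  have le1: "\<bar>?p i x\<bar> \<le> 1" "\<bar>?q i x\<bar> \<le> 1" for i x using pq by auto
  have eq: "p x * q y * g (block n x) (block n y) = (\<Sum>i<n. \<Sum>j<n. g i j * (?p i x * ?q j y))" for x y
  proof -
    have "(\<Sum>i<n. \<Sum>j<n. g i j * (?p i x * ?q j y))
      = (\<Sum>i<n. if i = block n x then (\<Sum>j<n. if j = block n y then p x * q y * g i j else 0) else 0)"
      by (intro sum.cong refl) (auto intro!: sum.cong sum.neutral simp del: sum.delta sum.delta')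
    also have "\<dots> = p x * q y * g (block n x) (block n y)"
      by (simp only: sum.delta' sum.delta finite_lessThan lessThan_iff block_less[OF assms(1)] if_True)
    finally show ?thesis by (rule sym)
  qed
  have int: "integrable unit_square (\<lambda>z. ?p i (fst z) * ?q j (snd z))" for i j
    unfolding unit_square_def
  proof (intro P.integrable_const_bound[of _ 1] AE_I2)
    show "norm (?p i (fst z) * ?q j (snd z)) \<le> 1" for z
      unfolding real_norm_def abs_mult[of "?p i (fst z)"] using le1 by (intro mult_le_one) auto
  qed measurable
  have "(LINT z|unit_square. p (fst z) * q (snd z) * g (block n (fst z)) (block n (snd z))) =
    (\<Sum>i<n. \<Sum>j<n. g i j * (LINT z|unit_square. ?p i (fst z) * ?q j (snd z)))"
    unfolding eq using int by (simp add: Bochner_Integration.integral_sum)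
  also have "\<dots> = (\<Sum>i<n. \<Sum>j<n. g i j * ((LINT x|unit_interval. ?p i x) * (LINT x|unit_interval. ?q j x)))"
  proof (intro sum.cong refl arg_cong2[where f="(*)"])
    fix i j
    have "(LINT x|unit_interval. LINT y|unit_interval. (\<lambda>z. ?p i (fst z) * ?q j (snd z)) (x, y))
      = (LINT z|unit_square. ?p i (fst z) * ?q j (snd z))"
      unfolding unit_square_def by (rule P.integral_fst') (use int in \<open>simp add: unit_square_def\<close>)
    then show "(LINT z|unit_square. ?p i (fst z) * ?q j (snd z)) = (LINT x|unit_interval. ?p i x) * (LINT x|unit_interval. ?q j x)"
      by simp
  qed
  finally show ?thesis .
qed

lemma integral_square_block:
  fixes g :: "nat \<Rightarrow> nat \<Rightarrow> real"
  assumes "n > 0"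
  shows "(LINT z|unit_square. g (block n (fst z)) (block n (snd z))) = (\<Sum>i<n. \<Sum>j<n. g i j) / (real n)\<^sup>2"
proof -
  have "(LINT z|unit_square. g (block n (fst z)) (block n (snd z))) = (\<Sum>i<n. \<Sum>j<n. g i j * (1 / n * (1 / n)))"
    using integral_square_block_weighted[OF assms, of "\<lambda>_. 1" "\<lambda>_. 1" g] by (simp add: integral_block_eq)
  then show ?thesis by (simp add: power2_eq_square sum_divide_distrib)
qed

definition step_kernel :: "nat \<Rightarrow> (nat set \<Rightarrow> real) \<Rightarrow> kernel" where
  "step_kernel n A = (\<lambda>(x, y). A {block n x, block n y})"

lemma measurable_block_pair:
  "(\<lambda>z. h (block n (fst z)) (block n (snd z))) \<in> borel_measurable unit_square"
  for h :: "nat \<Rightarrow> nat \<Rightarrow> real"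
proof -
  have "(\<lambda>z. (block n (fst z), block n (snd z))) \<in> measurable unit_square (count_space UNIV)"
  proof (rule measurable_count_space_eq2_countable[THEN iffD2], safe)
    fix a b
    show "(\<lambda>z. (block n (fst z), block n (snd z))) -` {(a, b)} \<inter> space unit_square \<in> sets unit_square"
    proof -
      have "{x\<in>space unit_interval. block n x = a} \<times> {x\<in>space unit_interval. block n x = b} \<in> sets unit_square"
        unfolding unit_square_def by (intro pair_measureI) measurable
      also have "{x\<in>space unit_interval. block n x = a} \<times> {x\<in>space unit_interval. block n x = b} =
         (\<lambda>z. (block n (fst z), block n (snd z))) -` {(a, b)} \<inter> space unit_square" by auto
      finally show ?thesis .
    qed
  qed auto
  then have "(\<lambda>z. case_prod h (block n (fst z), block n (snd z))) \<in> borel_measurable unit_square"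
    by (rule measurable_compose) simp
  then show ?thesis by simp
qed

lemma measurable_step_kernel [measurable]: "step_kernel n A \<in> borel_measurable unit_square"
  using measurable_block_pair[of "\<lambda>i j. A {i, j}" n]
  by (simp add: step_kernel_def case_prod_unfold)

lemma graphonsI:
  assumes "f \<in> borel_measurable unit_square"
    and "\<And>x y. x \<in> {0..1} \<Longrightarrow> y \<in> {0..1} \<Longrightarrow> f (x, y) \<in> {0..1}"
    and "\<And>x y. x \<in> {0..1} \<Longrightarrow> y \<in> {0..1} \<Longrightarrow> f (x, y) = f (y, x)"
  shows "f \<in> graphons"
proof -
  have "f ` ({0..1} \<times> {0..1}) \<subseteq> {0..1}" using assms(2) by auto
  then have "bounded (f ` ({0..1} \<times> {0..1}))" by (rule bounded_subset[OF bounded_closed_interval])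
  with assms show ?thesis by (auto simp: graphons_def kernels_def)
qed

lemma step_kernel_graphon: "A \<in> cube \<Longrightarrow> step_kernel n A \<in> graphons"
  by (intro graphonsI measurable_step_kernel) (auto simp: step_kernel_def cube_def insert_commute)

lemma L1_norm_step_kernel_diff:
  assumes "n > 0"
  shows "L1_norm (\<lambda>z. step_kernel n A z - step_kernel n B z)
    = (\<Sum>i<n. \<Sum>j<n. \<bar>A {i, j} - B {i, j}\<bar>) / (real n)\<^sup>2"
  using integral_square_block[OF assms, of "\<lambda>i j. \<bar>A {i, j} - B {i, j}\<bar>"]
  by (simp add: L1_norm_def step_kernel_def case_prod_unfold)

lemma Min_Max_edge: "card e = 2 \<Longrightarrow> {Min e, Max e} = (e :: nat set)"
proof -
  assume "card e = 2"
  then obtain a b where "e = {a, b}" "a \<noteq> b" by (auto simp: card_2_iff)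
  then show ?thesis by (auto simp: min_def max_def)
qed

lemma edge_verts:
  assumes "loopless_multigraph G" "e \<in># edges G"
  shows "Min e \<in> verts G" "Max e \<in> verts G" "Min e \<noteq> Max e"
proof -
  have "card e = 2" "e \<subseteq> verts G" using assms by (auto simp: loopless_multigraph_def)
  then obtain a b where "e = {a, b}" "a \<noteq> b" "a \<in> verts G" "b \<in> verts G" by (auto simp: card_2_iff)
  then show "Min e \<in> verts G" "Max e \<in> verts G" "Min e \<noteq> Max e" by (auto simp: min_def max_def)
qed

lemma hom_density_step_kernel:
  assumes "loopless_multigraph G" "n > 0"
  shows "hom_density G (step_kernel n A) =
    (\<Sum>v\<in>PiE (verts G) (\<lambda>_. {..<n}). \<Prod>e\<in>#edges G. A (v ` e)) / real n ^ card (verts G)"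
proof -
  have "hom_density G (step_kernel n A) = (LINT x|(\<Pi>\<^sub>M v\<in>verts G. unit_interval).
     (\<lambda>v. \<Prod>e\<in>#edges G. A (v ` e)) (restrict (\<lambda>i. block n (x i)) (verts G)))"
    unfolding hom_density_def
  proof (intro Bochner_Integration.integral_cong refl)
    fix x
    show "(\<Prod>e\<in>#edges G. step_kernel n A (x (Min e), x (Max e))) =
      (\<lambda>v. \<Prod>e\<in>#edges G. A (v ` e)) (restrict (\<lambda>i. block n (x i)) (verts G))"
    proof (intro arg_cong[where f=prod_mset] image_mset_cong)
      fix e assume e: "e \<in># edges G"
      have "restrict (\<lambda>i. block n (x i)) (verts G) ` {Min e, Max e} = {block n (x (Min e)), block n (x (Max e))}"
        using edge_verts[OF assms(1) e] by simp
      moreover have "{Min e, Max e} = e" using assms(1) e by (intro Min_Max_edge) (simp add: loopless_multigraph_def)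
      ultimately show "step_kernel n A (x (Min e), x (Max e)) = A (restrict (\<lambda>i. block n (x i)) (verts G) ` e)"
        by (simp add: step_kernel_def)
    qed
  qed
  also have "\<dots> = (\<Sum>v\<in>PiE (verts G) (\<lambda>_. {..<n}). \<Prod>e\<in>#edges G. A (v ` e)) / real n ^ card (verts G)"
    using assms by (intro integral_PiM_block) (auto simp: loopless_multigraph_def)
  finally show ?thesis .
qed

lemma distr_PiM_pair:
  assumes "finite V" "i \<in> V" "j \<in> V" "i \<noteq> j"
  shows "distr (\<Pi>\<^sub>M v\<in>V. unit_interval) unit_square (\<lambda>x. (x i, x j)) = unit_square"
proof -
  interpret product_prob_space "\<lambda>_. unit_interval" V by unfold_locales
  let ?M = "\<Pi>\<^sub>M v\<in>V. unit_interval"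
  have meas: "(\<lambda>x. (x i, x j)) \<in> measurable ?M unit_square"
    unfolding unit_square_def using assms by measurable
  show ?thesis
  proof (rule sym, unfold unit_square_def, rule pair_measure_eqI)
    fix A B assume A: "A \<in> sets unit_interval" and B: "B \<in> sets unit_interval"
    let ?X = "\<lambda>k. if k = i then A else B"
    have AB: "A \<subseteq> space unit_interval" "B \<subseteq> space unit_interval"
      using A B sets.sets_into_space by blast+
    have "(\<lambda>x. (x i, x j)) -` (A \<times> B) \<inter> space ?M = prod_emb V (\<lambda>_. unit_interval) {i, j} (PiE {i, j} ?X)"
      using assms AB by (auto simp: prod_emb_def space_PiM PiE_def Pi_def restrict_def extensional_def split: if_splits)
    then have "emeasure (distr ?M unit_square (\<lambda>x. (x i, x j))) (A \<times> B) =
      emeasure ?M (prod_emb V (\<lambda>_. unit_interval) {i, j} (PiE {i, j} ?X))"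
      using A B by (subst emeasure_distr[OF meas]) (auto simp: unit_square_def)
    also have "\<dots> = (\<Prod>k\<in>{i, j}. emeasure unit_interval (?X k))"
      using assms A B by (intro emeasure_PiM_emb) auto
    also have "\<dots> = emeasure unit_interval A * emeasure unit_interval B" using assms by simp
    finally show "emeasure unit_interval A * emeasure unit_interval B =
      emeasure (distr ?M (unit_interval \<Otimes>\<^sub>M unit_interval) (\<lambda>x. (x i, x j))) (A \<times> B)"
      by (simp add: unit_square_def)
  qed (auto intro: unit_interval.sigma_finite_measure_axioms)
qed

lemma measurable_PiM_pair [measurable]:
  assumes "i \<in> V" "j \<in> V"
  shows "(\<lambda>x. (x i, x j)) \<in> measurable (\<Pi>\<^sub>M v\<in>V. unit_interval) unit_square"
  unfolding unit_square_def using assms by measurable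

lemma kernels_bounded:
  assumes "f \<in> kernels"
  obtains B where "B \<ge> 0" "\<And>x y. x \<in> {0..1} \<Longrightarrow> y \<in> {0..1} \<Longrightarrow> \<bar>f (x, y)\<bar> \<le> B"
proof -
  have "bounded (f ` ({0..1} \<times> {0..1}))" using assms by (simp add: kernels_def)
  then obtain B where "\<And>z. z \<in> {0..1} \<times> {0..1} \<Longrightarrow> \<bar>f z\<bar> \<le> B" by (auto simp: bounded_iff)
  then show ?thesis using that[of "max B 0"] by (metis SigmaI max.coboundedI1 max.cobounded2)
qed

lemma L1_norm_PiM:
  assumes "finite V" "i \<in> V" "j \<in> V" "i \<noteq> j" "f \<in> borel_measurable unit_square"
  shows "(LINT x|(\<Pi>\<^sub>M v\<in>V. unit_interval). \<bar>f (x i, x j)\<bar>) = L1_norm f"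
proof -
  have "L1_norm f = (LINT z|distr (\<Pi>\<^sub>M v\<in>V. unit_interval) unit_square (\<lambda>x. (x i, x j)). \<bar>f z\<bar>)"
    by (simp add: L1_norm_def distr_PiM_pair[OF assms(1-4)])
  also have "\<dots> = (LINT x|(\<Pi>\<^sub>M v\<in>V. unit_interval). \<bar>f (x i, x j)\<bar>)"
    using assms by (intro integral_distr measurable_PiM_pair borel_measurable_abs)
  finally show ?thesis by simp
qed

lemma prod_mset_diff_le:
  fixes a b :: "'a \<Rightarrow> real"
  assumes "\<And>e. e \<in># M \<Longrightarrow> a e \<in> {0..1}" "\<And>e. e \<in># M \<Longrightarrow> b e \<in> {0..1}"
  shows "\<bar>(\<Prod>e\<in>#M. a e) - (\<Prod>e\<in>#M. b e)\<bar> \<le> (\<Sum>e\<in>#M. \<bar>a e - b e\<bar>)"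
  using assms
proof (induction M)
  case (add e M)
  have pa: "(\<Prod>e\<in>#M. b e) \<in> {0..1}" using add.prems(2)
    by (induction M) (auto intro: mult_le_one mult_nonneg_nonneg simp del: mult_nonneg_nonneg)
  have "\<bar>(\<Prod>e\<in>#add_mset e M. a e) - (\<Prod>e\<in>#add_mset e M. b e)\<bar>
    = \<bar>a e * ((\<Prod>e\<in>#M. a e) - (\<Prod>e\<in>#M. b e)) + (a e - b e) * (\<Prod>e\<in>#M. b e)\<bar>"
    by (simp add: algebra_simps)
  also have "\<dots> \<le> \<bar>a e\<bar> * \<bar>(\<Prod>e\<in>#M. a e) - (\<Prod>e\<in>#M. b e)\<bar> + \<bar>a e - b e\<bar> * \<bar>(\<Prod>e\<in>#M. b e)\<bar>"
    by (metis abs_mult abs_triangle_ineq)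
  also have "\<dots> \<le> 1 * (\<Sum>e\<in>#M. \<bar>a e - b e\<bar>) + \<bar>a e - b e\<bar> * 1"
    using add pa by (intro add_mono mult_mono) (auto)
  finally show ?case by simp
qed simp

lemma measurable_edge_prod:
  assumes "\<And>e. e \<in># M \<Longrightarrow> Min e \<in> V \<and> Max e \<in> V"
    "\<And>e. e \<in># M \<Longrightarrow> f e \<in> borel_measurable unit_square"
  shows "(\<lambda>x. \<Prod>e\<in>#M. f e (x (Min e), x (Max e)) :: real) \<in> borel_measurable (\<Pi>\<^sub>M v\<in>V. unit_interval)"
  using assms
proof (induction M)
  case (add e M)
  have "(\<lambda>x. f e (x (Min e), x (Max e))) \<in> borel_measurable (\<Pi>\<^sub>M v\<in>V. unit_interval)"
    using add.prems by (intro measurable_compose[OF measurable_PiM_pair]) auto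
  with add show ?case by simp
qed simp

lemma hom_density_L1_Lipschitz:
  assumes G: "loopless_multigraph G" and "f \<in> graphons" "g \<in> graphons"
  shows "\<bar>hom_density G g - hom_density G f\<bar> \<le> size (edges G) * L1_norm (\<lambda>z. g z - f z)"
proof -
  let ?V = "verts G" let ?M = "\<Pi>\<^sub>M v\<in>?V. unit_interval"
  interpret product_prob_space "\<lambda>_. unit_interval" ?V by unfold_locales
  have V: "finite ?V" using G by (simp add: loopless_multigraph_def)
  have rng: "h (x (Min e), x (Max e)) \<in> {0..1}" if "h \<in> graphons" "x \<in> space ?M" "e \<in># edges G" for h x e
  proof -
    have "x (Min e) \<in> {0..1}" "x (Max e) \<in> {0..1}"
      using that(2) edge_verts[OF G that(3)] by (auto simp: space_PiM PiE_def)
    then show ?thesis using that(1) by (auto simp: graphons_def)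
  qed
  have fgm [measurable]: "f \<in> borel_measurable unit_square" "g \<in> borel_measurable unit_square"
    using assms by (auto simp: graphons_def kernels_def)
  have prng: "(\<Prod>e\<in>#E. h (x (Min e), x (Max e))) \<in> {0..1}" if "h \<in> graphons" "x \<in> space ?M" "E \<subseteq># edges G" for h x E
    using that(3)
  proof (induction E)
    case (add e E)
    have "e \<in># edges G" using add.prems by (simp add: mset_subset_eqD)
    from rng[OF that(1,2) this] add show ?case
      by (auto intro: mult_le_one simp: subset_mset.order_trans[OF mset_subset_eq_add_right] dest: subset_mset.order_trans[OF mset_subset_eq_add_right[of E "{#e#}"], simplified])
  qed simp
  have int: "integrable ?M (\<lambda>x. \<Prod>e\<in>#edges G. h (x (Min e), x (Max e)))" if "h \<in> graphons" for h
    using prng[OF that] that edge_verts[OF G]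
    by (intro P.integrable_const_bound[of _ 1] measurable_edge_prod) (auto simp: graphons_def kernels_def)
  have int1: "integrable ?M (\<lambda>x. \<bar>g (x (Min e), x (Max e)) - f (x (Min e), x (Max e))\<bar>)" if e: "e \<in># edges G" for e
  proof (intro P.integrable_const_bound[of _ 1])
    show "AE x in ?M. norm \<bar>g (x (Min e), x (Max e)) - f (x (Min e), x (Max e))\<bar> \<le> 1"
      using rng[OF assms(2) _ e] rng[OF assms(3) _ e] by (intro AE_I2) (auto simp: abs_le_iff, smt+)
    have [measurable]: "(\<lambda>x. (x (Min e), x (Max e))) \<in> measurable ?M unit_square"
      using edge_verts[OF G e] by (intro measurable_PiM_pair)
    show "(\<lambda>x. \<bar>g (x (Min e), x (Max e)) - f (x (Min e), x (Max e))\<bar>) \<in> borel_measurable ?M"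
      by measurable
  qed
  have ints: "integrable ?M (\<lambda>x. \<Sum>e\<in>#E. \<bar>g (x (Min e), x (Max e)) - f (x (Min e), x (Max e))\<bar>)
     \<and> (LINT x|?M. (\<Sum>e\<in>#E. \<bar>g (x (Min e), x (Max e)) - f (x (Min e), x (Max e))\<bar>)) = size E * L1_norm (\<lambda>z. g z - f z)"
    if "set_mset E \<subseteq> set_mset (edges G)" for E
    using that
  proof (induction E)
    case (add e E)
    then have e: "e \<in># edges G" by simp
    have "(LINT x|?M. \<bar>g (x (Min e), x (Max e)) - f (x (Min e), x (Max e))\<bar>) = L1_norm (\<lambda>z. g z - f z)"
      by (rule L1_norm_PiM[of ?V "Min e" "Max e" "\<lambda>z. g z - f z"]) (use edge_verts[OF G e] V in auto)
    with add int1[OF e] show ?case by (auto simp: algebra_simps)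
  qed simp
  have "\<bar>hom_density G g - hom_density G f\<bar> =
     \<bar>LINT x|?M. (\<Prod>e\<in>#edges G. g (x (Min e), x (Max e))) - (\<Prod>e\<in>#edges G. f (x (Min e), x (Max e)))\<bar>"
    unfolding hom_density_def using int assms by simp
  also have "\<dots> \<le> (LINT x|?M. \<bar>(\<Prod>e\<in>#edges G. g (x (Min e), x (Max e))) - (\<Prod>e\<in>#edges G. f (x (Min e), x (Max e)))\<bar>)"
    by (rule integral_abs_bound)
  also have "\<dots> \<le> (LINT x|?M. (\<Sum>e\<in>#edges G. \<bar>g (x (Min e), x (Max e)) - f (x (Min e), x (Max e))\<bar>))"
    using int assms ints rng by (intro integral_mono prod_mset_diff_le) auto
  also have "\<dots> = size (edges G) * L1_norm (\<lambda>z. g z - f z)" using ints by simp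
  finally show ?thesis .
qed

section \<open>Block permutations\<close>

lemma emeasure_lborel_translate:
  fixes c :: real
  assumes "B \<in> sets borel"
  shows "emeasure lborel {x. x + c \<in> B} = emeasure lborel B"
proof -
  have "emeasure lborel B = emeasure (distr lborel borel ((+) c)) B" by (simp add: lborel_distr_plus)
  also have "\<dots> = emeasure lborel {x. x + c \<in> B}"
    using assms by (subst emeasure_distr) (auto simp: vimage_def add.commute)
  finally show ?thesis by simp
qed

lemma ex_measure_preserving_block_permutation:
  assumes "\<pi> permutes {..<n}" "n > 0"
  obtains \<phi> where "\<phi> \<in> measure_preserving_maps" "\<And>x. x \<in> {0..1} \<Longrightarrow> \<phi> x \<in> {0..1} \<and> block n (\<phi> x) = \<pi> (block n x)"
proof -
  define \<phi> where "\<phi> x = (if x = 1 then real (\<pi> (n - 1)) / n else x + (real (\<pi> (block n x)) - real (block n x)) / n)" for x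
  define I where "I i = {real i / n ..< (real i + 1) / n}" for i
  have I: "I i = {x \<in> {0..<1}. block n x = i}" if "i < n" for i
    unfolding I_def using block_interval_eq[OF that] .
  have \<pi>: "\<pi> i < n" if "i < n" for i using permutes_in_image[OF assms(1), of i] that by simp
  have shift: "x + (real (\<pi> i) - real i) / n \<in> I (\<pi> i) \<longleftrightarrow> x \<in> I i" for x i
    by (auto simp: I_def diff_divide_distrib add_divide_distrib)
  have inI: "\<phi> x \<in> I (\<pi> (block n x))" if "x \<in> {0..1}" for x
  proof (cases "x = 1")
    case True
    then have "block n x = n - 1" by (simp add: block_def)
    then show ?thesis using True assms(2) by (simp add: \<phi>_def I_def divide_strict_right_mono)
  next
    case False
    then have "x \<in> I (block n x)" using that I block_less[OF assms(2)] by auto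
    then show ?thesis using shift[of x "block n x"] False by (simp add: \<phi>_def)
  qed
  have blk: "\<phi> x \<in> {0..1} \<and> block n (\<phi> x) = \<pi> (block n x)" if "x \<in> {0..1}" for x
    using inI[OF that] I[OF \<pi>[OF block_less[OF assms(2)]], of x] by auto
  have meas: "\<phi> \<in> measurable unit_interval unit_interval"
  proof -
    have "(\<lambda>x. real (\<pi> (block n x))) \<in> borel_measurable unit_interval" "(\<lambda>x. real (block n x)) \<in> borel_measurable unit_interval"
      by (auto intro!: measurable_compose[OF measurable_block])
    moreover have [measurable]: "(\<lambda>x. x) \<in> borel_measurable unit_interval"
      unfolding unit_interval_def by (intro measurable_restrict_space1) auto
    ultimately have "\<phi> \<in> borel_measurable unit_interval" unfolding \<phi>_def by measurable
    then have "\<phi> \<in> measurable unit_interval (restrict_space borel {0..1})"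
      using blk by (intro measurable_restrict_space2) auto
    then show ?thesis by (simp add: measurable_cong_sets[OF refl sets_unit_interval])
  qed
  have sumI: "(\<Sum>i<n. emeasure lborel (A \<inter> I i)) = emeasure lborel A" if A: "A \<in> sets borel" "A \<subseteq> {0..1}" for A
  proof -
    have "(\<Sum>i<n. emeasure lborel (A \<inter> I i)) = emeasure lborel (\<Union>i<n. A \<inter> I i)"
    proof (rule sum_emeasure)
      show "disjoint_family_on (\<lambda>i. A \<inter> I i) {..<n}" using I by (auto simp: disjoint_family_on_def)
      show "(\<lambda>i. A \<inter> I i) ` {..<n} \<subseteq> sets lborel" using A by (auto simp: I_def)
    qed auto
    also have "(\<Union>i<n. A \<inter> I i) = A \<inter> {0..<1}" using I block_less[OF assms(2)] by auto
    also have "emeasure lborel (A \<inter> {0..<1}) = emeasure lborel A"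
    proof (rule emeasure_eq_AE)
      have "AE x in lborel. x \<noteq> (1::real)" by (rule AE_lborel_singleton)
      then show "AE x in lborel. (x \<in> A \<inter> {0..<1}) = (x \<in> A)"
        by eventually_elim (use A in force)
    qed (use A in auto)
    finally show ?thesis .
  qed
  have "distr unit_interval unit_interval \<phi> = unit_interval"
  proof (rule measure_eqI)
    fix A assume "A \<in> sets (distr unit_interval unit_interval \<phi>)"
    then have Au: "A \<in> sets unit_interval" by simp
    then have A: "A \<in> sets borel" "A \<subseteq> {0..1}" by (auto simp: sets_unit_interval_iff)
    let ?B = "\<phi> -` A \<inter> {0..1}"
    have "?B \<in> sets unit_interval" using measurable_sets[OF meas Au] by simp
    then have B: "?B \<in> sets borel" "?B \<subseteq> {0..1}" by (auto simp: sets_unit_interval_iff)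
    have "emeasure (distr unit_interval unit_interval \<phi>) A = emeasure lborel ?B"
      using meas Au B by (simp add: emeasure_distr emeasure_unit_interval)
    also have "\<dots> = (\<Sum>i<n. emeasure lborel (?B \<inter> I i))" using sumI[OF B] by simp
    also have "\<dots> = (\<Sum>i<n. emeasure lborel (A \<inter> I (\<pi> i)))"
    proof (intro sum.cong refl)
      fix i assume "i \<in> {..<n}"
      then have i: "i < n" by simp
      have "?B \<inter> I i = {x. x + (real (\<pi> i) - real i) / n \<in> A \<inter> I (\<pi> i)}"
      proof (rule set_eqI, cases)
        fix x assume x: "x \<in> I i"
        then have "x \<in> {0..1}" "\<phi> x = x + (real (\<pi> i) - real i) / n" using I[OF i] by (auto simp: \<phi>_def)
        then show "x \<in> ?B \<inter> I i \<longleftrightarrow> x \<in> {x. x + (real (\<pi> i) - real i) / n \<in> A \<inter> I (\<pi> i)}"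
          using x shift[of x i] by (simp only: Int_iff vimage_eq mem_Collect_eq simp_thms)
      next
        fix x assume "x \<notin> I i"
        then show "x \<in> ?B \<inter> I i \<longleftrightarrow> x \<in> {x. x + (real (\<pi> i) - real i) / n \<in> A \<inter> I (\<pi> i)}"
          using shift[of x i] by blast
      qed
      then show "emeasure lborel (?B \<inter> I i) = emeasure lborel (A \<inter> I (\<pi> i))"
        using A by (simp only:) (intro emeasure_lborel_translate, auto simp: I_def)
    qed
    also have "\<dots> = (\<Sum>i<n. emeasure lborel (A \<inter> I i))"
      using sum.permute[OF assms(1), of "\<lambda>i. emeasure lborel (A \<inter> I i)"] by (simp add: o_def)
    also have "\<dots> = emeasure lborel A" by (rule sumI[OF A])
    also have "\<dots> = emeasure unit_interval A" using A by (simp add: emeasure_unit_interval)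
    finally show "emeasure (distr unit_interval unit_interval \<phi>) A = emeasure unit_interval A" .
  qed simp
  then show ?thesis using that[of \<phi>] meas blk by (auto simp: measure_preserving_maps_def)
qed

lemma abs_set_integral_unit_square_le:
  fixes h :: kernel
  assumes "\<And>z. z \<in> {0..1} \<times> {0..1} \<Longrightarrow> \<bar>h z\<bar> \<le> B" "B \<ge> 0"
  shows "\<bar>LINT z:A|unit_square. h z\<bar> \<le> B"
proof -
  have "\<bar>LINT z:A|unit_square. h z\<bar> \<le> (LINT z|unit_square. \<bar>indicator A z * h z\<bar>)"
    unfolding set_lebesgue_integral_def real_scaleR_def by (rule integral_abs_bound)
  also have "\<dots> \<le> B"
  proof (cases "integrable unit_square (\<lambda>z. \<bar>indicator A z * h z\<bar>)")
    case True
    have "(LINT z|unit_square. \<bar>indicator A z * h z\<bar>) \<le> (LINT z|unit_square. B)"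
      using assms by (intro integral_mono True) (auto simp: indicator_def)
    then show ?thesis by (simp add: unit_square.prob_space[simplified])
  qed (simp add: not_integrable_integral_eq assms)
  finally show ?thesis .
qed

lemma cut_norm_nonneg:
  assumes "\<And>z. z \<in> {0..1} \<times> {0..1} \<Longrightarrow> \<bar>h z\<bar> \<le> B" "B \<ge> 0"
  shows "cut_norm h \<ge> 0"
proof -
  have "0 \<le> \<bar>LINT z:{} \<times> {}|unit_square. h z\<bar>" by simp
  also have "\<dots> \<le> cut_norm h" unfolding cut_norm_def
  proof (rule cSUP_upper2[where x = "({}, {})"])
    show "bdd_above ((\<lambda>(S, T). \<bar>LINT z:S \<times> T|unit_square. h z\<bar>) ` (sets unit_interval \<times> sets unit_interval))"
      using abs_set_integral_unit_square_le[OF assms] by (intro bdd_aboveI2[of _ _ B]) auto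
  qed auto
  finally show ?thesis .
qed

lemma cut_distance_pullback:
  assumes "f \<in> graphons" "g \<in> graphons" "\<phi> \<in> measure_preserving_maps"
    and "\<And>x y. x \<in> {0..1} \<Longrightarrow> y \<in> {0..1} \<Longrightarrow> f (x, y) = g (\<phi> x, \<phi> y)"
  shows "cut_distance f g = 0"
proof (rule antisym)
  have nn: "cut_norm (\<lambda>z. f z - pullback \<psi> g z) \<ge> 0" if "\<psi> \<in> measure_preserving_maps" for \<psi>
  proof (rule cut_norm_nonneg[of _ 1])
    fix z :: "real \<times> real" assume z: "z \<in> {0..1} \<times> {0..1}"
    have "\<psi> x \<in> {0..1}" if "x \<in> {0..1}" for x
      using \<open>\<psi> \<in> _\<close> that measurable_space[of \<psi> unit_interval unit_interval x] by (simp add: measure_preserving_maps_def)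
    then have "pullback \<psi> g z \<in> {0..1}" "f z \<in> {0..1}" using z assms by (auto simp: pullback_def graphons_def)
    then show "\<bar>f z - pullback \<psi> g z\<bar> \<le> 1" by auto
  qed simp
  have "cut_norm (\<lambda>z. f z - pullback \<phi> g z) = 0"
  proof -
    have "(LINT z:S \<times> T|unit_square. f z - pullback \<phi> g z) = 0" for S T
    proof -
      have "(LINT z:S \<times> T|unit_square. f z - pullback \<phi> g z) = (LINT z|unit_square. 0)"
        unfolding set_lebesgue_integral_def using assms(4)
        by (intro Bochner_Integration.integral_cong refl) (auto simp: pullback_def)
      then show ?thesis by simp
    qed
    moreover have "sets unit_interval \<times> sets unit_interval \<noteq> {}" by auto
    ultimately show ?thesis unfolding cut_norm_def case_prod_unfold by (simp only: abs_zero) (rule cSUP_const)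
  qed
  then show "cut_distance f g \<le> 0" unfolding cut_distance_def
    using nn assms(3) by (intro cINF_lower2[where x = \<phi>] bdd_belowI2[of _ 0]) auto
  show "0 \<le> cut_distance f g" unfolding cut_distance_def
    using nn assms(3) by (intro cINF_greatest) auto
qed

lemma class_function_permute_blocks:
  assumes "class_function F" "A \<in> cube" "\<pi> permutes {..<n}" "n > 0"
  shows "F (step_kernel n (\<lambda>e. A (\<pi> ` e))) = F (step_kernel n A)"
proof -
  obtain \<phi> where \<phi>: "\<phi> \<in> measure_preserving_maps" "\<And>x. x \<in> {0..1} \<Longrightarrow> \<phi> x \<in> {0..1} \<and> block n (\<phi> x) = \<pi> (block n x)"
    using ex_measure_preserving_block_permutation[OF assms(3,4)] by blast
  have g: "step_kernel n (\<lambda>e. A (\<pi> ` e)) \<in> graphons" "step_kernel n A \<in> graphons"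
    using assms(2) by (auto intro!: step_kernel_graphon simp: cube_def)
  have "cut_distance (step_kernel n (\<lambda>e. A (\<pi> ` e))) (step_kernel n A) = 0"
    by (rule cut_distance_pullback[OF g \<phi>(1)]) (simp add: step_kernel_def \<phi>(2))
  then show ?thesis using assms(1) g unfolding class_function_def by blast
qed

section \<open>Density of step kernels\<close>

lemma graphon_AE_limit_continuous:
  assumes f: "f \<in> graphons"
  obtains g :: "nat \<Rightarrow> real \<times> real \<Rightarrow> real" where "\<And>k. continuous_on UNIV (g k)"
    "\<And>k z. g k z \<in> {0..1}" "AE z in unit_square. (\<lambda>k. g k z) \<longlonglongrightarrow> f z"
proof -
  interpret P: pair_sigma_finite unit_interval unit_interval by unfold_locales
  define c where "c x = max 0 (min 1 x)" for x :: real
  define f0 where "f0 = (\<lambda>z. f (c (fst z), c (snd z)))"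
  have fm: "f \<in> borel_measurable unit_square" using f by (simp add: graphons_def kernels_def)
  have "c \<in> measurable borel (restrict_space borel {0..1})"
    unfolding c_def by (intro measurable_restrict_space2) auto
  then have cm [measurable]: "c \<in> measurable borel unit_interval"
    by (simp add: measurable_cong_sets[OF refl sets_unit_interval])
  have "(\<lambda>z. (c (fst z), c (snd z))) \<in> measurable (borel \<Otimes>\<^sub>M borel) unit_square"
    unfolding unit_square_def by measurable
  then have "(\<lambda>z. (c (fst z), c (snd z))) \<in> measurable borel unit_square"
    by (simp add: borel_prod)
  from measurable_compose[OF this fm] have f0m: "f0 \<in> borel_measurable borel" by (simp add: f0_def)
  then have "f0 \<in> borel_measurable lebesgue" by (intro measurable_completion) simp
  then have "f0 measurable_on UNIV"
    using measurable_on_iff_borel_measurable[of UNIV f0] by simp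
  then obtain N g where N: "negligible N" and g: "\<And>k. continuous_on UNIV (g k)"
    and lim: "\<And>x. x \<notin> N \<Longrightarrow> (\<lambda>k. g k x) \<longlonglongrightarrow> f0 x"
    unfolding measurable_on_def by auto
  define h where "h k z = c (g k z)" for k z
  have h_cont: "continuous_on UNIV (h k)" for k
    unfolding h_def c_def by (intro continuous_intros g)
  have f0_rng: "f0 z \<in> {0..1}" for z
    using f by (auto simp: f0_def graphons_def c_def)
  have limh: "(\<lambda>k. h k x) \<longlonglongrightarrow> f0 x" if "x \<notin> N" for x
  proof -
    have "(\<lambda>k. h k x) \<longlonglongrightarrow> c (f0 x)" unfolding h_def c_def by (intro tendsto_intros lim that)
    moreover have "c (f0 x) = f0 x" using f0_rng[of x] by (simp add: c_def)
    ultimately show ?thesis by simp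
  qed
  have hm [measurable]: "h k \<in> borel_measurable borel" for k
    using h_cont borel_measurable_continuous_onI by blast
  have "N \<in> null_sets (completion lborel)" using N by (simp add: negligible_iff_null_sets)
  then obtain N' where N': "N' \<in> null_sets lborel" "N \<subseteq> N'" by (auto simp: null_sets_completion_iff2)
  let ?Q = "\<lambda>z. z \<notin> N'"
  have Q: "{z. ?Q z} \<in> sets borel"
    using N'(1) by (auto simp: null_sets_def Compl_eq[symmetric])
  have "AE z in lborel. ?Q z" using N'(1) by (rule AE_not_in)
  then have "AE z in (lborel :: real measure) \<Otimes>\<^sub>M (lborel :: real measure). ?Q z" unfolding lborel_prod .
  from lborel_pair.AE_pair[OF this] have "AE x in lborel. AE y in lborel. ?Q (x, y)" by simp
  then have "AE x in unit_interval. AE y in unit_interval. ?Q (x, y)"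
    unfolding unit_interval_def by (subst AE_restrict_space_iff, simp)+ (auto elim!: eventually_mono)
  then have "AE z in unit_square. ?Q z"
    unfolding unit_square_def
  proof (intro P.AE_pair_measure)
    have "{z. ?Q z} \<in> sets (borel \<Otimes>\<^sub>M borel)" using Q by (simp only: borel_prod)
    moreover have "(\<lambda>z. z) \<in> measurable (unit_interval \<Otimes>\<^sub>M unit_interval) (borel \<Otimes>\<^sub>M borel)"
    proof -
      have [measurable]: "(\<lambda>x. x) \<in> borel_measurable unit_interval"
        unfolding unit_interval_def by (intro measurable_restrict_space1) auto
      have "(\<lambda>z. (fst z, snd z)) \<in> measurable (unit_interval \<Otimes>\<^sub>M unit_interval) (borel \<Otimes>\<^sub>M borel)"
        by (intro measurable_Pair measurable_compose[OF measurable_fst] measurable_compose[OF measurable_snd]) simp_all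
      then show ?thesis by simp
    qed
    ultimately have "(\<lambda>z. z) -` {z. ?Q z} \<inter> space (unit_interval \<Otimes>\<^sub>M unit_interval) \<in> sets (unit_interval \<Otimes>\<^sub>M unit_interval)"
      by (rule measurable_sets[rotated])
    then show "{z \<in> space (unit_interval \<Otimes>\<^sub>M unit_interval). ?Q z} \<in> sets (unit_interval \<Otimes>\<^sub>M unit_interval)"
      by (simp add: Int_def conj_commute)
  qed simp
  then have "AE z in unit_square. (\<lambda>k. h k z) \<longlonglongrightarrow> f z"
  proof (rule AE_mp, intro AE_I2 impI)
    fix z assume "z \<in> space unit_square" "?Q z"
    moreover from this have "f0 z = f z" by (auto simp: f0_def c_def)
    ultimately show "(\<lambda>k. h k z) \<longlonglongrightarrow> f z" using limh[of z] N'(2) by auto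
  qed
  moreover have "h k z \<in> {0..1}" for k z by (auto simp: h_def c_def)
  ultimately show ?thesis using that[of h] h_cont by blast
qed

lemma borel_measurable_unit_square:
  assumes "g \<in> borel_measurable borel"
  shows "g \<in> borel_measurable unit_square"
proof -
  have "(\<lambda>z. (fst z, snd z)) \<in> measurable unit_square (borel \<Otimes>\<^sub>M borel)"
    unfolding unit_square_def unit_interval_def
    by (intro measurable_Pair measurable_compose[OF measurable_fst] measurable_compose[OF measurable_snd]
          measurable_restrict_space1) simp_all
  then have "(\<lambda>z. (fst z, snd z)) \<in> measurable unit_square borel" by (simp only: borel_prod)
  from measurable_compose[OF this assms] show ?thesis by simp
qed

lemma graphon_L1_approx_continuous:
  assumes f: "f \<in> graphons" and e: "e > 0"
  obtains g :: "real \<times> real \<Rightarrow> real" where "continuous_on UNIV g" "\<And>z. g z \<in> {0..1}"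
    "L1_norm (\<lambda>z. g z - f z) < e"
proof -
  obtain g :: "nat \<Rightarrow> real \<times> real \<Rightarrow> real" where g: "\<And>k. continuous_on UNIV (g k)"
    "\<And>k z. g k z \<in> {0..1}" "AE z in unit_square. (\<lambda>k. g k z) \<longlonglongrightarrow> f z"
    using graphon_AE_limit_continuous[OF f] by blast
  have [measurable]: "f \<in> borel_measurable unit_square" using f by (simp add: graphons_def kernels_def)
  have gm [measurable]: "g k \<in> borel_measurable unit_square" for k
    using g(1)[of k] by (intro borel_measurable_unit_square borel_measurable_continuous_onI)
  have "(\<lambda>k. LINT z|unit_square. \<bar>g k z - f z\<bar>) \<longlonglongrightarrow> (LINT z|unit_square. 0)"
  proof (rule integral_dominated_convergence[where w = "\<lambda>_. 1"])
    show "AE z in unit_square. (\<lambda>k. \<bar>g k z - f z\<bar>) \<longlonglongrightarrow> 0"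
      using g(3) by eventually_elim (auto intro!: tendsto_rabs_zero LIM_zero)
    show "AE z in unit_square. norm \<bar>g k z - f z\<bar> \<le> 1" for k
    proof (rule AE_I2)
      fix z assume "z \<in> space unit_square"
      then have "f z \<in> {0..1}" using f by (auto simp: graphons_def)
      then show "norm \<bar>g k z - f z\<bar> \<le> 1" using g(2)[of k z] by auto
    qed
  qed auto
  then have "(\<lambda>k. L1_norm (\<lambda>z. g k z - f z)) \<longlonglongrightarrow> 0" by (simp add: L1_norm_def)
  then have "eventually (\<lambda>k. L1_norm (\<lambda>z. g k z - f z) < e) sequentially"
    using e by (rule order_tendstoD(2))
  then obtain k where "L1_norm (\<lambda>z. g k z - f z) < e" using eventually_happens' sequentially_bot by blast
  then show ?thesis using that[of "g k"] g by blast
qed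

lemma block_approx:
  assumes "n > 0" "x \<in> {0..1}"
  shows "\<bar>real (block n x) / n - x\<bar> \<le> 1 / n"
proof (cases "x = 1")
  case True
  then show ?thesis using assms by (simp add: block_def of_nat_diff diff_divide_distrib)
next
  case False
  then have "x \<in> {real (block n x) / n ..< (real (block n x) + 1) / n}"
    using block_eq_iff[OF block_less[OF assms(1)], of x x] assms by auto
  then show ?thesis by (auto simp: add_divide_distrib abs_le_iff)
qed

lemma L1_norm_swap:
  assumes "h \<in> borel_measurable unit_square"
  shows "L1_norm (\<lambda>z. h (snd z, fst z)) = L1_norm h"
proof -
  interpret P: pair_sigma_finite unit_interval unit_interval by unfold_locales
  have "L1_norm h = (LINT z|distr unit_square unit_square (\<lambda>(x, y). (y, x)). \<bar>h z\<bar>)"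
    using P.distr_pair_swap by (simp add: L1_norm_def unit_square_def)
  also have "\<dots> = (LINT z|unit_square. \<bar>h (snd z, fst z)\<bar>)"
    using assms by (subst integral_distr) (auto simp: case_prod_unfold unit_square_def)
  finally show ?thesis by (simp add: L1_norm_def)
qed

lemma graphon_L1_approx_step_kernel:
  assumes f: "f \<in> graphons" and e: "e > 0"
  obtains n A where "n > 0" "A \<in> cube" "L1_norm (\<lambda>z. step_kernel n A z - f z) < e"
proof -
  have e2: "e / 2 > 0" using e by simp
  obtain g :: "real \<times> real \<Rightarrow> real" where g: "continuous_on UNIV g" "\<And>z. g z \<in> {0..1}"
    "L1_norm (\<lambda>z. g z - f z) < e / 2"
    using graphon_L1_approx_continuous[OF f e2] by metis
  have fm [measurable]: "f \<in> borel_measurable unit_square" using f by (simp add: graphons_def kernels_def)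
  have gm [measurable]: "g \<in> borel_measurable unit_square"
    using g(1) by (intro borel_measurable_unit_square borel_measurable_continuous_onI)
  have "uniformly_continuous_on ({0..1} \<times> {0..1}) g"
    using g(1) by (intro compact_uniformly_continuous compact_Times) (auto intro: continuous_on_subset)
  then obtain d where d: "d > 0" "\<And>z w. z \<in> {0..1} \<times> {0..1} \<Longrightarrow> w \<in> {0..1} \<times> {0..1} \<Longrightarrow> dist w z < d \<Longrightarrow> dist (g w) (g z) < e / 2"
    unfolding uniformly_continuous_on_def using e2 by metis
  obtain n where n: "n > 0" "2 / real n < d"
  proof -
    obtain m where "2 / d < real m" using reals_Archimedean2 by blast
    then have "2 / real (Suc m) < d" using d by (simp add: field_simps)
    then show ?thesis using that[of "Suc m"] by simp
  qed
  define p where "p i = real i / real n" for i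
  define A where "A e = (g (p (Min e), p (Max e)) + g (p (Max e), p (Min e))) / 2" for e :: "nat set"
  have A: "A \<in> cube"
  proof -
    have "(g z + g w) / 2 \<in> {0..1}" for z w using g(2)[of z] g(2)[of w] by auto
    then show ?thesis unfolding cube_def A_def by blast
  qed
  have near: "\<bar>g (p (block n x), p (block n y)) - g (x, y)\<bar> \<le> e / 2" if xy: "x \<in> {0..1}" "y \<in> {0..1}" for x y
  proof -
    have p01: "p (block n t) \<in> {0..1}" for t using block_less[OF n(1), of t] by (simp add: p_def)
    have "dist (p (block n x), p (block n y)) (x, y) \<le> \<bar>p (block n x) - x\<bar> + \<bar>p (block n y) - y\<bar>"
      unfolding dist_Pair_Pair by (rule order_trans[OF sqrt_sum_squares_le_sum_abs]) (simp add: dist_real_def)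
    also have "\<dots> \<le> 1 / n + 1 / n" unfolding p_def using xy n by (intro add_mono block_approx)
    also have "\<dots> < d" using n by simp
    finally have "dist (g (p (block n x), p (block n y))) (g (x, y)) < e / 2"
      using xy p01 by (intro d(2)) auto
    then show ?thesis by (simp add: dist_real_def)
  qed
  have Ablk: "A {i, j} = (g (p i, p j) + g (p j, p i)) / 2" for i j
    by (auto simp: A_def min_def max_def)
  let ?D = "\<lambda>z. g z - f z"
  have bnd: "\<bar>step_kernel n A z - f z\<bar> \<le> e / 2 + (\<bar>?D z\<bar> + \<bar>?D (snd z, fst z)\<bar>) / 2" if zsp: "z \<in> space unit_square" for z
  proof -
    obtain x y where z: "z = (x, y)" "x \<in> {0..1}" "y \<in> {0..1}" using zsp by (cases z) auto
    have sym: "f (y, x) = f (x, y)" using f z by (auto simp: graphons_def kernels_def)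
    have mean: "\<bar>(a + b) / 2 - c\<bar> \<le> e / 2 + (\<bar>u - c\<bar> + \<bar>v - c\<bar>) / 2"
      if "\<bar>a - u\<bar> \<le> e / 2" "\<bar>b - v\<bar> \<le> e / 2" for a b c u v :: real
    proof -
      have "(a + b) / 2 - c = (a - u) / 2 + (b - v) / 2 + (u - c) / 2 + (v - c) / 2" by (simp add: field_simps)
      also have "\<bar>\<dots>\<bar> \<le> \<bar>(a - u) / 2\<bar> + \<bar>(b - v) / 2\<bar> + \<bar>(u - c) / 2\<bar> + \<bar>(v - c) / 2\<bar>"
        by linarith
      also have "\<dots> = (\<bar>a - u\<bar> + \<bar>b - v\<bar> + \<bar>u - c\<bar> + \<bar>v - c\<bar>) / 2" by (simp add: add_divide_distrib)
      finally show ?thesis using that by (simp add: add_divide_distrib)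
    qed
    show ?thesis using mean[OF near[OF z(2,3)] near[OF z(3,2)], of "f (x, y)"]
      by (simp add: z(1) step_kernel_def Ablk sym)
  qed
  have Dk: "integrable unit_square (\<lambda>z. \<bar>?D z\<bar>)"
  proof (intro unit_square.integrable_const_bound[of _ 1] AE_I2)
    fix z assume "z \<in> space unit_square"
    then have "f z \<in> {0..1}" using f by (auto simp: graphons_def)
    then show "norm \<bar>g z - f z\<bar> \<le> 1" using g(2)[of z] by auto
  qed measurable
  have sw [measurable]: "(\<lambda>z. (snd z, fst z)) \<in> measurable unit_square unit_square"
    unfolding unit_square_def by measurable
  have Dsw: "integrable unit_square (\<lambda>z. \<bar>?D (snd z, fst z)\<bar>)"
  proof (intro unit_square.integrable_const_bound[of _ 1] AE_I2)
    fix z assume "z \<in> space unit_square"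
    then have "f (snd z, fst z) \<in> {0..1}" using f by (auto simp: graphons_def)
    then show "norm \<bar>?D (snd z, fst z)\<bar> \<le> 1" using g(2)[of "(snd z, fst z)"] by auto
  qed measurable
  have "L1_norm (\<lambda>z. step_kernel n A z - f z) \<le> (LINT z|unit_square. e / 2 + (\<bar>?D z\<bar> + \<bar>?D (snd z, fst z)\<bar>) / 2)"
    unfolding L1_norm_def
  proof (rule integral_mono)
    show "integrable unit_square (\<lambda>z. \<bar>step_kernel n A z - f z\<bar>)"
    proof (intro unit_square.integrable_const_bound[of _ 1] AE_I2)
      fix z assume z: "z \<in> space unit_square"
      then have "f z \<in> {0..1}" "step_kernel n A z \<in> {0..1}"
        using f step_kernel_graphon[OF A, of n] by (auto simp: graphons_def)
      then show "norm \<bar>step_kernel n A z - f z\<bar> \<le> 1" by auto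
    qed measurable
    show "integrable unit_square (\<lambda>z. e / 2 + (\<bar>?D z\<bar> + \<bar>?D (snd z, fst z)\<bar>) / 2)"
      using Dk Dsw by simp
  qed (rule bnd)
  also have "\<dots> = e / 2 + (L1_norm ?D + L1_norm (\<lambda>z. ?D (snd z, fst z))) / 2"
    using Dk Dsw by (simp add: L1_norm_def unit_square.prob_space[simplified])
  also have "\<dots> = e / 2 + L1_norm ?D"
    using L1_norm_swap[of ?D] by simp
  also have "\<dots> < e" using g(3) by simp
  finally show ?thesis using that[OF n(1) A] by blast
qed

section \<open>Coefficients of step polynomials\<close>

definition slots :: "nat \<Rightarrow> nat set set" where
  "slots n = {e. e \<subseteq> {..<n} \<and> (card e = 1 \<or> card e = 2)}"

lemma finite_slots [simp]: "finite (slots n)"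
  by (rule finite_subset[of _ "Pow {..<n}"]) (auto simp: slots_def)

lemma pair_slots: "i < n \<Longrightarrow> j < n \<Longrightarrow> {i, j} \<in> slots n"
  by (cases "i = j") (auto simp: slots_def)

lemma image_slots:
  assumes "e \<in> slots n" "\<And>i. i \<in> e \<Longrightarrow> f i < n'"
  shows "f ` e \<in> slots n'"
proof -
  have e: "card e = 1 \<or> card e = 2" "f ` e \<subseteq> {..<n'}" using assms by (auto simp: slots_def)
  then have "finite e" "e \<noteq> {}" by (auto intro: card_ge_0_finite)
  then have "card (f ` e) \<noteq> 0" "card (f ` e) \<le> card e" by (auto simp: card_image_le)
  then show ?thesis using e by (auto simp: slots_def)
qed

definition vertex_set :: "nat set multiset \<Rightarrow> nat set" where
  "vertex_set M = \<Union> (set_mset M)"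

definition push :: "(nat \<Rightarrow> nat) \<Rightarrow> nat set multiset \<Rightarrow> nat set multiset" where
  "push f M = image_mset (\<lambda>e. f ` e) M"

lemma push_push: "push f (push g M) = push (f \<circ> g) M"
  by (simp add: push_def multiset.map_comp o_def image_image)

lemma push_cong: "(\<And>i. i \<in> vertex_set M \<Longrightarrow> f i = g i) \<Longrightarrow> push f M = push g M"
  unfolding push_def by (intro image_mset_cong image_cong refl) (auto simp: vertex_set_def)

lemma push_ident: "(\<And>i. i \<in> vertex_set M \<Longrightarrow> f i = i) \<Longrightarrow> push f M = M"
  using push_cong[of M f "\<lambda>i. i"] by (simp add: push_def)

lemma vertex_set_push: "vertex_set (push f M) = f ` vertex_set M"
  by (auto simp: vertex_set_def push_def)

lemma size_push [simp]: "size (push f M) = size M"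
  by (simp add: push_def)

lemma push_small:
  assumes "M \<in> small_multisets N (slots n)" "\<And>i. i \<in> vertex_set M \<Longrightarrow> f i < n'"
  shows "push f M \<in> small_multisets N (slots n')"
proof -
  have "f ` e \<in> slots n'" if "e \<in># M" for e
    using assms that by (intro image_slots[of _ n]) (auto simp: small_multisets_def vertex_set_def)
  then show ?thesis using assms(1) by (auto simp: small_multisets_def push_def)
qed

lemma vertex_set_small:
  assumes "M \<in> small_multisets N (slots n)"
  shows "vertex_set M \<subseteq> {..<n}" "finite (vertex_set M)"
proof -
  show "vertex_set M \<subseteq> {..<n}" using assms by (auto simp: small_multisets_def vertex_set_def slots_def)
  then show "finite (vertex_set M)" by (rule finite_subset) simp
qed

lemma finite_small [simp]: "finite (small_multisets N (slots n))"
  by (simp add: finite_small_multisets)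

definition kernel_coefficient :: "nat \<Rightarrow> nat \<Rightarrow> (kernel \<Rightarrow> real) \<Rightarrow> nat set multiset \<Rightarrow> real" where
  "kernel_coefficient N n F M = coefficient N (slots n) M (\<lambda>A. F (step_kernel n A))"

definition step_polynomial :: "nat \<Rightarrow> (kernel \<Rightarrow> real) \<Rightarrow> bool" where
  "step_polynomial N F \<longleftrightarrow> continuous_wrt L1_norm F
     \<and> (\<forall>n>0. \<forall>A\<in>cube. F (step_kernel n A) =
          (\<Sum>M\<in>small_multisets N (slots n). kernel_coefficient N n F M * (\<Prod>e\<in>#M. A e)))
     \<and> (\<forall>n>0. \<forall>A\<in>cube. \<forall>\<pi>. \<pi> permutes {..<n} \<longrightarrow>
          F (step_kernel n (\<lambda>e. A (\<pi> ` e))) = F (step_kernel n A))"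

lemma coefficient_collect:
  assumes "finite P" "finite S" "\<And>M. M \<in> S \<Longrightarrow> T M \<in> small_multisets N P" "K \<in> small_multisets N P"
    and "\<And>A. A \<in> cube \<Longrightarrow> \<Phi> A = (\<Sum>M\<in>S. b M * (\<Prod>e\<in>#T M. A e))"
  shows "coefficient N P K \<Phi> = (\<Sum>M | M \<in> S \<and> T M = K. b M)"
proof -
  have "coefficient N P K \<Phi> = coefficient N P K (\<lambda>A. \<Sum>M\<in>S. b M * (\<Prod>e\<in>#T M. A e))"
    by (rule coefficient_cong) (rule assms(5))
  also have "\<dots> = (\<Sum>M\<in>S. b M * of_bool (K = T M))"
    unfolding coefficient_sum using small_bounded[of N P] assms
    by (intro sum.cong refl arg_cong2[where f="(*)"] coefficient_monomial) auto
  also have "\<dots> = (\<Sum>M\<in>S. if T M = K then b M else 0)" by (intro sum.cong) auto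
  also have "\<dots> = (\<Sum>M | M \<in> S \<and> T M = K. b M)" using assms(2) by (simp add: sum.inter_filter)
  finally show ?thesis .
qed

lemma step_kernel_cong:
  assumes "n > 0" "\<And>e. e \<in> slots n \<Longrightarrow> A e = B e"
  shows "step_kernel n A = step_kernel n B"
  using assms pair_slots block_less by (auto simp: step_kernel_def)

lemma step_kernel_refine:
  assumes "n > 0" "m > 0"
  shows "step_kernel (n * m) (\<lambda>e. A ((\<lambda>i. i div m) ` e)) = step_kernel n A"
  using assms by (auto simp: step_kernel_def block_div)

lemma prod_mset_push: "(\<Prod>e\<in>#M. A (f ` e)) = (\<Prod>e\<in>#push f M. A e)"
  by (simp add: push_def multiset.map_comp o_def)

lemma kernel_coefficient_permute:
  assumes F: "step_polynomial N F" and n: "n > 0" and \<pi>: "\<pi> permutes {..<n}" and M: "M \<in> small_multisets N (slots n)"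
  shows "kernel_coefficient N n F (push \<pi> M) = kernel_coefficient N n F M"
proof -
  let ?S = "small_multisets N (slots n)"
  have lt: "\<pi> i < n" if "i < n" for i using permutes_in_image[OF \<pi>, of i] that by simp
  have psm: "push \<pi> M' \<in> ?S" if "M' \<in> ?S" for M'
    using vertex_set_small(1)[OF that] lt by (intro push_small[OF that]) auto
  have inj: "push \<pi> M1 = push \<pi> M2 \<longleftrightarrow> M1 = M2" for M1 M2
  proof -
    have "push (inv \<pi>) (push \<pi> M') = M'" for M'
      by (simp add: push_push permutes_inv_o[OF \<pi>] push_ident)
    then show ?thesis by metis
  qed
  have "kernel_coefficient N n F (push \<pi> M) = (\<Sum>M' | M' \<in> ?S \<and> push \<pi> M' = push \<pi> M. kernel_coefficient N n F M')"
    unfolding kernel_coefficient_def[of N n F "push \<pi> M"]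
  proof (rule coefficient_collect)
    fix A :: "nat set \<Rightarrow> real" assume A: "A \<in> cube"
    then have A\<pi>: "(\<lambda>e. A (\<pi> ` e)) \<in> cube" by (simp add: cube_def)
    have "F (step_kernel n A) = F (step_kernel n (\<lambda>e. A (\<pi> ` e)))"
      using F n \<pi> A by (simp add: step_polynomial_def)
    also have "\<dots> = (\<Sum>M'\<in>?S. kernel_coefficient N n F M' * (\<Prod>e\<in>#M'. A (\<pi> ` e)))"
      using F n A\<pi> unfolding step_polynomial_def by blast
    finally show "F (step_kernel n A) = (\<Sum>M'\<in>?S. kernel_coefficient N n F M' * (\<Prod>e\<in>#push \<pi> M'. A e))"
      by (simp only: prod_mset_push)
  qed (use psm M in auto)
  also have "\<dots> = kernel_coefficient N n F M"
    using M by (simp add: inj conj_commute cong: conj_cong)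
  finally show ?thesis .
qed

lemma kernel_coefficient_refine:
  assumes F: "step_polynomial N F" and "n > 0" "m > 0" and K: "K \<in> small_multisets N (slots n)"
  shows "kernel_coefficient N n F K =
    (\<Sum>M | M \<in> small_multisets N (slots (n * m)) \<and> push (\<lambda>i. i div m) M = K. kernel_coefficient N (n * m) F M)"
  unfolding kernel_coefficient_def[of N n F K]
proof (rule coefficient_collect)
  fix A :: "nat set \<Rightarrow> real" assume A: "A \<in> cube"
  then have Aq: "(\<lambda>e. A ((\<lambda>i. i div m) ` e)) \<in> cube" by (simp add: cube_def)
  have nm: "n * m > 0" using assms by simp
  have "F (step_kernel n A) = F (step_kernel (n * m) (\<lambda>e. A ((\<lambda>i. i div m) ` e)))"
    using step_kernel_refine[OF assms(2,3)] by simp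
  also have "\<dots> = (\<Sum>M'\<in>small_multisets N (slots (n * m)). kernel_coefficient N (n * m) F M' * (\<Prod>e\<in>#M'. A ((\<lambda>i. i div m) ` e)))"
    using F nm Aq unfolding step_polynomial_def by blast
  finally show "F (step_kernel n A) = (\<Sum>M'\<in>small_multisets N (slots (n * m)). kernel_coefficient N (n * m) F M' * (\<Prod>e\<in>#push (\<lambda>i. i div m) M'. A e))"
    by (simp only: prod_mset_push)
next
  fix M assume M: "M \<in> small_multisets N (slots (n * m))"
  then show "push (\<lambda>i. i div m) M \<in> small_multisets N (slots n)"
    using vertex_set_small(1)[OF M] by (intro push_small[OF M]) (auto simp: less_mult_imp_div_less)
qed (use K in auto)

definition vanishing_from :: "nat \<Rightarrow> (kernel \<Rightarrow> real) \<Rightarrow> nat \<Rightarrow> bool" where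
  "vanishing_from N F p \<longleftrightarrow> (\<forall>n>0. \<forall>M\<in>small_multisets N (slots n).
     card (vertex_set M) \<ge> p \<longrightarrow> kernel_coefficient N n F M = 0)"

lemma push_card_le:
  assumes "M \<in> small_multisets N (slots n)"
  shows "card (vertex_set (push f M)) \<le> card (vertex_set M)"
  using vertex_set_small(2)[OF assms] by (simp add: vertex_set_push card_image_le)

text \<open>Deleting the diagonal blocks of a fine step kernel changes it by at most \<open>1 / (n * m)\<close> in
  $L^1$, so no coefficient of top vertex number belonging to a graph with loops survives in the limit.\<close>

lemma kernel_coefficient_loop:
  assumes F: "step_polynomial N F" and van: "vanishing_from N F (Suc p)" and n: "n > 0"
    and K: "K \<in> small_multisets N (slots n)" "card (vertex_set K) = p" "e0 \<in># K" "card e0 = 1"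
  shows "kernel_coefficient N n F K = 0"
proof -
  define B where "B m A = (\<lambda>e. if card e = 1 then 0 else A ((\<lambda>i. i div m) ` e))" for m and A :: "nat set \<Rightarrow> real"
  have Bc: "B m A \<in> cube" if "A \<in> cube" for m A using that by (auto simp: B_def cube_def)
  have zero: "coefficient N (slots n) K (\<lambda>A. F (step_kernel (n * m) (B m A))) = 0" if m: "m > 0" for m
  proof -
    let ?S = "small_multisets N (slots (n * m))"
    have nm: "n * m > 0" using n m by simp
    have "coefficient N (slots n) K (\<lambda>A. F (step_kernel (n * m) (B m A))) =
      (\<Sum>M | M \<in> ?S \<and> push (\<lambda>i. i div m) M = K. if \<exists>e\<in>#M. card e = 1 then 0 else kernel_coefficient N (n * m) F M)"
    proof (rule coefficient_collect)
      fix A :: "nat set \<Rightarrow> real" assume A: "A \<in> cube"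
      have "F (step_kernel (n * m) (B m A)) = (\<Sum>M\<in>?S. kernel_coefficient N (n * m) F M * (\<Prod>e\<in>#M. B m A e))"
        using F nm Bc[OF A] unfolding step_polynomial_def by blast
      also have "\<dots> = (\<Sum>M\<in>?S. (if \<exists>e\<in>#M. card e = 1 then 0 else kernel_coefficient N (n * m) F M) * (\<Prod>e\<in>#push (\<lambda>i. i div m) M. A e))"
      proof (intro sum.cong refl)
        fix M
        show "kernel_coefficient N (n * m) F M * (\<Prod>e\<in>#M. B m A e) =
          (if \<exists>e\<in>#M. card e = 1 then 0 else kernel_coefficient N (n * m) F M) * (\<Prod>e\<in>#push (\<lambda>i. i div m) M. A e)"
        proof (cases "\<exists>e\<in>#M. card e = 1")
          case True
          then have "(0::real) \<in># image_mset (B m A) M" by (force simp: B_def)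
          then have "(\<Prod>e\<in>#M. B m A e) = 0" by (simp add: prod_mset_zero_iff)
          then show ?thesis using True by simp
        next
          case False
          then have "(\<Prod>e\<in>#M. B m A e) = (\<Prod>e\<in>#M. A ((\<lambda>i. i div m) ` e))"
            by (intro arg_cong[where f=prod_mset] image_mset_cong) (auto simp: B_def)
          then show ?thesis using False by (simp add: prod_mset_push)
        qed
      qed
      finally show "F (step_kernel (n * m) (B m A)) = (\<Sum>M\<in>?S. (if \<exists>e\<in>#M. card e = 1 then 0 else kernel_coefficient N (n * m) F M) * (\<Prod>e\<in>#push (\<lambda>i. i div m) M. A e))" .
    next
      fix M assume M: "M \<in> ?S"
      then show "push (\<lambda>i. i div m) M \<in> small_multisets N (slots n)"
        using vertex_set_small(1)[OF M] by (intro push_small[OF M]) (auto simp: less_mult_imp_div_less)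
    qed (use K in auto)
    also have "\<dots> = 0"
    proof (rule sum.neutral, clarify)
      fix M assume M: "M \<in> ?S" and K': "K = push (\<lambda>i. i div m) M"
      show "(if \<exists>e\<in>#M. card e = 1 then 0 else kernel_coefficient N (n * m) F M) = 0"
      proof (cases "\<exists>e\<in>#M. card e = 1")
        case False
        obtain e where e: "e \<in># M" "e0 = (\<lambda>i. i div m) ` e" using K(3) K' by (auto simp: push_def)
        have "e \<in> slots (n * m)" using M e(1) by (auto simp: small_multisets_def)
        then have "card e = 2" using False e(1) by (auto simp: slots_def)
        then have "\<not> inj_on (\<lambda>i. i div m) e" using e(2) K(4) card_image[of "\<lambda>i. i div m" e] by auto
        moreover have "e \<subseteq> vertex_set M" using e(1) by (auto simp: vertex_set_def)
        ultimately have "\<not> inj_on (\<lambda>i. i div m) (vertex_set M)" using inj_on_subset by blast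
        then have "card ((\<lambda>i. i div m) ` vertex_set M) \<noteq> card (vertex_set M)"
          using vertex_set_small(2)[OF M] by (auto dest: eq_card_imp_inj_on)
        moreover have "card ((\<lambda>i. i div m) ` vertex_set M) \<le> card (vertex_set M)"
          using vertex_set_small(2)[OF M] by (rule card_image_le)
        moreover have "card ((\<lambda>i. i div m) ` vertex_set M) = p"
          using K(2) unfolding K' by (simp add: vertex_set_push)
        ultimately have "Suc p \<le> card (vertex_set M)" by simp
        then have "kernel_coefficient N (n * m) F M = 0"
          using van nm M by (auto simp: vanishing_from_def)
        then show ?thesis by simp
      qed simp
    qed
    finally show ?thesis .
  qed
  have "(\<lambda>m. coefficient N (slots n) K (\<lambda>A. F (step_kernel (n * Suc m) (B (Suc m) A))))
     \<longlonglongrightarrow> coefficient N (slots n) K (\<lambda>A. F (step_kernel n A))"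
  proof (rule coefficient_tendsto)
    fix A :: "nat set \<Rightarrow> real" assume A: "A \<in> cube"
    show "(\<lambda>m. F (step_kernel (n * Suc m) (B (Suc m) A))) \<longlonglongrightarrow> F (step_kernel n A)"
    proof (rule tendstoI)
      fix \<epsilon> :: real assume \<epsilon>: "\<epsilon> > 0"
      obtain \<delta> where \<delta>: "\<delta> > 0" "\<And>g. g \<in> graphons \<Longrightarrow> L1_norm (\<lambda>z. g z - step_kernel n A z) < \<delta> \<Longrightarrow> \<bar>F g - F (step_kernel n A)\<bar> < \<epsilon>"
      proof -
        have "continuous_wrt L1_norm F" using F unfolding step_polynomial_def by (rule conjunct1)
        from this[unfolded continuous_wrt_def, rule_format, OF step_kernel_graphon[OF A, of n] \<epsilon>]
        show ?thesis using that by blast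
      qed
      have "\<forall>\<^sub>F m in sequentially. inverse (real (Suc m)) < \<delta>"
        using LIMSEQ_inverse_real_of_nat \<delta>(1) by (rule order_tendstoD(2))
      then show "\<forall>\<^sub>F m in sequentially. dist (F (step_kernel (n * Suc m) (B (Suc m) A))) (F (step_kernel n A)) < \<epsilon>"
      proof eventually_elim
        case (elim m)
        let ?m = "Suc m" let ?A = "\<lambda>e. A ((\<lambda>i. i div ?m) ` e)"
        have nm: "n * ?m > 0" using n by simp
        have diff: "\<bar>B ?m A {i, j} - ?A {i, j}\<bar> \<le> (if i = j then 1 else 0)" for i j
        proof -
          have "\<bar>A e\<bar> \<le> 1" for e
          proof -
            have "A e \<in> {0..1}" using A unfolding cube_def by blast
            then show ?thesis by simp
          qed
          then show ?thesis by (auto simp: B_def)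
        qed
        have "L1_norm (\<lambda>z. step_kernel (n * ?m) (B ?m A) z - step_kernel n A z) =
           (\<Sum>i<n * ?m. \<Sum>j<n * ?m. \<bar>B ?m A {i, j} - ?A {i, j}\<bar>) / (real (n * ?m))\<^sup>2"
          using L1_norm_step_kernel_diff[OF nm, of "B ?m A" ?A] step_kernel_refine[OF n, of ?m A] by simp
        also have "\<dots> \<le> (\<Sum>i<n * ?m. \<Sum>j<n * ?m. if i = j then 1 else 0) / (real (n * ?m))\<^sup>2"
          by (intro divide_right_mono sum_mono diff) simp
        also have "\<dots> = real (n * ?m) / (real (n * ?m))\<^sup>2" by (simp add: sum.delta)
        also have "\<dots> = 1 / (real n * real ?m)"
        proof -
          have "real k / (real k)\<^sup>2 = 1 / real k" if "k > 0" for k using that by (simp add: power2_eq_square)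
          from this[OF nm] show ?thesis by (simp only: of_nat_mult)
        qed
        also have "\<dots> \<le> 1 / real ?m"
        proof (rule divide_left_mono)
          have "1 * real ?m \<le> real n * real ?m" using n by (intro mult_right_mono) auto
          then show "real ?m \<le> real n * real ?m" by simp
        qed (use n in auto)
        also have "\<dots> < \<delta>" using elim by (simp add: inverse_eq_divide)
        finally show ?case using \<delta>(2)[OF step_kernel_graphon[OF Bc[OF A]]] by (simp add: dist_real_def)
      qed
    qed
  qed
  moreover have "(\<lambda>m. coefficient N (slots n) K (\<lambda>A. F (step_kernel (n * Suc m) (B (Suc m) A)))) = (\<lambda>m. 0)"
    by (rule ext, rule zero) simp
  ultimately have "(\<lambda>m. 0) \<longlonglongrightarrow> kernel_coefficient N n F K" by (simp add: kernel_coefficient_def)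
  then show ?thesis by (simp add: LIMSEQ_const_iff)
qed

lemma kernel_coefficient_isomorphic:
  assumes F: "step_polynomial N F" and n: "n > 0"
    and M: "M \<in> small_multisets N (slots n)" and M': "M' \<in> small_multisets N (slots n)"
    and f: "bij_betw f (vertex_set M) (vertex_set M')" "push f M = M'"
  shows "kernel_coefficient N n F M' = kernel_coefficient N n F M"
proof -
  let ?V = "vertex_set M" let ?V' = "vertex_set M'" let ?U = "{..<n}"
  note V = vertex_set_small[OF M] vertex_set_small[OF M']
  have "card ?V = card ?V'" using f(1) by (rule bij_betw_same_card)
  then have "card (?U - ?V) = card (?U - ?V')" using V by (simp add: card_Diff_subset)
  then obtain g where g: "bij_betw g (?U - ?V) (?U - ?V')"
    using finite_same_card_bij[of "?U - ?V" "?U - ?V'"] by auto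
  define \<pi> where "\<pi> i = (if i \<in> ?V then f i else if i < n then g i else i)" for i
  have "bij_betw \<pi> ?V ?V'" using f(1) by (rule bij_betw_cong[THEN iffD1, rotated]) (simp add: \<pi>_def)
  moreover have "bij_betw \<pi> (?U - ?V) (?U - ?V')" using g by (rule bij_betw_cong[THEN iffD1, rotated]) (simp add: \<pi>_def)
  ultimately have "bij_betw \<pi> (?V \<union> (?U - ?V)) (?V' \<union> (?U - ?V'))"
    by (rule bij_betw_combine) auto
  moreover have "?V \<union> (?U - ?V) = ?U" "?V' \<union> (?U - ?V') = ?U" using V by auto
  ultimately have "bij_betw \<pi> ?U ?U" by simp
  then have "\<pi> permutes ?U" by (rule bij_imp_permutes) (use V in \<open>auto simp: \<pi>_def\<close>)
  moreover have "push \<pi> M = M'" using f(2) push_cong[of M \<pi> f] by (simp add: \<pi>_def)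
  ultimately show ?thesis using kernel_coefficient_permute[OF F n _ M] by blast
qed

lemma kernel_coefficient_refine_zero_iff:
  assumes F: "step_polynomial N F" and van: "vanishing_from N F (Suc p)" and n: "n > 0" and m: "m > 0"
    and K: "K \<in> small_multisets N (slots n)" "card (vertex_set K) = p"
    and M0: "M0 \<in> small_multisets N (slots (n * m))" "card (vertex_set M0) = p" "push (\<lambda>i. i div m) M0 = K"
  shows "kernel_coefficient N n F K = 0 \<longleftrightarrow> kernel_coefficient N (n * m) F M0 = 0"
proof -
  let ?q = "\<lambda>i. i div m" let ?S = "small_multisets N (slots (n * m))"
  have nm: "n * m > 0" using n m by simp
  let ?L = "{M. M \<in> ?S \<and> push ?q M = K}" let ?L' = "{M \<in> ?L. card (vertex_set M) = p}"
  have bij: "bij_betw ?q (vertex_set M) (vertex_set K)" if "M \<in> ?L'" for M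
  proof -
    have "?q ` vertex_set M = vertex_set K" using that by (auto simp flip: vertex_set_push)
    moreover have "finite (vertex_set M)" using that vertex_set_small(2) by blast
    ultimately show ?thesis using that K(2) by (intro bij_betw_imageI eq_card_imp_inj_on) auto
  qed
  have same: "kernel_coefficient N (n * m) F M = kernel_coefficient N (n * m) F M0" if M: "M \<in> ?L'" for M
  proof -
    define r where "r = the_inv_into (vertex_set M0) ?q"
    have M0L: "M0 \<in> ?L'" using M0 by simp
    have r: "bij_betw r (vertex_set K) (vertex_set M0)"
      unfolding r_def by (rule bij_betw_the_inv_into[OF bij[OF M0L]])
    have "bij_betw (r \<circ> ?q) (vertex_set M) (vertex_set M0)" using bij[OF M] r by (rule bij_betw_trans)
    moreover have "push (r \<circ> ?q) M = M0"
    proof -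
      have "push (r \<circ> ?q) M = push r (push ?q M0)" using M M0 by (simp add: push_push[symmetric])
      also have "\<dots> = M0" unfolding push_push
        by (rule push_ident) (use bij[OF M0L] the_inv_into_f_f[of ?q "vertex_set M0"] in \<open>auto simp: r_def bij_betw_def\<close>)
      finally show ?thesis .
    qed
    moreover have "M \<in> ?S" using M by simp
    ultimately show ?thesis using kernel_coefficient_isomorphic[OF F nm _ M0(1)] by metis
  qed
  have "kernel_coefficient N n F K = (\<Sum>M\<in>?L. kernel_coefficient N (n * m) F M)"
    using kernel_coefficient_refine[OF F n m K(1)] .
  also have "\<dots> = (\<Sum>M\<in>?L'. kernel_coefficient N (n * m) F M)"
  proof (rule sum.mono_neutral_right)
    show "\<forall>M\<in>?L - ?L'. kernel_coefficient N (n * m) F M = 0"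
    proof
      fix M assume M: "M \<in> ?L - ?L'"
      then have "p \<le> card (vertex_set M)" using push_card_le[of M N "n * m" ?q] K(2) by auto
      then have "Suc p \<le> card (vertex_set M)" using M by (auto simp: le_less)
      then show "kernel_coefficient N (n * m) F M = 0" using van nm M by (auto simp: vanishing_from_def)
    qed
  qed (auto intro: finite_subset[OF _ finite_small[of N "n * m"]])
  also have "\<dots> = (\<Sum>M\<in>?L'. kernel_coefficient N (n * m) F M0)" by (intro sum.cong refl same)
  also have "\<dots> = real (card ?L') * kernel_coefficient N (n * m) F M0" by simp
  finally have eq: "kernel_coefficient N n F K = real (card ?L') * kernel_coefficient N (n * m) F M0" .
  have fin: "finite ?L'" by (rule finite_subset[OF _ finite_small[of N "n * m"]]) auto
  have ne: "?L' \<noteq> {}" using M0 by blast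
  have "real (card ?L') \<noteq> 0" unfolding of_nat_eq_0_iff card_0_eq[OF fin] by (rule ne)
  then show ?thesis unfolding eq mult_eq_0_iff by blast
qed

lemma kernel_coefficient_isomorphic_zero:
  assumes F: "step_polynomial N F" and van: "vanishing_from N F (Suc p)" and n: "n > 0" "n' > 0"
    and M: "M \<in> small_multisets N (slots n)" "card (vertex_set M) = p" and M': "M' \<in> small_multisets N (slots n')"
    and f: "bij_betw f (vertex_set M) (vertex_set M')" "push f M = M'"
    and zero: "kernel_coefficient N n F M = 0"
  shows "kernel_coefficient N n' F M' = 0"
proof -
  have p': "card (vertex_set M') = p" using bij_betw_same_card[OF f(1)] M(2) by simp
  have lift: "push (\<lambda>i. i * m) M \<in> small_multisets N (slots (n * m))"
    "card (vertex_set (push (\<lambda>i. i * m) M)) = p" "push (\<lambda>i. i div m) (push (\<lambda>i. i * m) M) = M"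
    "bij_betw (\<lambda>i. i * m) (vertex_set M) (vertex_set (push (\<lambda>i. i * m) M))"
    if "M \<in> small_multisets N (slots n)" "card (vertex_set M) = p" "m > 0" for n m M
  proof -
    have inj: "inj_on (\<lambda>i. i * m) (vertex_set M)" using that(3) by (auto simp: inj_on_def)
    show "push (\<lambda>i. i * m) M \<in> small_multisets N (slots (n * m))"
      using vertex_set_small(1)[OF that(1)] that(3) by (intro push_small[OF that(1)]) auto
    show "card (vertex_set (push (\<lambda>i. i * m) M)) = p"
      using inj that(2) by (simp add: vertex_set_push card_image)
    show "push (\<lambda>i. i div m) (push (\<lambda>i. i * m) M) = M"
      unfolding push_push by (rule push_ident) (use that(3) in simp)
    show "bij_betw (\<lambda>i. i * m) (vertex_set M) (vertex_set (push (\<lambda>i. i * m) M))"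
      using inj by (simp add: bij_betw_def vertex_set_push)
  qed
  let ?M1 = "push (\<lambda>i. i * n') M" let ?M2 = "push (\<lambda>i. i * n) M'"
  note l1 = lift[OF M n(2)] and l2 = lift[OF M' p' n(1)]
  have z1: "kernel_coefficient N (n * n') F ?M1 = 0"
    using kernel_coefficient_refine_zero_iff[OF F van n M l1(1-3)] zero by simp
  define g where "g = (\<lambda>i. i * n) \<circ> f \<circ> the_inv_into (vertex_set M) (\<lambda>i. i * n')"
  have "bij_betw g (vertex_set ?M1) (vertex_set ?M2)"
    unfolding g_def using bij_betw_the_inv_into[OF l1(4)] f(1) l2(4) by (intro bij_betw_trans) auto
  moreover have "push g ?M1 = ?M2"
  proof -
    have "push g ?M1 = push ((\<lambda>i. i * n) \<circ> f) M"
      unfolding push_push g_def using l1(4) the_inv_into_f_f[of "\<lambda>i. i * n'" "vertex_set M"]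
      by (intro push_cong) (auto simp: bij_betw_def)
    then show ?thesis using f(2) by (simp add: push_push[symmetric])
  qed
  moreover have "n * n' > 0" using n by simp
  ultimately have "kernel_coefficient N (n' * n) F ?M2 = 0"
    using kernel_coefficient_isomorphic[OF F, of "n * n'" ?M1 ?M2 g] l1(1) l2(1) z1 by (simp add: mult.commute)
  then show ?thesis
    using kernel_coefficient_refine_zero_iff[OF F van n(2,1) M' p' l2(1-3)] by simp
qed

section \<open>Homomorphism densities\<close>

lemma polynomial_collect:
  assumes "finite P" "finite S" "\<And>M. M \<in> S \<Longrightarrow> T M \<in> small_multisets N P"
    and \<Phi>: "\<And>A. A \<in> cube \<Longrightarrow> \<Phi> A = (\<Sum>M\<in>S. b M * (\<Prod>e\<in>#T M. A e))" and A: "A \<in> cube"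
  shows "\<Phi> A = (\<Sum>K\<in>small_multisets N P. coefficient N P K \<Phi> * (\<Prod>e\<in>#K. A e))"
proof -
  have "\<Phi> A = (\<Sum>K\<in>small_multisets N P. \<Sum>M | M \<in> S \<and> T M = K. b M * (\<Prod>e\<in>#T M. A e))"
    unfolding \<Phi>[OF A] using assms(1-3) by (intro sum.group[symmetric] finite_small_multisets) auto
  also have "\<dots> = (\<Sum>K\<in>small_multisets N P. coefficient N P K \<Phi> * (\<Prod>e\<in>#K. A e))"
  proof (intro sum.cong refl)
    fix K assume K: "K \<in> small_multisets N P"
    have "(\<Sum>M | M \<in> S \<and> T M = K. b M * (\<Prod>e\<in>#T M. A e)) = (\<Sum>M | M \<in> S \<and> T M = K. b M) * (\<Prod>e\<in>#K. A e)"
      by (simp add: sum_distrib_right)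
    also have "(\<Sum>M | M \<in> S \<and> T M = K. b M) = coefficient N P K \<Phi>"
      by (rule coefficient_collect[symmetric, OF assms(1-3) K \<Phi>])
    finally show "(\<Sum>M | M \<in> S \<and> T M = K. b M * (\<Prod>e\<in>#T M. A e)) = coefficient N P K \<Phi> * (\<Prod>e\<in>#K. A e)" .
  qed
  finally show ?thesis .
qed

lemma vertex_set_edges:
  assumes "G \<in> multigraphs k"
  shows "vertex_set (edges G) = verts G"
  using assms by (auto simp: multigraphs_def loopless_multigraph_def no_isolated_vertices_def vertex_set_def)

lemma push_edges_small:
  assumes G: "loopless_multigraph G" "size (edges G) \<le> N" and f: "\<And>i. i \<in> verts G \<Longrightarrow> f i < n"
  shows "push f (edges G) \<in> small_multisets N (slots n)"
proof -
  have "f ` e \<in> slots n" if "e \<in># edges G" for e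
  proof -
    have e: "card e = 2" "e \<subseteq> verts G" using G that by (auto simp: loopless_multigraph_def)
    then obtain a b where "e = {a, b}" "a \<noteq> b" by (auto simp: card_2_iff)
    then show ?thesis using e f pair_slots[of "f a" n "f b"] by auto
  qed
  then show ?thesis using G(2) by (auto simp: small_multisets_def push_def)
qed

lemma edges_small:
  assumes "loopless_multigraph G" "size (edges G) \<le> N" "verts G \<subseteq> {..<n}"
  shows "edges G \<in> small_multisets N (slots n)"
  using push_edges_small[OF assms(1,2), of "\<lambda>i. i" n] assms(3) by (auto simp: push_def)

context
  fixes G :: multigraph and N n :: nat
  assumes G: "loopless_multigraph G" "size (edges G) \<le> N" and n: "n > 0"
begin

lemma finite_colorings: "finite (PiE (verts G) (\<lambda>_. {..<n}))"
  using G by (intro finite_PiE) (auto simp: loopless_multigraph_def)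

lemma coloring_small:
  assumes "v \<in> PiE (verts G) (\<lambda>_. {..<n})"
  shows "push v (edges G) \<in> small_multisets N (slots n)"
  using assms by (intro push_edges_small[OF G]) auto

lemma hom_density_step_kernel_push:
  "hom_density G (step_kernel n A) =
    (\<Sum>v\<in>PiE (verts G) (\<lambda>_. {..<n}). 1 / real n ^ card (verts G) * (\<Prod>e\<in>#push v (edges G). A e))"
  unfolding hom_density_step_kernel[OF G(1) n] sum_divide_distrib
  by (simp add: push_def multiset.map_comp o_def)

lemma kernel_coefficient_hom_density_eq_0_iff:
  assumes "M \<in> small_multisets N (slots n)"
  shows "kernel_coefficient N n (hom_density G) M = 0 \<longleftrightarrow> (\<forall>v\<in>PiE (verts G) (\<lambda>_. {..<n}). push v (edges G) \<noteq> M)"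
proof -
  let ?S = "{v. v \<in> PiE (verts G) (\<lambda>_. {..<n}) \<and> push v (edges G) = M}"
  have "kernel_coefficient N n (hom_density G) M = (\<Sum>v\<in>?S. 1 / real n ^ card (verts G))"
    unfolding kernel_coefficient_def
    by (rule coefficient_collect[OF finite_slots finite_colorings coloring_small assms hom_density_step_kernel_push])
  also have "\<dots> = real (card ?S) / real n ^ card (verts G)" by simp
  finally have eq: "kernel_coefficient N n (hom_density G) M = real (card ?S) / real n ^ card (verts G)" .
  have fin: "finite ?S" using finite_colorings by simp
  have "kernel_coefficient N n (hom_density G) M = 0 \<longleftrightarrow> ?S = {}"
    unfolding eq using n card_0_eq[OF fin] by simp
  then show ?thesis by blast
qed

end

lemma step_polynomial_hom_density:
  assumes G: "loopless_multigraph G" "size (edges G) \<le> N"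
  shows "step_polynomial N (hom_density G)"
  unfolding step_polynomial_def
proof (intro conjI allI impI ballI)
  show "continuous_wrt L1_norm (hom_density G)"
    unfolding continuous_wrt_def
  proof (intro ballI allI impI)
    fix f and \<epsilon> :: real assume f: "f \<in> graphons" and \<epsilon>: "\<epsilon> > 0"
    let ?s = "real (size (edges G)) + 1"
    show "\<exists>\<delta>>0. \<forall>g\<in>graphons. L1_norm (\<lambda>z. g z - f z) < \<delta> \<longrightarrow> \<bar>hom_density G g - hom_density G f\<bar> < \<epsilon>"
    proof (intro exI[of _ "\<epsilon> / ?s"] conjI ballI impI)
      fix g assume g: "g \<in> graphons" "L1_norm (\<lambda>z. g z - f z) < \<epsilon> / ?s"
      have "L1_norm (\<lambda>z. g z - f z) \<ge> 0" by (simp add: L1_norm_def)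
      then have "real (size (edges G)) * L1_norm (\<lambda>z. g z - f z) \<le> ?s * L1_norm (\<lambda>z. g z - f z)"
        by (intro mult_right_mono) auto
      also have "\<dots> < \<epsilon>" using g(2) by (simp add: field_simps)
      finally show "\<bar>hom_density G g - hom_density G f\<bar> < \<epsilon>"
        using hom_density_L1_Lipschitz[OF G(1) f g(1)] by simp
    qed (use \<epsilon> in simp)
  qed
next
  fix n :: nat and A :: "nat set \<Rightarrow> real" assume n: "n > 0" and A: "A \<in> cube"
  show "hom_density G (step_kernel n A) =
     (\<Sum>M\<in>small_multisets N (slots n). kernel_coefficient N n (hom_density G) M * (\<Prod>e\<in>#M. A e))"
    unfolding kernel_coefficient_def
    by (rule polynomial_collect[OF finite_slots finite_colorings[OF G n] coloring_small[OF G n] hom_density_step_kernel_push[OF G n] A])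
next
  fix n :: nat and A :: "nat set \<Rightarrow> real" and \<pi> assume n: "n > 0" and A: "A \<in> cube" and \<pi>: "\<pi> permutes {..<n}"
  let ?P = "PiE (verts G) (\<lambda>_. {..<n})"
  have lt: "\<rho> i < n" if "\<rho> permutes {..<n}" "i < n" for \<rho> i using permutes_in_image[OF that(1), of i] that(2) by simp
  have sub: "e \<subseteq> verts G" if "e \<in># edges G" for e using G that by (auto simp: loopless_multigraph_def)
  have "(\<Sum>v\<in>?P. \<Prod>e\<in>#edges G. A (\<pi> ` v ` e)) = (\<Sum>v\<in>?P. \<Prod>e\<in>#edges G. A (v ` e))"
  proof (rule sum.reindex_bij_witness[where i = "\<lambda>v. restrict (inv \<pi> \<circ> v) (verts G)" and j = "\<lambda>v. restrict (\<pi> \<circ> v) (verts G)"])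
    fix v assume v: "v \<in> ?P"
    show "restrict (inv \<pi> \<circ> restrict (\<pi> \<circ> v) (verts G)) (verts G) = v"
      using v permutes_inverses(2)[OF \<pi>] by (auto simp: fun_eq_iff restrict_def PiE_def extensional_def)
    show "restrict (\<pi> \<circ> restrict (inv \<pi> \<circ> v) (verts G)) (verts G) = v"
      using v permutes_inverses(1)[OF \<pi>] by (auto simp: fun_eq_iff restrict_def PiE_def extensional_def)
    show "restrict (\<pi> \<circ> v) (verts G) \<in> ?P" using v lt[OF \<pi>] by (auto simp: PiE_def Pi_def)
    show "restrict (inv \<pi> \<circ> v) (verts G) \<in> ?P" using v lt[OF permutes_inv[OF \<pi>]] by (auto simp: PiE_def Pi_def)
    show "(\<Prod>e\<in>#edges G. A (restrict (\<pi> \<circ> v) (verts G) ` e)) = (\<Prod>e\<in>#edges G. A (\<pi> ` v ` e))"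
    proof (intro arg_cong[where f=prod_mset] image_mset_cong arg_cong[where f=A])
      fix e assume "e \<in># edges G"
      then have "restrict (\<pi> \<circ> v) (verts G) ` e = (\<pi> \<circ> v) ` e" using sub by (intro image_cong) auto
      then show "restrict (\<pi> \<circ> v) (verts G) ` e = \<pi> ` v ` e" by (simp add: image_comp)
    qed
  qed
  then show "hom_density G (step_kernel n (\<lambda>e. A (\<pi> ` e))) = hom_density G (step_kernel n A)"
    using hom_density_step_kernel[OF G(1) n] by simp
qed

lemma continuous_wrt_L1_diff_mult:
  assumes F: "continuous_wrt L1_norm F" and G: "continuous_wrt L1_norm G"
  shows "continuous_wrt L1_norm (\<lambda>f. F f - c * G f)"
  unfolding continuous_wrt_def
proof (intro ballI allI impI)
  fix f and \<epsilon> :: real assume f: "f \<in> graphons" and \<epsilon>: "\<epsilon> > 0"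
  have e2: "\<epsilon> / 2 > 0" using \<epsilon> by simp
  have e3: "\<epsilon> / (2 * (\<bar>c\<bar> + 1)) > 0" using \<epsilon> by (intro divide_pos_pos mult_pos_pos) auto
  obtain \<delta>1 where d1: "\<delta>1 > 0" "\<And>g. g \<in> graphons \<Longrightarrow> L1_norm (\<lambda>z. g z - f z) < \<delta>1 \<Longrightarrow> \<bar>F g - F f\<bar> < \<epsilon> / 2"
    using F[unfolded continuous_wrt_def, rule_format, OF f e2] by blast
  obtain \<delta>2 where d2: "\<delta>2 > 0" "\<And>g. g \<in> graphons \<Longrightarrow> L1_norm (\<lambda>z. g z - f z) < \<delta>2 \<Longrightarrow> \<bar>G g - G f\<bar> < \<epsilon> / (2 * (\<bar>c\<bar> + 1))"
    using G[unfolded continuous_wrt_def, rule_format, OF f e3] by blast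
  show "\<exists>\<delta>>0. \<forall>g\<in>graphons. L1_norm (\<lambda>z. g z - f z) < \<delta> \<longrightarrow> \<bar>(F g - c * G g) - (F f - c * G f)\<bar> < \<epsilon>"
  proof (intro exI[of _ "min \<delta>1 \<delta>2"] conjI ballI impI)
    fix g assume g: "g \<in> graphons" "L1_norm (\<lambda>z. g z - f z) < min \<delta>1 \<delta>2"
    have "\<bar>c\<bar> * \<bar>G g - G f\<bar> \<le> (\<bar>c\<bar> + 1) * (\<epsilon> / (2 * (\<bar>c\<bar> + 1)))"
      using d2(2)[OF g(1)] g(2) by (intro mult_mono) auto
    also have "\<dots> = \<epsilon> / 2" by (simp add: field_simps)
    finally have "\<bar>c * (G g - G f)\<bar> \<le> \<epsilon> / 2" by (simp add: abs_mult)
    moreover have "\<bar>F g - F f\<bar> < \<epsilon> / 2" using d1(2)[OF g(1)] g(2) by simp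
    moreover have "(F g - c * G g) - (F f - c * G f) = (F g - F f) - c * (G g - G f)" by (simp add: algebra_simps)
    ultimately show "\<bar>(F g - c * G g) - (F f - c * G f)\<bar> < \<epsilon>" by linarith
  qed (use d1 d2 in simp)
qed

lemma kernel_coefficient_diff_mult:
  "kernel_coefficient N n (\<lambda>f. F f - c * G f) M = kernel_coefficient N n F M - c * kernel_coefficient N n G M"
  unfolding kernel_coefficient_def coefficient_diff
  using coefficient_sum[of N "slots n" M "\<lambda>_. c" "\<lambda>_ A. G (step_kernel n A)" "{0::nat}"] by simp

lemma step_polynomial_diff_mult:
  assumes F: "step_polynomial N F" and G: "step_polynomial N G"
  shows "step_polynomial N (\<lambda>f. F f - c * G f)"
  unfolding step_polynomial_def
proof (intro conjI allI impI ballI)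
  show "continuous_wrt L1_norm (\<lambda>f. F f - c * G f)"
    using F G by (intro continuous_wrt_L1_diff_mult) (auto simp: step_polynomial_def)
next
  fix n :: nat and A :: "nat set \<Rightarrow> real" assume n: "n > 0" and A: "A \<in> cube"
  have 1: "F (step_kernel n A) = (\<Sum>M\<in>small_multisets N (slots n). kernel_coefficient N n F M * (\<Prod>e\<in>#M. A e))"
    using F n A unfolding step_polynomial_def by blast
  have 2: "G (step_kernel n A) = (\<Sum>M\<in>small_multisets N (slots n). kernel_coefficient N n G M * (\<Prod>e\<in>#M. A e))"
    using G n A unfolding step_polynomial_def by blast
  show "F (step_kernel n A) - c * G (step_kernel n A) =
     (\<Sum>M\<in>small_multisets N (slots n). kernel_coefficient N n (\<lambda>f. F f - c * G f) M * (\<Prod>e\<in>#M. A e))"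
    unfolding 1 2 kernel_coefficient_diff_mult sum_distrib_left sum_subtractf[symmetric]
    by (simp add: algebra_simps)
next
  fix n :: nat and A :: "nat set \<Rightarrow> real" and \<pi> assume n: "n > 0" and A: "A \<in> cube" and \<pi>: "\<pi> permutes {..<n}"
  have "F (step_kernel n (\<lambda>e. A (\<pi> ` e))) = F (step_kernel n A)"
    using F n A \<pi> unfolding step_polynomial_def by blast
  moreover have "G (step_kernel n (\<lambda>e. A (\<pi> ` e))) = G (step_kernel n A)"
    using G n A \<pi> unfolding step_polynomial_def by blast
  ultimately show "F (step_kernel n (\<lambda>e. A (\<pi> ` e))) - c * G (step_kernel n (\<lambda>e. A (\<pi> ` e))) = F (step_kernel n A) - c * G (step_kernel n A)"
    by simp
qed

lemma kernel_coefficient_diff_sum: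
  assumes "finite I"
  shows "kernel_coefficient N n (\<lambda>f. F f - (\<Sum>i\<in>I. c i * G i f)) M =
    kernel_coefficient N n F M - (\<Sum>i\<in>I. c i * kernel_coefficient N n (G i) M)"
  unfolding kernel_coefficient_def coefficient_diff coefficient_sum ..

lemma step_polynomial_diff_sum:
  assumes "finite I" "step_polynomial N F" "\<And>i. i \<in> I \<Longrightarrow> step_polynomial N (G i)"
  shows "step_polynomial N (\<lambda>f. F f - (\<Sum>i\<in>I. c i * G i f))"
  using assms(1,3)
proof (induction I rule: finite_induct)
  case (insert i I)
  then have "step_polynomial N (\<lambda>f. (F f - (\<Sum>i\<in>I. c i * G i f)) - c i * G i f)"
    by (intro step_polynomial_diff_mult) auto
  moreover have "(\<lambda>f. (F f - (\<Sum>i\<in>I. c i * G i f)) - c i * G i f) = (\<lambda>f. F f - (\<Sum>i\<in>insert i I. c i * G i f))"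
    using insert(1,2) by (auto simp: algebra_simps)
  ultimately show ?case by simp
qed (use assms(2) in simp)

lemma representative_in:
  assumes "H \<in> multigraph_classes_upto N"
  obtains k where "k \<le> N" "H \<in> multigraph_classes k" "representative H \<in> H" "representative H \<in> multigraphs k"
proof -
  obtain k where k: "k \<le> N" "H \<in> multigraph_classes k" using assms by (auto simp: multigraph_classes_upto_def)
  note eq = equiv_multigraph_iso[of k]
  have "H \<noteq> {}" using k(2) in_quotient_imp_non_empty[OF eq] by (simp add: multigraph_classes_def)
  then have r: "representative H \<in> H" unfolding representative_def by (simp add: some_in_eq)
  moreover have "H \<subseteq> multigraphs k" using k(2) in_quotient_imp_subset[OF eq] by (simp add: multigraph_classes_def)
  ultimately show ?thesis using that k by blast
qed

lemma representative_loopless: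
  assumes "H \<in> multigraph_classes_upto N"
  shows "loopless_multigraph (representative H)" "size (edges (representative H)) \<le> N"
    "vertex_set (edges (representative H)) = verts (representative H)" "finite (verts (representative H))"
proof -
  obtain k where k: "k \<le> N" "representative H \<in> multigraphs k" using representative_in[OF assms] by metis
  then show "loopless_multigraph (representative H)" "size (edges (representative H)) \<le> N"
    "vertex_set (edges (representative H)) = verts (representative H)"
    using vertex_set_edges by (auto simp: multigraphs_def)
  then show "finite (verts (representative H))" by (simp add: loopless_multigraph_def)
qed

lemma representative_iso_eq:
  assumes "H \<in> multigraph_classes_upto N" "H' \<in> multigraph_classes_upto N"
    and "(representative H, representative H') \<in> multigraph_iso"
  shows "H = H'"
proof -
  obtain k where k: "H \<in> multigraph_classes k" "representative H \<in> H" "representative H \<in> multigraphs k"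
    using representative_in[OF assms(1)] by metis
  obtain k' where k': "H' \<in> multigraph_classes k'" "representative H' \<in> H'" "representative H' \<in> multigraphs k'"
    using representative_in[OF assms(2)] by metis
  have "size (edges (representative H)) = size (edges (representative H'))"
    using assms(3) by (auto simp: multigraph_iso_def) (metis size_image_mset)
  then have "k = k'" using k(3) k'(3) by (simp add: multigraphs_def)
  then show ?thesis
    using quotient_eq_iff[OF equiv_multigraph_iso[of k], of H H' "representative H" "representative H'"] k k' assms(3)
    by (auto simp: multigraph_classes_def)
qed

lemma ex_representative_iso:
  assumes "G \<in> multigraphs k" "k \<le> N"
  obtains H where "H \<in> multigraph_classes_upto N" "(representative H, G) \<in> multigraph_iso"
proof -
  let ?R = "multigraph_iso \<inter> multigraphs k \<times> multigraphs k"
  have H: "?R `` {G} \<in> multigraph_classes k" using assms(1) by (auto simp: multigraph_classes_def intro: quotientI)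
  then have "?R `` {G} \<in> multigraph_classes_upto N" using assms(2) by (auto simp: multigraph_classes_upto_def)
  moreover from this have "representative (?R `` {G}) \<in> ?R `` {G}" using representative_in by metis
  then have "(representative (?R `` {G}), G) \<in> ?R"
    using equiv_multigraph_iso[of k] by (auto elim: equivE dest: symD)
  ultimately show ?thesis using that by blast
qed

definition class_size :: "multigraph set \<Rightarrow> nat" where
  "class_size H = Suc (Max (insert 0 (verts (representative H))))"

lemma representative_small:
  assumes "H \<in> multigraph_classes_upto N"
  shows "verts (representative H) \<subseteq> {..<class_size H}"
    "edges (representative H) \<in> small_multisets N (slots (class_size H))"
proof -
  note r = representative_loopless[OF assms]
  show *: "verts (representative H) \<subseteq> {..<class_size H}"
    using r(4) by (auto simp: class_size_def less_Suc_eq_le)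
  show "edges (representative H) \<in> small_multisets N (slots (class_size H))"
    using edges_small[OF r(1,2) *] .
qed

lemma kernel_coefficient_class_density_self:
  assumes H: "H \<in> multigraph_classes_upto N"
  shows "kernel_coefficient N (class_size H) (class_density H) (edges (representative H)) \<noteq> 0"
proof -
  note r = representative_loopless[OF H]
  let ?G = "representative H" let ?v = "restrict (\<lambda>i. i) (verts ?G)"
  have "?v \<in> PiE (verts ?G) (\<lambda>_. {..<class_size H})" using representative_small(1)[OF H] by auto
  moreover have "push ?v (edges ?G) = edges ?G" by (rule push_ident) (simp add: r(3))
  moreover have "class_size H > 0" by (simp add: class_size_def)
  moreover have "class_density H = hom_density ?G" by (simp add: class_density_def fun_eq_iff)
  ultimately show ?thesis
    using kernel_coefficient_hom_density_eq_0_iff[OF r(1,2) _ representative_small(2)[OF H]] by auto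
qed

lemma push_edges_iso:
  assumes r: "vertex_set (edges G) = verts G" "vertex_set (edges G') = verts G'" "finite (verts G)"
    and v: "push v (edges G) = edges G'" "card (verts G) \<le> card (verts G')"
  shows "(G, G') \<in> multigraph_iso"
proof -
  have img: "v ` verts G = verts G'" using v(1) vertex_set_push[of v "edges G"] r by simp
  then have "card (v ` verts G) = card (verts G)" using v(2) card_image_le[OF r(3), of v] by simp
  then have "bij_betw v (verts G) (verts G')" using img r(3) by (intro bij_betw_imageI eq_card_imp_inj_on) auto
  then show ?thesis using v(1) by (auto simp: multigraph_iso_def push_def)
qed

lemma step_polynomial_class_density:
  assumes "H \<in> multigraph_classes_upto N"
  shows "step_polynomial N (class_density H)"
proof -
  have "class_density H = hom_density (representative H)" by (simp add: class_density_def fun_eq_iff)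
  then show ?thesis using step_polynomial_hom_density representative_loopless[OF assms] by simp
qed

lemma kernel_coefficient_class_density_nonzero:
  assumes H: "H \<in> multigraph_classes_upto N" and n: "n > 0" and M: "M \<in> small_multisets N (slots n)"
    and nz: "kernel_coefficient N n (class_density H) M \<noteq> 0"
  obtains v where "push v (edges (representative H)) = M" "card (vertex_set M) \<le> card (verts (representative H))"
proof -
  note r = representative_loopless[OF H]
  have "class_density H = hom_density (representative H)" by (simp add: class_density_def fun_eq_iff)
  then obtain v where v: "push v (edges (representative H)) = M"
    using nz kernel_coefficient_hom_density_eq_0_iff[OF r(1,2) n M] by auto
  then have "vertex_set M = v ` verts (representative H)" using r(3) vertex_set_push by metis
  then have "card (vertex_set M) \<le> card (verts (representative H))" using r(4) by (simp add: card_image_le)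
  with v show ?thesis using that by blast
qed

lemma kernel_coefficient_class_density_other:
  assumes H: "H \<in> multigraph_classes_upto N" and H': "H' \<in> multigraph_classes_upto N"
    and nz: "kernel_coefficient N (class_size H) (class_density H') (edges (representative H)) \<noteq> 0"
    and le: "card (verts (representative H')) \<le> card (verts (representative H))"
  shows "H' = H"
proof -
  have "class_size H > 0" by (simp add: class_size_def)
  from kernel_coefficient_class_density_nonzero[OF H' this representative_small(2)[OF H] nz]
  obtain v where "push v (edges (representative H')) = edges (representative H)" by blast
  then have "(representative H', representative H) \<in> multigraph_iso"
    using representative_loopless[OF H] representative_loopless[OF H'] le by (intro push_edges_iso) auto
  then show ?thesis by (rule representative_iso_eq[OF H' H])
qed

lemma class_densities_independent:
  assumes "\<And>n A. n > 0 \<Longrightarrow> A \<in> cube \<Longrightarrow> (\<Sum>H\<in>multigraph_classes_upto N. d H * class_density H (step_kernel n A)) = 0"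
    and H: "H \<in> multigraph_classes_upto N"
  shows "d H = 0"
proof (rule ccontr)
  assume dH: "d H \<noteq> 0"
  let ?C = "{H \<in> multigraph_classes_upto N. d H \<noteq> 0}" let ?p = "\<lambda>H. card (verts (representative H))"
  have fin: "finite (?p ` ?C)" using finite_multigraph_classes_upto by simp
  have "?p ` ?C \<noteq> {}" using H dH by blast
  then have "Max (?p ` ?C) \<in> ?p ` ?C" using fin by (rule Max_in[rotated])
  then obtain K where K: "K \<in> ?C" "?p K = Max (?p ` ?C)" by auto
  have Kmax: "?p H \<le> ?p K" if "H \<in> ?C" for H unfolding K(2) using fin that by (intro Max_ge) auto
  let ?n = "class_size K" let ?M = "edges (representative K)"
  have n: "?n > 0" by (simp add: class_size_def)
  have "0 = coefficient N (slots ?n) ?M (\<lambda>A. \<Sum>H\<in>multigraph_classes_upto N. d H * class_density H (step_kernel ?n A))"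
    using coefficient_cong[of "\<lambda>A. \<Sum>H\<in>multigraph_classes_upto N. d H * class_density H (step_kernel ?n A)" "\<lambda>_. 0"] assms(1)[OF n]
    by (simp add: coefficient_zero)
  also have "\<dots> = (\<Sum>H\<in>multigraph_classes_upto N. d H * kernel_coefficient N ?n (class_density H) ?M)"
    unfolding coefficient_sum kernel_coefficient_def ..
  also have "\<dots> = (\<Sum>H\<in>{K}. d H * kernel_coefficient N ?n (class_density H) ?M)"
  proof (rule sum.mono_neutral_right)
    show "\<forall>H\<in>multigraph_classes_upto N - {K}. d H * kernel_coefficient N ?n (class_density H) ?M = 0"
    proof
      fix H assume H: "H \<in> multigraph_classes_upto N - {K}"
      show "d H * kernel_coefficient N ?n (class_density H) ?M = 0"
        using kernel_coefficient_class_density_other[of K N H] K Kmax[of H] H by auto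
    qed
  qed (use finite_multigraph_classes_upto K in auto)
  finally have "d K * kernel_coefficient N ?n (class_density K) ?M = 0" by simp
  then show False using K kernel_coefficient_class_density_self[of K N] by auto
qed

lemma step_polynomial_expansion:
  assumes "step_polynomial N F" "vanishing_from N F p"
  shows "\<exists>c. hom_density_expansion N c F"
  using assms
proof (induction p arbitrary: F)
  case (0 F)
  have steps: "F (step_kernel n A) = 0" if "n > 0" "A \<in> cube" for n A
  proof -
    have "F (step_kernel n A) = (\<Sum>M\<in>small_multisets N (slots n). kernel_coefficient N n F M * (\<Prod>e\<in>#M. A e))"
      using 0(1) that unfolding step_polynomial_def by blast
    also have "\<dots> = 0" using 0(2) that(1) by (intro sum.neutral) (auto simp: vanishing_from_def)
    finally show ?thesis .
  qed
  have "F f = 0" if f: "f \<in> graphons" for f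
  proof (rule ccontr)
    assume "F f \<noteq> 0"
    then have pos: "\<bar>F f\<bar> > 0" by simp
    have cont: "continuous_wrt L1_norm F" using 0(1) unfolding step_polynomial_def by blast
    obtain \<delta> where d: "\<delta> > 0" "\<And>g. g \<in> graphons \<Longrightarrow> L1_norm (\<lambda>z. g z - f z) < \<delta> \<Longrightarrow> \<bar>F g - F f\<bar> < \<bar>F f\<bar>"
      using cont[unfolded continuous_wrt_def, rule_format, OF f pos] by blast
    obtain n A where "n > 0" "A \<in> cube" "L1_norm (\<lambda>z. step_kernel n A z - f z) < \<delta>"
      using graphon_L1_approx_step_kernel[OF f d(1)] by metis
    then show False using d(2)[of "step_kernel n A"] step_kernel_graphon steps by fastforce
  qed
  then show ?case by (intro exI[of _ "\<lambda>_. 0"]) (simp add: hom_density_expansion_def)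
next
  case (Suc p F)
  let ?C = "{H \<in> multigraph_classes_upto N. card (verts (representative H)) = p}"
  let ?K = "\<lambda>H. edges (representative H)"
  define \<rho> where "\<rho> H = kernel_coefficient N (class_size H) F (?K H) / kernel_coefficient N (class_size H) (class_density H) (?K H)" for H
  define G where "G f = F f - (\<Sum>H\<in>?C. \<rho> H * class_density H f)" for f
  have fin: "finite ?C" using finite_multigraph_classes_upto by simp
  have G: "step_polynomial N G" unfolding G_def
    by (rule step_polynomial_diff_sum[OF fin Suc.prems(1)]) (simp add: step_polynomial_class_density)
  have kc: "kernel_coefficient N n G M = kernel_coefficient N n F M - (\<Sum>H\<in>?C. \<rho> H * kernel_coefficient N n (class_density H) M)" for n M
    unfolding G_def by (rule kernel_coefficient_diff_sum[OF fin])
  have vanS: "vanishing_from N G (Suc p)"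
    unfolding vanishing_from_def
  proof (intro allI impI ballI)
    fix n :: nat and M assume n: "n > 0" and M: "M \<in> small_multisets N (slots n)" and p: "Suc p \<le> card (vertex_set M)"
    have "kernel_coefficient N n F M = 0" using Suc.prems(2) n M p by (simp add: vanishing_from_def)
    moreover have "kernel_coefficient N n (class_density H) M = 0" if "H \<in> ?C" for H
    proof (rule ccontr)
      assume "kernel_coefficient N n (class_density H) M \<noteq> 0"
      then have "card (vertex_set M) \<le> card (verts (representative H))"
        using kernel_coefficient_class_density_nonzero[of H N n M] that n M by blast
      then show False using that p by simp
    qed
    ultimately show "kernel_coefficient N n G M = 0" by (simp add: kc)
  qed
  have rep0: "kernel_coefficient N (class_size K) G (?K K) = 0" if K: "K \<in> ?C" for K
  proof -
    have "(\<Sum>H\<in>?C. \<rho> H * kernel_coefficient N (class_size K) (class_density H) (?K K)) =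
      (\<Sum>H\<in>{K}. \<rho> H * kernel_coefficient N (class_size K) (class_density H) (?K K))"
    proof (rule sum.mono_neutral_right)
      show "\<forall>H\<in>?C - {K}. \<rho> H * kernel_coefficient N (class_size K) (class_density H) (?K K) = 0"
        using kernel_coefficient_class_density_other[of K N] K by fastforce
    qed (use fin K in auto)
    then show ?thesis using kernel_coefficient_class_density_self[of K N] K by (simp add: kc \<rho>_def)
  qed
  have "vanishing_from N G p"
    unfolding vanishing_from_def
  proof (intro allI impI ballI)
    fix n :: nat and M assume n: "n > 0" and M: "M \<in> small_multisets N (slots n)" and p: "p \<le> card (vertex_set M)"
    consider "Suc p \<le> card (vertex_set M)" | e where "card (vertex_set M) = p" "e \<in># M" "card e = 1"
      | "card (vertex_set M) = p" "\<And>e. e \<in># M \<Longrightarrow> card e \<noteq> 1"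
      using p by force
    then show "kernel_coefficient N n G M = 0"
    proof cases
      case 1
      then show ?thesis using vanS n M by (simp add: vanishing_from_def)
    next
      case 2
      then show ?thesis using kernel_coefficient_loop[OF G vanS n M] by blast
    next
      case 3
      let ?G = "\<lparr>verts = vertex_set M, edges = M\<rparr>"
      have "card e = 2" if "e \<in># M" for e using M 3(2)[OF that] that by (auto simp: small_multisets_def slots_def)
      moreover have "finite (vertex_set M)" using vertex_set_small(2)[OF M] .
      ultimately have "?G \<in> multigraphs (size M)"
        by (auto simp: multigraphs_def loopless_multigraph_def no_isolated_vertices_def vertex_set_def)
      moreover have "size M \<le> N" using M by (simp add: small_multisets_def)
      ultimately obtain H where H: "H \<in> multigraph_classes_upto N" "(representative H, ?G) \<in> multigraph_iso"
        using ex_representative_iso by metis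
      then obtain f where f: "bij_betw f (verts (representative H)) (vertex_set M)" "push f (?K H) = M"
        by (auto simp: multigraph_iso_def push_def)
      note r = representative_loopless[OF H(1)]
      have HC: "H \<in> ?C" using H(1) bij_betw_same_card[OF f(1)] 3(1) by simp
      have ns: "class_size H > 0" by (simp add: class_size_def)
      show ?thesis
      proof (rule kernel_coefficient_isomorphic_zero[OF G vanS ns n representative_small(2)[OF H(1)] _ M _ f(2) rep0[OF HC]])
        show "card (vertex_set (?K H)) = p" using HC r(3) by simp
        show "bij_betw f (vertex_set (?K H)) (vertex_set M)" using f(1) unfolding r(3) .
      qed
    qed
  qed
  from Suc.IH[OF G this] obtain c where c: "\<And>f. f \<in> graphons \<Longrightarrow> G f = (\<Sum>H\<in>multigraph_classes_upto N. c H * class_density H f)"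
    by (auto simp: hom_density_expansion_def)
  have "F f = (\<Sum>H\<in>multigraph_classes_upto N. (c H + (if H \<in> ?C then \<rho> H else 0)) * class_density H f)" if f: "f \<in> graphons" for f
  proof -
    have "(\<Sum>H\<in>?C. \<rho> H * class_density H f) = (\<Sum>H\<in>multigraph_classes_upto N. (if H \<in> ?C then \<rho> H else 0) * class_density H f)"
      using finite_multigraph_classes_upto by (intro sum.mono_neutral_cong_left) auto
    then have "F f = (\<Sum>H\<in>multigraph_classes_upto N. c H * class_density H f) + (\<Sum>H\<in>multigraph_classes_upto N. (if H \<in> ?C then \<rho> H else 0) * class_density H f)"
      using c[OF f] G_def[of f] by simp
    then show ?thesis unfolding distrib_right sum.distrib .
  qed
  then have "hom_density_expansion N (\<lambda>H. c H + (if H \<in> ?C then \<rho> H else 0)) F"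
    unfolding hom_density_expansion_def by (intro ballI)
  then show ?case by (rule exI[where P = "\<lambda>c. hom_density_expansion N c F"])
qed

lemma gateaux_zero_imp_step_polynomial:
  assumes cf: "class_function F" and cont: "continuous_wrt L1_norm F"
    and diff: "times_gateaux_differentiable (N + 1) F"
    and zero: "\<forall>f\<in>graphons. \<forall>g. (\<forall>i<N + 1. g i \<in> Adm f) \<longrightarrow> gateaux F g (N + 1) f = 0"
  shows "step_polynomial N F"
  unfolding step_polynomial_def
proof (intro conjI allI impI ballI)
  show "continuous_wrt L1_norm F" by (rule cont)
next
  fix n :: nat and A :: "nat set \<Rightarrow> real" assume n: "n > 0" and A: "A \<in> cube"
  show "F (step_kernel n A) = (\<Sum>M\<in>small_multisets N (slots n). kernel_coefficient N n F M * (\<Prod>e\<in>#M. A e))"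
    unfolding kernel_coefficient_def
  proof (rule polynomial_on_segments[OF finite_slots _ _ A])
    fix A B :: "nat set \<Rightarrow> real" assume A: "A \<in> cube" and B: "B \<in> cube"
    obtain q where q: "\<forall>i>N. coeff q i = 0" "\<forall>s\<in>{0..1}. F (\<lambda>z. step_kernel n A z + s * (step_kernel n B z - step_kernel n A z)) = poly q s"
      using graphon_segment_polynomial[OF cont diff zero step_kernel_graphon[OF A, of n] step_kernel_graphon[OF B, of n]] by blast
    have eq: "(\<lambda>z. step_kernel n A z + s * (step_kernel n B z - step_kernel n A z)) = step_kernel n (\<lambda>e. A e + s * (B e - A e))" for s
      by (auto simp: step_kernel_def)
    have "degree q \<le> N" using q(1) by (intro degree_le) auto
    then show "\<exists>q. degree q \<le> N \<and> (\<forall>s\<in>{0..1}. F (step_kernel n (\<lambda>e. A e + s * (B e - A e))) = poly q s)"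
      using q(2) unfolding eq by blast
  next
    fix A B :: "nat set \<Rightarrow> real" assume "\<And>p. p \<in> slots n \<Longrightarrow> A p = B p"
    then show "F (step_kernel n A) = F (step_kernel n B)" using step_kernel_cong[OF n] by metis
  qed
next
  fix n :: nat and A :: "nat set \<Rightarrow> real" and \<pi> assume "n > 0" "A \<in> cube" "\<pi> permutes {..<n}"
  then show "F (step_kernel n (\<lambda>e. A (\<pi> ` e))) = F (step_kernel n A)"
    by (intro class_function_permute_blocks[OF cf])
qed

lemma card_vertex_set_le:
  assumes "M \<in> small_multisets N (slots n)"
  shows "card (vertex_set M) \<le> 2 * N"
proof -
  have "card (vertex_set M) \<le> (\<Sum>e\<in>set_mset M. card e)"
    using card_UN_le[of "set_mset M" "\<lambda>e. e"] by (simp add: vertex_set_def)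
  also have "\<dots> \<le> (\<Sum>e\<in>set_mset M. 2)"
    using assms by (intro sum_mono) (auto simp: small_multisets_def slots_def)
  also have "\<dots> = 2 * card (set_mset M)" by simp
  also have "card (set_mset M) \<le> size M"
    unfolding size_multiset_overloaded_eq using sum_mono[of "set_mset M" "\<lambda>_. 1" "count M"] by (simp add: Suc_leI)
  also have "size M \<le> N" using assms by (simp add: small_multisets_def)
  finally show ?thesis by simp
qed

lemma gateaux_zero_imp_expansion:
  assumes "class_function F" "continuous_wrt L1_norm F" "times_gateaux_differentiable (N + 1) F"
    and "\<forall>f\<in>graphons. \<forall>g. (\<forall>i<N + 1. g i \<in> Adm f) \<longrightarrow> gateaux F g (N + 1) f = 0"
  shows "\<exists>c. hom_density_expansion N c F"
proof (rule step_polynomial_expansion[OF gateaux_zero_imp_step_polynomial[OF assms]])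
  show "vanishing_from N F (Suc (2 * N))"
    unfolding vanishing_from_def using card_vertex_set_le by (metis not_less_eq_eq)
qed

section \<open>Vanishing derivatives of homomorphism densities\<close>

text \<open>The index is a strict bound on the degree.\<close>

primrec gateaux_polynomial :: "nat \<Rightarrow> (kernel \<Rightarrow> real) \<Rightarrow> bool" where
  "gateaux_polynomial 0 \<Phi> \<longleftrightarrow> (\<forall>f\<in>kernels. \<Phi> f = 0)"
| "gateaux_polynomial (Suc n) \<Phi> \<longleftrightarrow> (\<forall>g\<in>kernels. \<exists>\<Psi>. gateaux_polynomial n \<Psi> \<and>
     (\<forall>f\<in>kernels. has_gateaux_derivative \<Phi> (\<Psi> f) f g))"

lemma kernels_add_mult:
  assumes "f \<in> kernels" "g \<in> kernels"
  shows "(\<lambda>z. f z + l * g z) \<in> kernels"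
  using kernels_lincomb[OF assms, of 1 l] by simp

lemma gateaux_polynomial_zero: "gateaux_polynomial n (\<lambda>_. 0)"
proof (induction n)
  case (Suc n)
  then show ?case by (auto simp: has_gateaux_derivative_def intro!: exI[of _ "\<lambda>_. 0"])
qed simp

lemma gateaux_polynomial_Suc: "gateaux_polynomial n \<Phi> \<Longrightarrow> gateaux_polynomial (Suc n) \<Phi>"
proof (induction n arbitrary: \<Phi>)
  case 0
  have "has_gateaux_derivative \<Phi> 0 f g" if "f \<in> kernels" "g \<in> kernels" for f g
    using 0 that kernels_add_mult[OF that] by (simp add: has_gateaux_derivative_def)
  then show ?case by (auto intro!: exI[of _ "\<lambda>_. 0"])
next
  case (Suc n)
  show ?case unfolding gateaux_polynomial.simps(2)[of "Suc n"]
  proof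
    fix g assume "g \<in> kernels"
    then obtain \<Psi> where "gateaux_polynomial n \<Psi>" "\<forall>f\<in>kernels. has_gateaux_derivative \<Phi> (\<Psi> f) f g"
      using Suc.prems by auto
    with Suc.IH show "\<exists>\<Psi>. gateaux_polynomial (Suc n) \<Psi> \<and> (\<forall>f\<in>kernels. has_gateaux_derivative \<Phi> (\<Psi> f) f g)"
      by blast
  qed
qed

lemma gateaux_polynomial_mono: "gateaux_polynomial m \<Phi> \<Longrightarrow> m \<le> n \<Longrightarrow> gateaux_polynomial n \<Phi>"
  by (rotate_tac 1, induction n rule: dec_induct) (auto intro: gateaux_polynomial_Suc simp del: gateaux_polynomial.simps)

lemma gateaux_polynomial_lincomb:
  "gateaux_polynomial n \<Phi> \<Longrightarrow> gateaux_polynomial n \<Psi> \<Longrightarrow> gateaux_polynomial n (\<lambda>f. a * \<Phi> f + b * \<Psi> f)"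
proof (induction n arbitrary: \<Phi> \<Psi>)
  case (Suc n)
  show ?case unfolding gateaux_polynomial.simps(2)
  proof
    fix g assume g: "g \<in> kernels"
    obtain \<Phi>' where 1: "gateaux_polynomial n \<Phi>'" "\<forall>f\<in>kernels. has_gateaux_derivative \<Phi> (\<Phi>' f) f g"
      using Suc.prems(1) g by auto
    obtain \<Psi>' where 2: "gateaux_polynomial n \<Psi>'" "\<forall>f\<in>kernels. has_gateaux_derivative \<Psi> (\<Psi>' f) f g"
      using Suc.prems(2) g by auto
    have "has_gateaux_derivative (\<lambda>f. a * \<Phi> f + b * \<Psi> f) (a * \<Phi>' f + b * \<Psi>' f) f g" if f: "f \<in> kernels" for f
    proof -
      have "((\<lambda>l. a * ((\<Phi> (\<lambda>z. f z + l * g z) - \<Phi> f) / l) + b * ((\<Psi> (\<lambda>z. f z + l * g z) - \<Psi> f) / l))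
         \<longlongrightarrow> a * \<Phi>' f + b * \<Psi>' f) (at_right 0)"
        using 1(2) 2(2) f by (intro tendsto_intros) (auto simp: has_gateaux_derivative_def)
      then show ?thesis unfolding has_gateaux_derivative_def
        by (simp add: diff_divide_distrib add_divide_distrib algebra_simps)
    qed
    then show "\<exists>\<Theta>. gateaux_polynomial n \<Theta> \<and> (\<forall>f\<in>kernels. has_gateaux_derivative (\<lambda>f. a * \<Phi> f + b * \<Psi> f) (\<Theta> f) f g)"
      using Suc.IH[OF 1(1) 2(1)] by blast
  qed
qed simp

lemma gateaux_polynomial_sum:
  assumes "finite I" "\<And>i. i \<in> I \<Longrightarrow> gateaux_polynomial n (\<Phi> i)"
  shows "gateaux_polynomial n (\<lambda>f. \<Sum>i\<in>I. c i * \<Phi> i f)"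
  using assms
proof (induction I rule: finite_induct)
  case (insert i I)
  then have "gateaux_polynomial n (\<lambda>f. c i * \<Phi> i f + 1 * (\<Sum>i\<in>I. c i * \<Phi> i f))"
    by (intro gateaux_polynomial_lincomb) auto
  then show ?case using insert(1,2) by simp
qed (simp add: gateaux_polynomial_zero)

lemma integrable_kernel_prod:
  assumes "finite V" "finite I" "\<And>i. i \<in> I \<Longrightarrow> a i \<in> V \<and> b i \<in> V" "\<And>i. i \<in> I \<Longrightarrow> h i \<in> kernels"
  shows "integrable (\<Pi>\<^sub>M v\<in>V. unit_interval) (\<lambda>x. \<Prod>i\<in>I. h i (x (a i), x (b i)))"
proof -
  interpret product_prob_space "\<lambda>_. unit_interval" V by unfold_locales
  have "\<exists>B. \<forall>x\<in>{0..1}. \<forall>y\<in>{0..1}. \<bar>h i (x, y)\<bar> \<le> B" if "i \<in> I" for i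
    using kernels_bounded[OF assms(4)[OF that]] by metis
  then obtain B where B: "\<And>i x y. i \<in> I \<Longrightarrow> x \<in> {0..1} \<Longrightarrow> y \<in> {0..1} \<Longrightarrow> \<bar>h i (x, y)\<bar> \<le> B i"
    by metis
  show ?thesis
  proof (rule P.integrable_const_bound[of _ "\<Prod>i\<in>I. B i"])
    show "AE x in (\<Pi>\<^sub>M v\<in>V. unit_interval). norm (\<Prod>i\<in>I. h i (x (a i), x (b i))) \<le> (\<Prod>i\<in>I. B i)"
    proof (rule AE_I2)
      fix x assume x: "x \<in> space (\<Pi>\<^sub>M v\<in>V. unit_interval)"
      have "\<bar>h i (x (a i), x (b i))\<bar> \<le> B i" if i: "i \<in> I" for i
      proof (rule B[OF i])
        have "x v \<in> {0..1}" if "v \<in> V" for v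
          using PiE_mem[of x V "\<lambda>_. {0..1}" v] x that by (simp add: space_PiM)
        then show "x (a i) \<in> {0..1}" "x (b i) \<in> {0..1}" using assms(3)[OF i] by blast+
      qed
      then show "norm (\<Prod>i\<in>I. h i (x (a i), x (b i))) \<le> (\<Prod>i\<in>I. B i)"
        unfolding real_norm_def abs_prod by (intro prod_mono) auto
    qed
    show "(\<lambda>x. \<Prod>i\<in>I. h i (x (a i), x (b i))) \<in> borel_measurable (\<Pi>\<^sub>M v\<in>V. unit_interval)"
    proof (rule borel_measurable_prod)
      fix i assume i: "i \<in> I"
      show "(\<lambda>x. h i (x (a i), x (b i))) \<in> borel_measurable (\<Pi>\<^sub>M v\<in>V. unit_interval)"
        using assms(3)[OF i] assms(4)[OF i]
        by (intro measurable_compose[OF measurable_PiM_pair]) (auto simp: kernels_def)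
    qed
  qed
qed

definition mixed_density ::
  "nat set \<Rightarrow> 'i set \<Rightarrow> ('i \<Rightarrow> nat) \<Rightarrow> ('i \<Rightarrow> nat) \<Rightarrow> 'i set \<Rightarrow> ('i \<Rightarrow> kernel) \<Rightarrow> kernel \<Rightarrow> real" where
  "mixed_density V I a b A k f =
     (LINT x|(\<Pi>\<^sub>M v\<in>V. unit_interval). (\<Prod>i\<in>I. (if i \<in> A then f else k i) (x (a i), x (b i))))"

context
  fixes V :: "nat set" and I :: "'i set" and a b :: "'i \<Rightarrow> nat"
  assumes V: "finite V" and I: "finite I" and ab: "\<And>i. i \<in> I \<Longrightarrow> a i \<in> V \<and> b i \<in> V"
begin

lemma mixed_density_add_mult:
  assumes A: "A \<subseteq> I" and k: "\<And>i. i \<in> I \<Longrightarrow> k i \<in> kernels" and f: "f \<in> kernels" and g: "g \<in> kernels"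
  shows "mixed_density V I a b A k (\<lambda>z. f z + l * g z) =
    (\<Sum>B\<in>Pow A. l ^ card (A - B) * mixed_density V I a b B (\<lambda>i. if i \<in> A then g else k i) f)"
proof -
  let ?M = "\<Pi>\<^sub>M v\<in>V. unit_interval"
  let ?k = "\<lambda>i. if i \<in> A then g else k i"
  have fA: "finite A" using A I by (rule finite_subset)
  have int: "integrable ?M (\<lambda>x. \<Prod>i\<in>I. (if i \<in> B then f else ?k i) (x (a i), x (b i)))" for B
    using k f g by (intro integrable_kernel_prod V I ab) auto
  have pt: "(\<Prod>i\<in>I. (if i \<in> A then (\<lambda>z. f z + l * g z) else k i) (x (a i), x (b i))) =
     (\<Sum>B\<in>Pow A. l ^ card (A - B) * (\<Prod>i\<in>I. (if i \<in> B then f else ?k i) (x (a i), x (b i))))" for x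
  proof -
    let ?e = "\<lambda>h i. h (x (a i), x (b i)) :: real"
    have split: "(\<Prod>i\<in>I. h i) = (\<Prod>i\<in>A. h i) * (\<Prod>i\<in>I - A. h i)" for h :: "'i \<Rightarrow> real"
      using prod.subset_diff[OF A I, of h] by (simp add: mult.commute)
    have "(\<Prod>i\<in>A. ?e f i + l * ?e g i) = (\<Sum>B\<in>Pow A. (\<Prod>i\<in>B. ?e f i) * (\<Prod>i\<in>A - B. l * ?e g i))"
      using fA by (rule prod_add)
    also have "\<dots> = (\<Sum>B\<in>Pow A. l ^ card (A - B) * (\<Prod>i\<in>A. ?e (if i \<in> B then f else g) i))"
    proof (intro sum.cong refl)
      fix B assume B: "B \<in> Pow A"
      have "(\<Prod>i\<in>A. ?e (if i \<in> B then f else g) i) = (\<Prod>i\<in>A - B. ?e (if i \<in> B then f else g) i) * (\<Prod>i\<in>B. ?e (if i \<in> B then f else g) i)"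
        using B by (intro prod.subset_diff fA) auto
      also have "\<dots> = (\<Prod>i\<in>A - B. ?e g i) * (\<Prod>i\<in>B. ?e f i)" by simp
      finally show "(\<Prod>i\<in>B. ?e f i) * (\<Prod>i\<in>A - B. l * ?e g i) = l ^ card (A - B) * (\<Prod>i\<in>A. ?e (if i \<in> B then f else g) i)"
        by (simp add: prod.distrib)
    qed
    finally have eq: "(\<Prod>i\<in>A. ?e f i + l * ?e g i) = (\<Sum>B\<in>Pow A. l ^ card (A - B) * (\<Prod>i\<in>A. ?e (if i \<in> B then f else g) i))" .
    have "(\<Prod>i\<in>I. (if i \<in> A then (\<lambda>z. f z + l * g z) else k i) (x (a i), x (b i))) =
      (\<Prod>i\<in>A. ?e f i + l * ?e g i) * (\<Prod>i\<in>I - A. ?e (k i) i)" unfolding split by simp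
    also have "\<dots> = (\<Sum>B\<in>Pow A. l ^ card (A - B) * ((\<Prod>i\<in>A. ?e (if i \<in> B then f else g) i) * (\<Prod>i\<in>I - A. ?e (k i) i)))"
      unfolding eq sum_distrib_right by (simp add: mult.assoc)
    also have "\<dots> = (\<Sum>B\<in>Pow A. l ^ card (A - B) * (\<Prod>i\<in>I. (if i \<in> B then f else ?k i) (x (a i), x (b i))))"
    proof (intro sum.cong refl arg_cong2[where f="(*)"])
      fix B assume B: "B \<in> Pow A"
      have "(\<Prod>i\<in>I - A. (if i \<in> B then f else ?k i) (x (a i), x (b i))) = (\<Prod>i\<in>I - A. ?e (k i) i)"
        using B by (intro prod.cong) auto
      moreover have "(\<Prod>i\<in>A. (if i \<in> B then f else ?k i) (x (a i), x (b i))) = (\<Prod>i\<in>A. ?e (if i \<in> B then f else g) i)"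
        by (intro prod.cong) auto
      ultimately show "(\<Prod>i\<in>A. ?e (if i \<in> B then f else g) i) * (\<Prod>i\<in>I - A. ?e (k i) i) = (\<Prod>i\<in>I. (if i \<in> B then f else ?k i) (x (a i), x (b i)))"
        unfolding split by simp
    qed
    finally show ?thesis .
  qed
  show ?thesis
    unfolding mixed_density_def pt using int by (subst Bochner_Integration.integral_sum) auto
qed

lemma gateaux_polynomial_mixed_density:
  assumes "A \<subseteq> I" "\<And>i. i \<in> I \<Longrightarrow> k i \<in> kernels"
  shows "gateaux_polynomial (Suc (card A)) (mixed_density V I a b A k)"
  using assms
proof (induction "card A" arbitrary: A k rule: less_induct)
  case less
  let ?T = "mixed_density V I a b"
  have fA: "finite A" using less.prems(1) I by (rule finite_subset)
  show ?case unfolding gateaux_polynomial.simps(2)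
  proof
    fix g assume g: "g \<in> kernels"
    let ?k = "\<lambda>i. if i \<in> A then g else k i"
    define \<Psi> where "\<Psi> = (\<lambda>f. \<Sum>B\<in>{B \<in> Pow A. card (A - B) = 1}. 1 * ?T B ?k f)"
    have "gateaux_polynomial (card A) \<Psi>"
      unfolding \<Psi>_def
    proof (rule gateaux_polynomial_sum)
      fix B assume B: "B \<in> {B \<in> Pow A. card (A - B) = 1}"
      then have "card A - card B = 1" using card_Diff_subset[of B A] finite_subset[of B A] fA by simp
      then have cB: "Suc (card B) = card A" by simp
      have "gateaux_polynomial (Suc (card B)) (?T B ?k)"
        using B cB less.prems g by (intro less.hyps) auto
      then show "gateaux_polynomial (card A) (?T B ?k)" unfolding cB .
    qed (use fA in simp)
    moreover have "has_gateaux_derivative (?T A k) (\<Psi> f) f g" if f: "f \<in> kernels" for f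
    proof -
      let ?p = "\<lambda>l. \<Sum>B\<in>Pow A. l ^ card (A - B) * ?T B ?k f"
      have p: "?T A k (\<lambda>z. f z + l * g z) = ?p l" for l
        by (rule mixed_density_add_mult[OF less.prems(1) less.prems(2) f g])
      have p0: "?T A k f = ?p 0" using p[of 0] by simp
      have "(?p has_real_derivative (\<Sum>B\<in>Pow A. (real (card (A - B)) * 0 ^ (card (A - B) - 1)) * ?T B ?k f)) (at 0)"
        by (auto intro!: derivative_eq_intros sum.cong)
      moreover have "(\<Sum>B\<in>Pow A. (real (card (A - B)) * 0 ^ (card (A - B) - 1)) * ?T B ?k f) = \<Psi> f"
      proof -
        have "real c * 0 ^ (c - 1) = of_bool (c = 1)" for c by (cases "c = 1"; cases c) auto
        then have "(\<Sum>B\<in>Pow A. (real (card (A - B)) * 0 ^ (card (A - B) - 1)) * ?T B ?k f) =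
          (\<Sum>B\<in>Pow A. if card (A - B) = 1 then 1 * ?T B ?k f else 0)"
          by (intro sum.cong refl) simp
        then show ?thesis unfolding \<Psi>_def using fA by (subst sum.inter_filter) (simp, simp only:)
      qed
      ultimately have "(?p has_real_derivative \<Psi> f) (at 0)" by simp
      then have "((\<lambda>l. (?p l - ?p 0) / l) \<longlongrightarrow> \<Psi> f) (at 0)"
        unfolding DERIV_def add_0 .
      then have "((\<lambda>l. (?p l - ?p 0) / l) \<longlongrightarrow> \<Psi> f) (at_right 0)"
        by (rule tendsto_within_subset) simp
      then show ?thesis unfolding has_gateaux_derivative_def p p0 .
    qed
    ultimately show "\<exists>\<Psi>. gateaux_polynomial (card A) \<Psi> \<and> (\<forall>f\<in>kernels. has_gateaux_derivative (?T A k) (\<Psi> f) f g)"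
      by blast
  qed
qed

end

lemma gateaux_polynomial_hom_density:
  assumes G: "loopless_multigraph G" "size (edges G) \<le> N"
  shows "gateaux_polynomial (Suc N) (hom_density G)"
proof -
  obtain xs where xs: "mset xs = edges G" using ex_mset by blast
  let ?I = "{0..<length xs}"
  have mem: "xs ! i \<in># edges G" if "i \<in> ?I" for i using that by (auto simp flip: xs)
  have V: "finite (verts G)" using G by (simp add: loopless_multigraph_def)
  have "hom_density G f = mixed_density (verts G) ?I (\<lambda>i. Min (xs ! i)) (\<lambda>i. Max (xs ! i)) ?I (\<lambda>_ _. 0) f" for f
  proof -
    have "(\<Prod>e\<in>#edges G. f (x (Min e), x (Max e))) = (\<Prod>i\<in>?I. f (x (Min (xs ! i)), x (Max (xs ! i))))" for x
    proof -
      have "(\<Prod>e\<in>#edges G. f (x (Min e), x (Max e))) = prod_list (map (\<lambda>e. f (x (Min e), x (Max e))) xs)"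
        by (simp flip: xs mset_map add: prod_mset_prod_list)
      then show ?thesis by (simp add: prod.list_conv_set_nth)
    qed
    then show ?thesis unfolding hom_density_def mixed_density_def
      by (auto intro!: Bochner_Integration.integral_cong prod.cong)
  qed
  then have eq: "hom_density G = mixed_density (verts G) ?I (\<lambda>i. Min (xs ! i)) (\<lambda>i. Max (xs ! i)) ?I (\<lambda>_ _. 0)"
    by (rule ext)
  have "(\<lambda>_. 0) \<in> kernels"
    by (auto simp: kernels_def bounded_iff)
  then have "gateaux_polynomial (Suc (card ?I)) (hom_density G)"
    unfolding eq using edge_verts[OF G(1) mem] by (intro gateaux_polynomial_mixed_density V) auto
  moreover have "card ?I = size (edges G)" by (simp flip: xs)
  ultimately have "gateaux_polynomial (Suc (size (edges G))) (hom_density G)" by (simp only:)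
  then show ?thesis by (rule gateaux_polynomial_mono) (use G(2) in simp)
qed

lemma graphon_add_small_multiple:
  assumes f: "f \<in> graphons" and e: "e > 0" "(\<lambda>z. f z + e * g z) \<in> graphons" and t: "t \<in> {0..e}"
  shows "(\<lambda>z. f z + t * g z) \<in> graphons"
proof -
  have "(\<lambda>z. f z + t / e * ((f z + e * g z) - f z)) \<in> graphons"
    using t e(1) by (intro graphons_convex[OF f e(2)]) auto
  then show ?thesis using e(1) by simp
qed

lemma Adm_eventually:
  assumes f: "f \<in> graphons" and g: "g \<in> Adm f" and h: "h \<in> Adm f"
  shows "eventually (\<lambda>l. (\<lambda>z. f z + l * h z) \<in> graphons \<and> g \<in> Adm (\<lambda>z. f z + l * h z)) (at_right 0)"
proof -
  obtain e1 where e1: "e1 > 0" "(\<lambda>z. f z + e1 * g z) \<in> graphons" using g by (auto simp: Adm_def)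
  obtain e2 where e2: "e2 > 0" "(\<lambda>z. f z + e2 * h z) \<in> graphons" using h by (auto simp: Adm_def)
  have gk: "g \<in> kernels" using g by (simp add: Adm_def)
  have "eventually (\<lambda>l. l \<in> {0<..<e2 / 2}) (at_right 0)"
    using e2 by (intro eventually_at_right_real) auto
  then show ?thesis
  proof eventually_elim
    case (elim l)
    have 1: "(\<lambda>z. f z + l * h z) \<in> graphons" using elim by (intro graphon_add_small_multiple[OF f e2]) auto
    have 2: "(\<lambda>z. f z + (2 * l) * h z) \<in> graphons" using elim by (intro graphon_add_small_multiple[OF f e2]) auto
    have "(\<lambda>z. (f z + (2 * l) * h z) + 1 / 2 * ((f z + e1 * g z) - (f z + (2 * l) * h z))) \<in> graphons"
      by (rule graphons_convex[OF 2 e1(2)]) simp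
    moreover have "(\<lambda>z. (f z + (2 * l) * h z) + 1 / 2 * ((f z + e1 * g z) - (f z + (2 * l) * h z)))
      = (\<lambda>z. (f z + l * h z) + e1 / 2 * g z)" by (auto simp: field_simps)
    ultimately have "(\<lambda>z. (f z + l * h z) + e1 / 2 * g z) \<in> graphons" by (simp only:)
    moreover have "e1 / 2 > 0" using e1 by simp
    ultimately have "g \<in> Adm (\<lambda>z. f z + l * h z)" unfolding Adm_def using gk by blast
    with 1 show ?case by blast
  qed
qed

lemma gateaux_eq_polynomial:
  assumes gp: "gateaux_polynomial (Suc N) \<Phi>" and F: "\<And>f. f \<in> graphons \<Longrightarrow> F f = \<Phi> f"
    and g: "\<And>i. i < Suc N \<Longrightarrow> g i \<in> kernels" and k: "k \<le> Suc N"
  shows "\<exists>\<Psi>. gateaux_polynomial (Suc N - k) \<Psi> \<and>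
    (\<forall>f\<in>graphons. (\<forall>i<k. g i \<in> Adm f) \<longrightarrow> gateaux F g k f = \<Psi> f)"
  using k
proof (induction k)
  case 0
  then show ?case using gp F by (intro exI[of _ \<Phi>]) auto
next
  case (Suc k)
  then obtain \<Psi> where \<Psi>: "gateaux_polynomial (Suc (N - k)) \<Psi>"
    "\<And>f. f \<in> graphons \<Longrightarrow> (\<forall>i<k. g i \<in> Adm f) \<Longrightarrow> gateaux F g k f = \<Psi> f"
    by (auto simp: Suc_diff_le simp del: gateaux_polynomial.simps)
  obtain \<Psi>' where \<Psi>': "gateaux_polynomial (N - k) \<Psi>'" "\<And>f. f \<in> kernels \<Longrightarrow> has_gateaux_derivative \<Psi> (\<Psi>' f) f (g k)"
    using \<Psi>(1) g[of k] Suc.prems by auto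
  have "gateaux F g (Suc k) f = \<Psi>' f" if f: "f \<in> graphons" and adm: "\<forall>i<Suc k. g i \<in> Adm f" for f
  proof -
    have "\<forall>\<^sub>F l in at_right 0. \<forall>i\<in>{..<Suc k}. (\<lambda>z. f z + l * g k z) \<in> graphons \<and> g i \<in> Adm (\<lambda>z. f z + l * g k z)"
      using adm f by (intro eventually_ball_finite ballI Adm_eventually) auto
    then have "\<forall>\<^sub>F l in at_right 0. (\<Psi> (\<lambda>z. f z + l * g k z) - \<Psi> f) / l =
       (gateaux F g k (\<lambda>z. f z + l * g k z) - gateaux F g k f) / l"
    proof eventually_elim
      case (elim l)
      then have "(\<lambda>z. f z + l * g k z) \<in> graphons" "\<forall>i<k. g i \<in> Adm (\<lambda>z. f z + l * g k z)" by auto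
      then have "gateaux F g k (\<lambda>z. f z + l * g k z) = \<Psi> (\<lambda>z. f z + l * g k z)" by (rule \<Psi>(2))
      moreover have "gateaux F g k f = \<Psi> f" using adm by (intro \<Psi>(2)[OF f]) auto
      ultimately show ?case by simp
    qed
    moreover have "((\<lambda>l. (\<Psi> (\<lambda>z. f z + l * g k z) - \<Psi> f) / l) \<longlongrightarrow> \<Psi>' f) (at_right 0)"
      using \<Psi>'(2)[of f] f by (simp add: has_gateaux_derivative_def graphons_def)
    ultimately have "has_gateaux_derivative (gateaux F g k) (\<Psi>' f) f (g k)"
      unfolding has_gateaux_derivative_def by (rule Lim_transform_eventually[rotated])
    then show ?thesis using has_gateaux_derivative_unique by simp
  qed
  then show ?case using \<Psi>'(1) by auto
qed

section \<open>Quasirandom kernels and the cut norm\<close>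

primrec hadamard :: "nat \<Rightarrow> nat \<Rightarrow> nat \<Rightarrow> real" where
  "hadamard 0 i j = 1"
| "hadamard (Suc k) i j = hadamard k (i div 2) (j div 2) * (if odd i \<and> odd j then -1 else 1)"

lemma hadamard_commute: "hadamard k i j = hadamard k j i"
  by (induction k arbitrary: i j) auto

lemma hadamard_cases: "hadamard k i j = 1 \<or> hadamard k i j = -1"
proof (induction k arbitrary: i j)
  case (Suc k)
  from Suc[of "i div 2" "j div 2"] show ?case by auto
qed simp

lemma sum_lessThan_double:
  "(\<Sum>i<2 * n. f i) = (\<Sum>i<n. f (2 * i) + f (2 * i + 1))" for f :: "nat \<Rightarrow> real"
  by (induction n) auto

lemma hadamard_orthogonal:
  "j < 2 ^ k \<Longrightarrow> j' < 2 ^ k \<Longrightarrow> (\<Sum>i<2 ^ k. hadamard k i j * hadamard k i j') = (if j = j' then 2 ^ k else 0)"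
proof (induction k arbitrary: j j')
  case (Suc k)
  have lt: "j div 2 < 2 ^ k" "j' div 2 < 2 ^ k" using Suc.prems by auto
  let ?s = "\<lambda>j. if odd j then -1 else (1::real)"
  have "(\<Sum>i<2 ^ Suc k. hadamard (Suc k) i j * hadamard (Suc k) i j') =
    (\<Sum>i<2 ^ k. hadamard k i (j div 2) * hadamard k i (j' div 2) * (1 + ?s j * ?s j'))"
    unfolding power_Suc sum_lessThan_double by (intro sum.cong refl) (auto simp: algebra_simps)
  also have "\<dots> = (if j div 2 = j' div 2 then 2 ^ k else 0) * (1 + ?s j * ?s j')"
    unfolding sum_distrib_right[symmetric] Suc.IH[OF lt] ..
  also have "\<dots> = (if j = j' then 2 ^ Suc k else 0)"
  proof (cases "j div 2 = j' div 2")
    case True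
    then have "j = j' \<longleftrightarrow> (odd j \<longleftrightarrow> odd j')"
      by (metis div_mult_mod_eq odd_iff_mod_2_eq_one not_mod_2_eq_0_eq_1 even_iff_mod_2_eq_zero)
    then show ?thesis using True by auto
  next
    case False
    then have "j \<noteq> j'" by auto
    then show ?thesis using False by simp
  qed
  finally show ?case .
qed simp

text \<open>Lindsey's inequality: by orthogonality the operator norm of the Hadamard matrix is the square
  root of its size.\<close>

lemma hadamard_bilinear_bound:
  fixes u w :: "nat \<Rightarrow> real"
  assumes "\<And>i. i < 2 ^ k \<Longrightarrow> \<bar>u i\<bar> \<le> 1" "\<And>i. i < 2 ^ k \<Longrightarrow> \<bar>w i\<bar> \<le> 1"
  shows "\<bar>\<Sum>i<2 ^ k. \<Sum>j<2 ^ k. u i * w j * hadamard k i j\<bar> \<le> 2 ^ k * sqrt (2 ^ k)"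
proof -
  let ?m = "2 ^ k :: nat" let ?h = "hadamard k"
  have sq: "x\<^sup>2 \<le> 1" if "\<bar>x\<bar> \<le> 1" for x :: real using that by (simp add: abs_square_le_1)
  have "(\<Sum>i<?m. (\<Sum>j<?m. w j * ?h i j)\<^sup>2) = (\<Sum>i<?m. \<Sum>j<?m. \<Sum>j'<?m. w j * w j' * (?h i j * ?h i j'))"
    by (simp add: power2_eq_square sum_product mult_ac)
  also have "\<dots> = (\<Sum>j<?m. \<Sum>j'<?m. \<Sum>i<?m. w j * w j' * (?h i j * ?h i j'))"
    by (rule trans[OF sum.swap], rule sum.cong[OF refl], rule sum.swap)
  also have "\<dots> = (\<Sum>j<?m. \<Sum>j'<?m. if j' = j then (w j)\<^sup>2 * ?m else 0)"
    unfolding sum_distrib_left[symmetric]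
    by (intro sum.cong refl) (auto simp: hadamard_orthogonal power2_eq_square)
  also have "\<dots> = (\<Sum>j<?m. (w j)\<^sup>2 * ?m)" by (intro sum.cong refl) (simp add: sum.delta)
  also have "\<dots> \<le> (\<Sum>j<?m. 1 * real ?m)"
    using assms(2) sq by (intro sum_mono mult_right_mono) auto
  also have "\<dots> = (real ?m)\<^sup>2" by (simp add: power2_eq_square)
  finally have W: "(\<Sum>i<?m. (\<Sum>j<?m. w j * ?h i j)\<^sup>2) \<le> (real ?m)\<^sup>2" .
  have "(\<Sum>i<?m. (u i)\<^sup>2) \<le> (\<Sum>i<?m. 1)" using assms(1) sq by (intro sum_mono) auto
  then have U: "(\<Sum>i<?m. (u i)\<^sup>2) \<le> real ?m" by simp
  have "(\<Sum>i<?m. \<Sum>j<?m. u i * w j * ?h i j)\<^sup>2 = (\<Sum>i<?m. u i * (\<Sum>j<?m. w j * ?h i j))\<^sup>2"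
    by (simp add: sum_distrib_left mult.assoc)
  also have "\<dots> \<le> (\<Sum>i<?m. (u i)\<^sup>2) * (\<Sum>i<?m. (\<Sum>j<?m. w j * ?h i j)\<^sup>2)"
    by (rule Cauchy_Schwarz_ineq_sum)
  also have "\<dots> \<le> real ?m * (real ?m)\<^sup>2"
    using U W by (intro mult_mono) (auto intro: sum_nonneg)
  also have "\<dots> = (real ?m * sqrt (real ?m))\<^sup>2" by (simp add: power_mult_distrib)
  finally have "\<bar>\<Sum>i<?m. \<Sum>j<?m. u i * w j * ?h i j\<bar> \<le> \<bar>real ?m * sqrt (real ?m)\<bar>"
    by (simp only: abs_le_square_iff)
  then show ?thesis by simp
qed

definition hadamard_slot :: "nat \<Rightarrow> nat set \<Rightarrow> real" where
  "hadamard_slot k e = hadamard k (Min e mod 2 ^ k) (Max e mod 2 ^ k)"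

lemma hadamard_slot_pair: "hadamard_slot k {i, j} = hadamard k (i mod 2 ^ k) (j mod 2 ^ k)"
  by (cases "i \<le> j") (auto simp: hadamard_slot_def min_def max_def hadamard_commute)

lemma sum_lessThan_mult:
  fixes f :: "nat \<Rightarrow> real"
  shows "(\<Sum>i<n * m. f i) = (\<Sum>a<n. \<Sum>r<m. f (a * m + r))"
proof -
  have "(\<Sum>i<n * m. f i) = (\<Sum>a<n. sum f {a * m..<a * m + m})" by (rule sum.nat_group[symmetric])
  also have "\<dots> = (\<Sum>a<n. \<Sum>r<m. f (a * m + r))"
  proof (rule sum.cong[OF refl])
    show "sum f {a * m..<a * m + m} = (\<Sum>r<m. f (a * m + r))" for a
      using sum.shift_bounds_nat_ivl[of f 0 "a * m" m] by (simp add: atLeast0LessThan add.commute)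
  qed
  finally show ?thesis .
qed

lemma hadamard_block_bound:
  fixes u w :: "nat \<Rightarrow> real" and B :: "nat set \<Rightarrow> real"
  assumes "\<And>i. i < n * 2 ^ k \<Longrightarrow> \<bar>u i\<bar> \<le> 1" "\<And>i. i < n * 2 ^ k \<Longrightarrow> \<bar>w i\<bar> \<le> 1" and B: "\<And>e. \<bar>B e\<bar> \<le> 1"
  shows "\<bar>\<Sum>i<n * 2 ^ k. \<Sum>j<n * 2 ^ k. u i * w j * (B ((\<lambda>i. i div 2 ^ k) ` {i, j}) * hadamard_slot k {i, j})\<bar>
    \<le> (real n)\<^sup>2 * (2 ^ k * sqrt (2 ^ k))"
proof -
  let ?m = "2 ^ k :: nat"
  let ?f = "\<lambda>i j. u i * w j * (B ((\<lambda>i. i div ?m) ` {i, j}) * hadamard_slot k {i, j})"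
  have "(\<Sum>i<n * ?m. \<Sum>j<n * ?m. ?f i j) = (\<Sum>a<n. \<Sum>r<?m. \<Sum>b<n. \<Sum>s<?m. ?f (a * ?m + r) (b * ?m + s))"
    unfolding sum_lessThan_mult ..
  also have "\<dots> = (\<Sum>a<n. \<Sum>b<n. \<Sum>r<?m. \<Sum>s<?m. ?f (a * ?m + r) (b * ?m + s))"
    by (rule sum.cong[OF refl], rule sum.swap)
  also have "\<dots> = (\<Sum>a<n. \<Sum>b<n. B {a, b} * (\<Sum>r<?m. \<Sum>s<?m. u (a * ?m + r) * w (b * ?m + s) * hadamard k r s))"
    by (simp add: hadamard_slot_pair sum_distrib_left mult_ac)
  finally have eq: "(\<Sum>i<n * ?m. \<Sum>j<n * ?m. ?f i j) = \<dots>" .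
  have lt: "a * ?m + r < n * ?m" if "a < n" "r < ?m" for a r
  proof -
    have "a * ?m + r < Suc a * ?m" using that(2) by simp
    also have "\<dots> \<le> n * ?m" using that(1) by (intro mult_right_mono) auto
    finally show ?thesis .
  qed
  have "\<bar>B {a, b} * (\<Sum>r<?m. \<Sum>s<?m. u (a * ?m + r) * w (b * ?m + s) * hadamard k r s)\<bar> \<le> 1 * (2 ^ k * sqrt (2 ^ k))"
    if "a < n" "b < n" for a b
    unfolding abs_mult using B assms(1,2) lt[OF that(1)] lt[OF that(2)]
    by (intro mult_mono hadamard_bilinear_bound) auto
  then have "\<bar>\<Sum>a<n. \<Sum>b<n. B {a, b} * (\<Sum>r<?m. \<Sum>s<?m. u (a * ?m + r) * w (b * ?m + s) * hadamard k r s)\<bar>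
    \<le> (\<Sum>a<n. \<Sum>b<n. 2 ^ k * sqrt (2 ^ k))"
    by (intro order_trans[OF sum_abs] sum_mono) auto
  also have "\<dots> = (real n)\<^sup>2 * (2 ^ k * sqrt (2 ^ k))" by (simp add: power2_eq_square)
  finally show ?thesis unfolding eq .
qed

lemma sum_PiE_insert:
  fixes f :: "('a \<Rightarrow> 'b) \<Rightarrow> real"
  assumes "a \<notin> U"
  shows "(\<Sum>v\<in>PiE (insert a U) (\<lambda>_. B). f v) = (\<Sum>v\<in>PiE U (\<lambda>_. B). \<Sum>i\<in>B. f (v(a := i)))"
proof -
  have "(\<Sum>v\<in>PiE (insert a U) (\<lambda>_. B). f v) = (\<Sum>(i, v)\<in>B \<times> PiE U (\<lambda>_. B). f (v(a := i)))"
    unfolding PiE_insert_eq using inj_combinator[OF assms, of "\<lambda>_. B"]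
    by (subst sum.reindex) (auto simp: case_prod_unfold)
  also have "\<dots> = (\<Sum>v\<in>PiE U (\<lambda>_. B). \<Sum>i\<in>B. f (v(a := i)))"
    by (simp add: sum.cartesian_product[symmetric] sum.swap[of _ B])
  finally show ?thesis .
qed

lemma abs_prod_le_1:
  fixes f :: "'a \<Rightarrow> real"
  assumes "\<And>i. i \<in> I \<Longrightarrow> \<bar>f i\<bar> \<le> 1"
  shows "\<bar>\<Prod>i\<in>I. f i\<bar> \<le> 1"
  unfolding abs_prod using assms by (intro prod_le_1) auto

lemma coloring_sum_bound:
  fixes \<phi> :: "nat set \<Rightarrow> nat set \<Rightarrow> real"
  assumes V: "finite V" and E: "finite E" "\<And>e. e \<in> E \<Longrightarrow> card e = 2 \<and> e \<subseteq> V" and e0: "e0 \<in> E"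
    and \<phi>: "\<And>e x. e \<in> E \<Longrightarrow> \<bar>\<phi> e x\<bar> \<le> 1" and B: "\<And>e. \<bar>B e\<bar> \<le> 1"
    and \<phi>0: "\<And>x. \<phi> e0 x = B ((\<lambda>i. i div 2 ^ k) ` x) * hadamard_slot k x"
  shows "\<bar>\<Sum>v\<in>PiE V (\<lambda>_. {..<n * 2 ^ k}). \<Prod>e\<in>E. \<phi> e (v ` e)\<bar> * sqrt (2 ^ k) \<le> real (n * 2 ^ k) ^ card V"
proof -
  let ?M = "n * 2 ^ k" let ?R = "{..<n * 2 ^ k}"
  obtain a b where ab: "e0 = {a, b}" "a \<noteq> b" using E(2)[OF e0] by (auto simp: card_2_iff)
  define U where "U = V - {a, b}"
  have V_eq: "V = insert a (insert b U)" using E(2)[OF e0] ab by (auto simp: U_def)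
  have nU: "a \<notin> insert b U" "b \<notin> U" "finite U" using ab V by (auto simp: U_def)
  let ?Ea = "{e \<in> E - {e0}. a \<in> e}" let ?Eb = "{e \<in> E - {e0}. a \<notin> e}"
  have nb: "b \<notin> e" if "e \<in> ?Ea" for e
  proof
    assume "b \<in> e"
    then have "{a, b} \<subseteq> e" using that by auto
    moreover have "card e = card {a, b}" "finite e" using that E(2)[of e] ab by (auto intro: card_ge_0_finite)
    ultimately have "{a, b} = e" by (intro card_subset_eq) auto
    then show False using that ab by simp
  qed
  have inner: "\<bar>\<Sum>i\<in>?R. \<Sum>j\<in>?R. \<Prod>e\<in>E. \<phi> e ((v(b := j, a := i)) ` e)\<bar> \<le> (real n)\<^sup>2 * (2 ^ k * sqrt (2 ^ k))" for v
  proof -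
    define u where "u i = (\<Prod>e\<in>?Ea. \<phi> e ((v(a := i)) ` e))" for i
    define w where "w j = (\<Prod>e\<in>?Eb. \<phi> e ((v(b := j)) ` e))" for j
    have "(\<Prod>e\<in>E. \<phi> e ((v(b := j, a := i)) ` e)) = u i * w j * (B ((\<lambda>i. i div 2 ^ k) ` {i, j}) * hadamard_slot k {i, j})" for i j
    proof -
      let ?v = "v(b := j, a := i)"
      have 1: "(\<Prod>e\<in>E. \<phi> e (?v ` e)) = \<phi> e0 (?v ` e0) * (\<Prod>e\<in>E - {e0}. \<phi> e (?v ` e))"
        using E(1) e0 by (rule prod.remove)
      have "E - {e0} = ?Ea \<union> ?Eb" by auto
      then have "(\<Prod>e\<in>E - {e0}. \<phi> e (?v ` e)) = (\<Prod>e\<in>?Ea \<union> ?Eb. \<phi> e (?v ` e))" by (rule arg_cong)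
      also have "\<dots> = (\<Prod>e\<in>?Ea. \<phi> e (?v ` e)) * (\<Prod>e\<in>?Eb. \<phi> e (?v ` e))"
        using E(1) by (intro prod.union_disjoint) auto
      finally have 2: "(\<Prod>e\<in>E - {e0}. \<phi> e (?v ` e)) = (\<Prod>e\<in>?Ea. \<phi> e (?v ` e)) * (\<Prod>e\<in>?Eb. \<phi> e (?v ` e))" .
      have 3: "(\<Prod>e\<in>?Ea. \<phi> e (?v ` e)) = u i"
        unfolding u_def
      proof (rule prod.cong[OF refl])
        fix e assume "e \<in> ?Ea"
        then have "?v ` e = (v(a := i)) ` e" using nb[of e] by (intro image_cong) auto
        then show "\<phi> e (?v ` e) = \<phi> e ((v(a := i)) ` e)" by (simp only:)
      qed
      have 4: "(\<Prod>e\<in>?Eb. \<phi> e (?v ` e)) = w j"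
        unfolding w_def
      proof (rule prod.cong[OF refl])
        fix e assume "e \<in> ?Eb"
        then have "?v ` e = (v(b := j)) ` e" by (intro image_cong) auto
        then show "\<phi> e (?v ` e) = \<phi> e ((v(b := j)) ` e)" by (simp only:)
      qed
      have 5: "?v ` e0 = {i, j}" using ab by auto
      show ?thesis unfolding 1 2 3 4 5 \<phi>0 by (rule mult.commute)
    qed
    then have "(\<Sum>i\<in>?R. \<Sum>j\<in>?R. \<Prod>e\<in>E. \<phi> e ((v(b := j, a := i)) ` e)) =
      (\<Sum>i<?M. \<Sum>j<?M. u i * w j * (B ((\<lambda>i. i div 2 ^ k) ` {i, j}) * hadamard_slot k {i, j}))" by simp
    moreover have "\<bar>u i\<bar> \<le> 1" "\<bar>w i\<bar> \<le> 1" for i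
      unfolding u_def w_def using \<phi> by (auto intro!: abs_prod_le_1)
    ultimately show ?thesis using hadamard_block_bound[of n k u w B] B by simp
  qed
  have "(\<Sum>v\<in>PiE V (\<lambda>_. ?R). \<Prod>e\<in>E. \<phi> e (v ` e)) =
    (\<Sum>v\<in>PiE U (\<lambda>_. ?R). \<Sum>j\<in>?R. \<Sum>i\<in>?R. \<Prod>e\<in>E. \<phi> e ((v(b := j, a := i)) ` e))"
    unfolding V_eq by (simp only: sum_PiE_insert[OF nU(1)] sum_PiE_insert[OF nU(2)])
  also have "\<dots> = (\<Sum>v\<in>PiE U (\<lambda>_. ?R). \<Sum>i\<in>?R. \<Sum>j\<in>?R. \<Prod>e\<in>E. \<phi> e ((v(b := j, a := i)) ` e))"
    by (rule sum.cong[OF refl], rule sum.swap)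
  finally have eq: "(\<Sum>v\<in>PiE V (\<lambda>_. ?R). \<Prod>e\<in>E. \<phi> e (v ` e)) =
    (\<Sum>v\<in>PiE U (\<lambda>_. ?R). \<Sum>i\<in>?R. \<Sum>j\<in>?R. \<Prod>e\<in>E. \<phi> e ((v(b := j, a := i)) ` e))" .
  have "\<bar>\<Sum>v\<in>PiE V (\<lambda>_. ?R). \<Prod>e\<in>E. \<phi> e (v ` e)\<bar> \<le> (\<Sum>v\<in>PiE U (\<lambda>_. ?R). (real n)\<^sup>2 * (2 ^ k * sqrt (2 ^ k)))"
    unfolding eq by (intro order_trans[OF sum_abs] sum_mono inner)
  also have "\<dots> = real ?M ^ card U * ((real n)\<^sup>2 * (2 ^ k * sqrt (2 ^ k)))"
    using nU(3) by (simp add: card_PiE)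
  finally have "\<bar>\<Sum>v\<in>PiE V (\<lambda>_. ?R). \<Prod>e\<in>E. \<phi> e (v ` e)\<bar> * sqrt (2 ^ k) \<le> real ?M ^ card U * ((real n)\<^sup>2 * (2 ^ k * sqrt (2 ^ k))) * sqrt (2 ^ k)"
    by (intro mult_right_mono) auto
  also have "\<dots> = real ?M ^ card U * (real ?M)\<^sup>2"
  proof -
    have "sqrt (2 ^ k) * sqrt (2 ^ k) = (2 ^ k :: real)" by simp
    then show ?thesis by (simp add: power2_eq_square mult_ac)
  qed
  also have "\<dots> = real ?M ^ card V"
    using nU unfolding V_eq by (simp add: power2_eq_square)
  finally show ?thesis .
qed

definition quasirandom :: "nat \<Rightarrow> (nat set \<Rightarrow> real) \<Rightarrow> nat set \<Rightarrow> real" where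
  "quasirandom k A e = A ((\<lambda>i. i div 2 ^ k) ` e) * ((1 + hadamard_slot k e) / 2)"

lemma hadamard_slot_cases: "hadamard_slot k e = 1 \<or> hadamard_slot k e = -1"
  unfolding hadamard_slot_def by (rule hadamard_cases)

lemma quasirandom_cube:
  assumes "A \<in> cube"
  shows "quasirandom k A \<in> cube"
proof -
  have "quasirandom k A e \<in> {0..1}" for e
  proof -
    have "A ((\<lambda>i. i div 2 ^ k) ` e) \<in> {0..1}" using assms unfolding cube_def by blast
    then show ?thesis using hadamard_slot_cases[of k e] by (auto simp: quasirandom_def)
  qed
  then show ?thesis by (simp add: cube_def)
qed

lemma quasirandom_prod_mset:
  "(\<Prod>e\<in>#E. quasirandom k A (v ` e)) =
    (1 / 2) ^ card (set_mset E) * (\<Sum>S\<in>Pow (set_mset E). \<Prod>e\<in>set_mset E.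
      A ((\<lambda>i. i div 2 ^ k) ` v ` e) ^ count E e * (if e \<in> S then hadamard_slot k (v ` e) else 1))"
proof -
  let ?h = "\<lambda>e. hadamard_slot k (v ` e)" let ?A = "\<lambda>e. A ((\<lambda>i. i div 2 ^ k) ` v ` e)"
  have "(\<Prod>e\<in>#E. quasirandom k A (v ` e)) = (\<Prod>e\<in>set_mset E. quasirandom k A (v ` e) ^ count E e)"
    by (rule image_prod_mset_multiplicity)
  also have "\<dots> = (\<Prod>e\<in>set_mset E. (1 / 2) * (?A e ^ count E e * (?h e + 1)))"
  proof (intro prod.cong refl)
    fix e assume "e \<in> set_mset E"
    then have "count E e \<noteq> 0" by simp
    moreover have "?h e = 1 \<or> ?h e = -1" by (rule hadamard_slot_cases)
    ultimately show "quasirandom k A (v ` e) ^ count E e = (1 / 2) * (?A e ^ count E e * (?h e + 1))"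
      by (auto simp: quasirandom_def power_0_left)
  qed
  also have "\<dots> = (1 / 2) ^ card (set_mset E) * ((\<Prod>e\<in>set_mset E. ?A e ^ count E e) * (\<Prod>e\<in>set_mset E. ?h e + 1))"
    by (simp only: prod.distrib prod_constant)
  also have "(\<Prod>e\<in>set_mset E. ?h e + 1) = (\<Sum>S\<in>Pow (set_mset E). \<Prod>e\<in>set_mset E. if e \<in> S then ?h e else 1)"
  proof -
    have "(\<Prod>e\<in>set_mset E. ?h e + 1) = (\<Sum>S\<in>Pow (set_mset E). (\<Prod>e\<in>S. ?h e) * (\<Prod>e\<in>set_mset E - S. 1))"
      by (rule prod_add) simp
    also have "\<dots> = (\<Sum>S\<in>Pow (set_mset E). \<Prod>e\<in>set_mset E. if e \<in> S then ?h e else 1)"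
    proof (intro sum.cong refl)
      fix S assume "S \<in> Pow (set_mset E)"
      then have "set_mset E \<inter> {e. e \<in> S} = S" by auto
      then show "(\<Prod>e\<in>S. ?h e) * (\<Prod>e\<in>set_mset E - S. 1) = (\<Prod>e\<in>set_mset E. if e \<in> S then ?h e else 1)"
        using prod.inter_restrict[of "set_mset E" ?h S] by (simp add: Int_def)
    qed
    finally show ?thesis .
  qed
  finally show ?thesis by (simp add: sum_distrib_left prod.distrib)
qed

lemma inverse_sqrt_power_tendsto: "(\<lambda>k. 1 / sqrt (2 ^ k)) \<longlonglongrightarrow> 0"
proof -
  have "(\<lambda>k. sqrt ((1 / 2) ^ k)) \<longlonglongrightarrow> sqrt 0"
    by (intro tendsto_real_sqrt LIMSEQ_realpow_zero) auto
  then show ?thesis by (simp add: power_one_over real_sqrt_divide)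
qed

lemma hom_density_quasirandom:
  assumes G: "loopless_multigraph G" and n: "n > 0" and A: "A \<in> cube"
  shows "(\<lambda>k. hom_density G (step_kernel (n * 2 ^ k) (quasirandom k A))) \<longlonglongrightarrow>
    (1 / 2) ^ card (set_mset (edges G)) * hom_density G (step_kernel n A)"
proof -
  let ?E = "set_mset (edges G)" let ?V = "verts G" let ?c = "count (edges G)"
  let ?S = "\<lambda>k S. (\<Sum>v\<in>PiE ?V (\<lambda>_. {..<n * 2 ^ k}). \<Prod>e\<in>?E.
      A ((\<lambda>i. i div 2 ^ k) ` v ` e) ^ ?c e * (if e \<in> S then hadamard_slot k (v ` e) else 1)) / real (n * 2 ^ k) ^ card ?V"
  have V: "finite ?V" using G by (simp add: loopless_multigraph_def)
  have nk: "n * 2 ^ k > 0" for k using n by simp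
  have expand: "hom_density G (step_kernel (n * 2 ^ k) (quasirandom k A)) = (1 / 2) ^ card ?E * (\<Sum>S\<in>Pow ?E. ?S k S)" for k
    unfolding hom_density_step_kernel[OF G nk] quasirandom_prod_mset sum_distrib_left[symmetric]
    unfolding sum_divide_distrib[symmetric] times_divide_eq_right by (subst sum.swap, rule refl)
  have empty: "?S k {} = hom_density G (step_kernel n A)" for k
  proof -
    have "hom_density G (step_kernel n A) = hom_density G (step_kernel (n * 2 ^ k) (\<lambda>e. A ((\<lambda>i. i div 2 ^ k) ` e)))"
      using step_kernel_refine[OF n, of "2 ^ k" A] by simp
    also have "\<dots> = ?S k {}"
      unfolding hom_density_step_kernel[OF G nk] by (simp add: image_prod_mset_multiplicity)
    finally show ?thesis by simp
  qed
  have A1: "\<bar>A x\<bar> \<le> 1" for x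
  proof -
    have "A x \<in> {0..1}" using A unfolding cube_def by blast
    then show ?thesis by simp
  qed
  have small: "\<bar>?S k S\<bar> \<le> 1 / sqrt (2 ^ k)" if S: "S \<in> Pow ?E - {{}}" for k S
  proof -
    obtain e0 where e0: "e0 \<in> S" "e0 \<in> ?E" using S by blast
    define \<phi> where "\<phi> = (\<lambda>e x. A ((\<lambda>i. i div 2 ^ k) ` x) ^ ?c e * (if e \<in> S then hadamard_slot k x else 1))"
    have h1: "\<bar>hadamard_slot k x\<bar> \<le> 1" for x using hadamard_slot_cases[of k x] by auto
    have "\<bar>\<Sum>v\<in>PiE ?V (\<lambda>_. {..<n * 2 ^ k}). \<Prod>e\<in>?E. \<phi> e (v ` e)\<bar> * sqrt (2 ^ k) \<le> real (n * 2 ^ k) ^ card ?V"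
    proof (rule coloring_sum_bound[OF V _ _ e0(2), where B = "\<lambda>x. A x ^ ?c e0"])
      show "\<bar>\<phi> e x\<bar> \<le> 1" for e x
        unfolding \<phi>_def abs_mult power_abs using A1 h1 by (intro mult_le_one power_le_one) auto
      show "\<bar>A x ^ ?c e0\<bar> \<le> 1" for x unfolding power_abs using A1 by (intro power_le_one) auto
      show "card e = 2 \<and> e \<subseteq> ?V" if "e \<in> ?E" for e using G that by (auto simp: loopless_multigraph_def)
    qed (use e0 in \<open>auto simp: \<phi>_def\<close>)
    moreover have "real (n * 2 ^ k) ^ card ?V > 0" using nk[of k] by simp
    moreover have "\<bar>X / D\<bar> \<le> 1 / s" if "\<bar>X\<bar> * s \<le> D" "D > 0" "s > 0" for X D s :: real
      using that by (simp add: field_simps)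
    ultimately have "\<bar>(\<Sum>v\<in>PiE ?V (\<lambda>_. {..<n * 2 ^ k}). \<Prod>e\<in>?E. \<phi> e (v ` e)) / real (n * 2 ^ k) ^ card ?V\<bar> \<le> 1 / sqrt (2 ^ k)"
      by simp
    then show ?thesis by (simp only: \<phi>_def)
  qed
  have "(\<lambda>k. 1 / sqrt (2 ^ k)) \<longlonglongrightarrow> 0" by (rule inverse_sqrt_power_tendsto)
  then have lim0: "(\<lambda>k. ?S k S) \<longlonglongrightarrow> 0" if "S \<in> Pow ?E - {{}}" for S
    by (rule Lim_null_comparison[rotated]) (use small[OF that] in simp)
  have "(\<lambda>k. (1 / 2) ^ card ?E * (hom_density G (step_kernel n A) + (\<Sum>S\<in>Pow ?E - {{}}. ?S k S))) \<longlonglongrightarrow>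
     (1 / 2) ^ card ?E * (hom_density G (step_kernel n A) + (\<Sum>S\<in>Pow ?E - {{}}. 0))"
    by (intro tendsto_intros lim0)
  moreover have "(\<Sum>S\<in>Pow ?E. ?S k S) = hom_density G (step_kernel n A) + (\<Sum>S\<in>Pow ?E - {{}}. ?S k S)" for k
    using sum.remove[of "Pow ?E" "{}" "?S k"] empty[of k] by simp
  ultimately show ?thesis unfolding expand by simp
qed

lemma block_weight_bound:
  assumes S: "S \<in> sets unit_interval" and i: "i < n"
  shows "\<bar>real n * (LINT x|unit_interval. indicator S x * of_bool (block n x = i))\<bar> \<le> 1"
proof -
  have [measurable]: "S \<in> sets unit_interval" by (rule S)
  let ?I = "LINT x|unit_interval. indicator S x * of_bool (block n x = i) :: real"
  have "?I \<le> (LINT x|unit_interval. of_bool (block n x = i))"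
    by (intro integral_mono unit_interval.integrable_const_bound[of _ 1]) (auto simp: indicator_def)
  then have "?I \<le> 1 / n" using integral_block_eq[OF i] by simp
  moreover have "?I \<ge> 0" by (intro Bochner_Integration.integral_nonneg) auto
  ultimately show ?thesis using i by (simp add: abs_mult field_simps)
qed

lemma cut_norm_hadamard_le:
  assumes n: "n > 0" and B: "\<And>e. \<bar>B e\<bar> \<le> 1"
  shows "cut_norm (step_kernel (n * 2 ^ k) (\<lambda>e. B ((\<lambda>i. i div 2 ^ k) ` e) * hadamard_slot k e)) \<le> 1 / sqrt (2 ^ k)"
proof -
  let ?M = "n * 2 ^ k" let ?C = "\<lambda>e. B ((\<lambda>i. i div 2 ^ k) ` e) * hadamard_slot k e"
  have M: "?M > 0" using n by simp
  have "\<bar>LINT z:S \<times> T|unit_square. step_kernel ?M ?C z\<bar> \<le> 1 / sqrt (2 ^ k)"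
    if S: "S \<in> sets unit_interval" and T: "T \<in> sets unit_interval" for S T
  proof -
    define u where "u i = real ?M * (LINT x|unit_interval. indicator S x * of_bool (block ?M x = i))" for i
    define w where "w i = real ?M * (LINT x|unit_interval. indicator T x * of_bool (block ?M x = i))" for i
    have uw: "\<bar>u i\<bar> \<le> 1" "\<bar>w i\<bar> \<le> 1" if "i < ?M" for i
      unfolding u_def w_def using that by (intro block_weight_bound S T; simp)+
    have "(LINT z:S \<times> T|unit_square. step_kernel ?M ?C z) =
      (LINT z|unit_square. indicator S (fst z) * indicator T (snd z) * (\<lambda>i j. ?C {i, j}) (block ?M (fst z)) (block ?M (snd z)))"
      unfolding set_lebesgue_integral_def step_kernel_def
      by (intro Bochner_Integration.integral_cong refl) (auto simp: indicator_def)
    also have "\<dots> = (\<Sum>i<?M. \<Sum>j<?M. ?C {i, j} * ((LINT x|unit_interval. indicator S x * of_bool (block ?M x = i)) * (LINT x|unit_interval. indicator T x * of_bool (block ?M x = j))))"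
      using S T by (intro integral_square_block_weighted M) (auto simp: indicator_def)
    also have "\<dots> = (\<Sum>i<?M. \<Sum>j<?M. u i * w j * ?C {i, j}) / (real ?M)\<^sup>2"
      using M by (simp add: u_def w_def sum_divide_distrib power2_eq_square mult_ac)
    finally have "\<bar>LINT z:S \<times> T|unit_square. step_kernel ?M ?C z\<bar> = \<bar>\<Sum>i<?M. \<Sum>j<?M. u i * w j * ?C {i, j}\<bar> / (real ?M)\<^sup>2"
      by (simp only: abs_divide abs_power2)
    also have "\<dots> \<le> (real n)\<^sup>2 * (2 ^ k * sqrt (2 ^ k)) / (real ?M)\<^sup>2"
      using uw B by (intro divide_right_mono hadamard_block_bound) auto
    also have "\<dots> = 1 / sqrt (2 ^ k)"
    proof -
      define s where "s = sqrt (2 ^ k :: real)"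
      have "s > 0" "2 ^ k = s\<^sup>2" by (simp_all add: s_def)
      then show ?thesis using n unfolding s_def[symmetric]
        by (simp add: power2_eq_square field_simps)
    qed
    finally show ?thesis .
  qed
  then show ?thesis unfolding cut_norm_def by (intro cSUP_least) auto
qed

lemma hom_density_scale:
  assumes "loopless_multigraph G" "n > 0"
  shows "hom_density G (step_kernel n (\<lambda>e. c * A e)) = c ^ size (edges G) * hom_density G (step_kernel n A)"
  unfolding hom_density_step_kernel[OF assms] by (simp add: prod_mset.distrib sum_distrib_left)

lemma cut_norm_quasirandom_le:
  assumes n: "n > 0" and A: "A \<in> cube"
  shows "cut_norm (\<lambda>z. step_kernel (n * 2 ^ k) (quasirandom k A) z - step_kernel n (\<lambda>e. 1 / 2 * A e) z) \<le> 1 / sqrt (2 ^ k)"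
proof -
  have "\<bar>1 / 2 * A e\<bar> \<le> 1" for e
  proof -
    have "A e \<in> {0..1}" using A unfolding cube_def by blast
    then show ?thesis by simp
  qed
  moreover have "step_kernel n (\<lambda>e. 1 / 2 * A e) = step_kernel (n * 2 ^ k) (\<lambda>e. 1 / 2 * A ((\<lambda>i. i div 2 ^ k) ` e))"
    using step_kernel_refine[OF n, of "2 ^ k" "\<lambda>e. 1 / 2 * A e"] by simp
  then have "(\<lambda>z. step_kernel (n * 2 ^ k) (quasirandom k A) z - step_kernel n (\<lambda>e. 1 / 2 * A e) z) =
    step_kernel (n * 2 ^ k) (\<lambda>e. (\<lambda>e. 1 / 2 * A e) ((\<lambda>i. i div 2 ^ k) ` e) * hadamard_slot k e)"
    by (auto simp: step_kernel_def quasirandom_def fun_eq_iff algebra_simps add_divide_distrib)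
  ultimately show ?thesis using cut_norm_hadamard_le[OF n, of "\<lambda>e. 1 / 2 * A e" k] by simp
qed

lemma hom_density_expansion_tendsto:
  assumes "hom_density_expansion N c F" "\<And>k. g k \<in> graphons"
    and "\<And>H. H \<in> multigraph_classes_upto N \<Longrightarrow> (\<lambda>k. class_density H (g k)) \<longlonglongrightarrow> l H"
  shows "(\<lambda>k. F (g k)) \<longlonglongrightarrow> (\<Sum>H\<in>multigraph_classes_upto N. c H * l H)"
proof -
  have "(\<lambda>k. F (g k)) = (\<lambda>k. \<Sum>H\<in>multigraph_classes_upto N. c H * class_density H (g k))"
    using assms(1,2) by (simp add: hom_density_expansion_def)
  then show ?thesis using assms(3) by (auto intro!: tendsto_intros)
qed

lemma card_set_mset_less_size:
  assumes "count M e > 1"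
  shows "card (set_mset M) < size M"
proof -
  have "(\<Sum>x\<in>set_mset M. 1) < (\<Sum>x\<in>set_mset M. count M x)"
    using assms by (intro sum_strict_mono_ex1) (auto simp: Suc_le_eq intro!: bexI[of _ e] simp flip: count_greater_zero_iff)
  then show ?thesis by (simp add: size_multiset_overloaded_eq)
qed

lemma cut_continuous_imp_simple:
  assumes F: "continuous_wrt cut_norm F" and c: "hom_density_expansion N c F"
    and H: "H \<in> multigraph_classes_upto N" "\<not> simple_class H"
  shows "c H = 0"
proof -
  let ?E = "\<lambda>H. edges (representative H)"
  have cd: "class_density H = hom_density (representative H)" for H by (simp add: class_density_def fun_eq_iff)
  define d where "d H = c H * ((1 / 2) ^ card (set_mset (?E H)) - (1 / 2) ^ size (?E H))" for H
  have "(\<Sum>H\<in>multigraph_classes_upto N. d H * class_density H (step_kernel n A)) = 0" if n: "n > 0" and A: "A \<in> cube" for n A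
  proof -
    let ?W = "\<lambda>k. step_kernel (n * 2 ^ k) (quasirandom k A)" let ?g = "step_kernel n (\<lambda>e. 1 / 2 * A e)"
    have W: "?W k \<in> graphons" for k by (intro step_kernel_graphon quasirandom_cube A)
    have "(\<lambda>e. 1 / 2 * A e) \<in> cube"
    proof -
      have "1 / 2 * A e \<in> {0..1}" for e
      proof -
        have "A e \<in> {0..1}" using A unfolding cube_def by blast
        then show ?thesis by simp
      qed
      then show ?thesis unfolding cube_def by blast
    qed
    then have g: "?g \<in> graphons" by (rule step_kernel_graphon)
    have "(\<lambda>k. F (?W k)) \<longlonglongrightarrow> F ?g"
    proof (rule tendstoI)
      fix \<epsilon> :: real assume \<epsilon>: "\<epsilon> > 0"
      obtain \<delta> where \<delta>: "\<delta> > 0" "\<And>h. h \<in> graphons \<Longrightarrow> cut_norm (\<lambda>z. h z - ?g z) < \<delta> \<Longrightarrow> \<bar>F h - F ?g\<bar> < \<epsilon>"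
        using F[unfolded continuous_wrt_def, rule_format, OF g \<epsilon>] by blast
      have "(\<lambda>k. 1 / sqrt (2 ^ k)) \<longlonglongrightarrow> 0" by (rule inverse_sqrt_power_tendsto)
      then have "\<forall>\<^sub>F k in sequentially. 1 / sqrt (2 ^ k) < \<delta>" using \<delta>(1) by (rule order_tendstoD(2))
      then show "\<forall>\<^sub>F k in sequentially. dist (F (?W k)) (F ?g) < \<epsilon>"
      proof eventually_elim
        case (elim k)
        then have "cut_norm (\<lambda>z. ?W k z - ?g z) < \<delta>" using cut_norm_quasirandom_le[OF n A, of k] by linarith
        then show ?case using \<delta>(2)[OF W] by (simp add: dist_real_def)
      qed
    qed
    moreover have "(\<lambda>k. F (?W k)) \<longlonglongrightarrow> (\<Sum>H\<in>multigraph_classes_upto N. c H * ((1 / 2) ^ card (set_mset (?E H)) * class_density H (step_kernel n A)))"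
      unfolding cd by (intro hom_density_expansion_tendsto[OF c W, unfolded cd] hom_density_quasirandom n A representative_loopless)
    ultimately have "F ?g = (\<Sum>H\<in>multigraph_classes_upto N. c H * ((1 / 2) ^ card (set_mset (?E H)) * class_density H (step_kernel n A)))"
      by (rule LIMSEQ_unique)
    moreover have "F ?g = (\<Sum>H\<in>multigraph_classes_upto N. c H * ((1 / 2) ^ size (?E H) * class_density H (step_kernel n A)))"
    proof -
      have "F ?g = (\<Sum>H\<in>multigraph_classes_upto N. c H * class_density H ?g)"
        using c g by (simp add: hom_density_expansion_def)
      also have "\<dots> = (\<Sum>H\<in>multigraph_classes_upto N. c H * ((1 / 2) ^ size (?E H) * class_density H (step_kernel n A)))"
        unfolding cd by (intro sum.cong[OF refl] arg_cong2[where f="(*)"] refl hom_density_scale[OF _ n] representative_loopless)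
      finally show ?thesis .
    qed
    ultimately have "(\<Sum>H\<in>multigraph_classes_upto N. c H * ((1 / 2) ^ card (set_mset (?E H)) * class_density H (step_kernel n A))) -
      (\<Sum>H\<in>multigraph_classes_upto N. c H * ((1 / 2) ^ size (?E H) * class_density H (step_kernel n A))) = 0" by linarith
    then show ?thesis unfolding sum_subtractf[symmetric] d_def by (simp add: algebra_simps)
  qed
  then have "d H = 0" using H(1) by (rule class_densities_independent)
  moreover have "(1 / 2 :: real) ^ card (set_mset (?E H)) \<noteq> (1 / 2) ^ size (?E H)"
  proof -
    obtain e where "count (?E H) e > 1" using H(2) by (auto simp: simple_class_def simple_multigraph_def not_le)
    then have "card (set_mset (?E H)) < size (?E H)" by (rule card_set_mset_less_size)
    then have "(1 / 2 :: real) ^ size (?E H) < (1 / 2) ^ card (set_mset (?E H))"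
      by (intro power_strict_decreasing) auto
    then show ?thesis by (rule less_imp_neq[symmetric])
  qed
  ultimately show ?thesis by (simp add: d_def)
qed

lemma hom_density_expansion_unique:
  assumes "hom_density_expansion N c F" "hom_density_expansion N c' F" and H: "H \<in> multigraph_classes_upto N"
  shows "c H = c' H"
proof -
  have "(\<Sum>H\<in>multigraph_classes_upto N. (c H - c' H) * class_density H (step_kernel n A)) = 0" if "n > 0" "A \<in> cube" for n A
    using assms(1,2) step_kernel_graphon[OF that(2), of n]
    by (simp add: hom_density_expansion_def left_diff_distrib sum_subtractf)
  then have "c H - c' H = 0" using H by (rule class_densities_independent[where d = "\<lambda>H. c H - c' H"])
  then show ?thesis by simp
qed

lemma expansion_imp_gateaux_zero:
  assumes c: "hom_density_expansion N c F" and f: "f \<in> graphons" and g: "\<forall>i<N + 1. g i \<in> Adm f"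
  shows "gateaux F g (N + 1) f = 0"
proof -
  let ?\<Phi> = "\<lambda>f. \<Sum>H\<in>multigraph_classes_upto N. c H * class_density H f"
  have "gateaux_polynomial (Suc N) (class_density H)" if "H \<in> multigraph_classes_upto N" for H
  proof -
    have "class_density H = hom_density (representative H)" by (simp add: class_density_def fun_eq_iff)
    then show ?thesis using gateaux_polynomial_hom_density representative_loopless[OF that] by simp
  qed
  then have gp: "gateaux_polynomial (Suc N) ?\<Phi>"
    by (intro gateaux_polynomial_sum finite_multigraph_classes_upto)
  have Feq: "F f = ?\<Phi> f" if "f \<in> graphons" for f using c that by (simp add: hom_density_expansion_def)
  have gk: "g i \<in> kernels" if "i < Suc N" for i using g that by (simp add: Adm_def)
  have "\<exists>\<Psi>. gateaux_polynomial (Suc N - Suc N) \<Psi> \<and>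
    (\<forall>f\<in>graphons. (\<forall>i<Suc N. g i \<in> Adm f) \<longrightarrow> gateaux F g (Suc N) f = \<Psi> f)"
    using gp Feq gk order_refl by (rule gateaux_eq_polynomial)
  then obtain \<Psi> where \<Psi>: "gateaux_polynomial 0 \<Psi>" "\<And>f. f \<in> graphons \<Longrightarrow> (\<forall>i<Suc N. g i \<in> Adm f) \<Longrightarrow> gateaux F g (Suc N) f = \<Psi> f"
    unfolding diff_self_eq_0 by blast
  have "gateaux F g (Suc N) f = \<Psi> f" using g by (intro \<Psi>(2)[OF f]) simp
  also have "\<dots> = 0" using \<Psi>(1) f by (simp add: graphons_def)
  finally show ?thesis by simp
qed

theorem theorem1:
  fixes N :: nat and F :: "kernel \<Rightarrow> real"
  assumes "class_function F"
    and "continuous_wrt L1_norm F"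
    and "times_gateaux_differentiable (N + 1) F"
  shows "((\<forall>f\<in>graphons. \<forall>g. (\<forall>i<N + 1. g i \<in> Adm f) \<longrightarrow> gateaux F g (N + 1) f = 0)
            \<longleftrightarrow> (\<exists>c. hom_density_expansion N c F))
       \<and> (\<forall>c c'. hom_density_expansion N c F \<and> hom_density_expansion N c' F \<longrightarrow>
            (\<forall>H\<in>multigraph_classes_upto N. c H = c' H))
       \<and> (continuous_wrt cut_norm F \<longrightarrow>
            (\<forall>c. hom_density_expansion N c F \<longrightarrow>
               (\<forall>H\<in>multigraph_classes_upto N. \<not> simple_class H \<longrightarrow> c H = 0)))"
proof (intro conjI iffI)
  assume "\<forall>f\<in>graphons. \<forall>g. (\<forall>i<N + 1. g i \<in> Adm f) \<longrightarrow> gateaux F g (N + 1) f = 0"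
  with assms show "\<exists>c. hom_density_expansion N c F" by (rule gateaux_zero_imp_expansion)
next
  assume "\<exists>c. hom_density_expansion N c F"
  then obtain c where "hom_density_expansion N c F" ..
  then show "\<forall>f\<in>graphons. \<forall>g. (\<forall>i<N + 1. g i \<in> Adm f) \<longrightarrow> gateaux F g (N + 1) f = 0"
    using expansion_imp_gateaux_zero by blast
next
  show "\<forall>c c'. hom_density_expansion N c F \<and> hom_density_expansion N c' F \<longrightarrow>
      (\<forall>H\<in>multigraph_classes_upto N. c H = c' H)"
    using hom_density_expansion_unique by blast
next
  show "continuous_wrt cut_norm F \<longrightarrow> (\<forall>c. hom_density_expansion N c F \<longrightarrow>
      (\<forall>H\<in>multigraph_classes_upto N. \<not> simple_class H \<longrightarrow> c H = 0))"
    using cut_continuous_imp_simple by blast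
qed

end
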